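(* Let $\beta>0$ be a constant and let $p=p(n)$ satisfy $p=\omega\left(\log^8 n/n\right)$. Then with probability tending to $1$ as $n\to\infty$, a random digraph $G\sim D(n,p)$ satisfies $r(G,\mathcal{HAM})\in\left(\tfrac12-\beta,\ \tfrac12+\beta\right)$.
   Context: $D(n,p)$ is the random digraph on vertex set $[n]$ in which each of the $n(n-1)$ ordered pairs $(u,v)$, $u\neq v$, is included as an arc independently with probability $p$. $\mathcal{HAM}$ denotes the property of containing a directed Hamilton cycle (a directed cycle through all vertices). For a digraph $G$ and a monotone increasing property $\mathcal P$, the local resilience is $r(G,\mathcal P):=\min\{r:\ \exists H\subseteq G$ such that for all $v\in V(G)$, $d^+_H(v)\le r\, d^+_G(v)$ and $d^-_H(v)\le r\, d^-_G(v)$, and $G-H$ does not have $\mathcal P\}$, where $d^+$, $d^-$ denote out- and in-degree and $G-H$ is $G$ with the arcs of $H$ deleted. *)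

theory Defs
  imports
    "HOL-Probability.Product_PMF"
    "HOL-Library.Landau_Symbols"
    "Graph_Theory.Digraph_Component"
begin

definition arc_pairs :: "nat \<Rightarrow> (nat \<times> nat) set" where
  "arc_pairs n = {(u, v). u \<in> {1..n} \<and> v \<in> {1..n} \<and> u \<noteq> v}"

text \<open>
  The distribution $D(n,p)$. Note that \<^term>\<open>bernoulli_pmf p\<close> is the intended distribution
  only for $0 \le p \le 1$.
\<close>
definition random_digraph :: "nat \<Rightarrow> real \<Rightarrow> (nat, nat \<times> nat) pre_digraph pmf" where
  "random_digraph n p =
     map_pmf (\<lambda>f. \<lparr>verts = {1..n}, arcs = {a \<in> arc_pairs n. f a}, tail = fst, head = snd\<rparr>)
       (Pi_pmf (arc_pairs n) False (\<lambda>_. bernoulli_pmf p))"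

definition hamiltonian :: "('a, 'b) pre_digraph \<Rightarrow> bool" where
  "hamiltonian G \<longleftrightarrow>
     (\<exists>u c. pre_digraph.cycle G c \<and> pre_digraph.awalk G u c u \<and>
            set (pre_digraph.awalk_verts G u c) = verts G)"

definition delete_arcs :: "('a, 'b) pre_digraph \<Rightarrow> ('a, 'b) pre_digraph \<Rightarrow> ('a, 'b) pre_digraph" where
  "delete_arcs G H = G\<lparr>arcs := arcs G - arcs H\<rparr>"

definition breaks :: "(('a, 'b) pre_digraph \<Rightarrow> bool) \<Rightarrow> ('a, 'b) pre_digraph \<Rightarrow> real \<Rightarrow> bool" where
  "breaks P G r \<longleftrightarrow>
     (\<exists>H. subgraph H G \<and>
          (\<forall>v \<in> verts G. real (out_degree H v) \<le> r * real (out_degree G v) \<and>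
                         real (in_degree H v) \<le> r * real (in_degree G v)) \<and>
          \<not> P (delete_arcs G H))"

text \<open>
  The constraint $r \ge 0$ only matters if $G$ has no arcs: then every real $r$ would be
  admissible and the minimum would not exist. That the minimum is attained is
  shown in \<open>local_resilience_attained\<close> below.
\<close>
definition local_resilience :: "('a, 'b) pre_digraph \<Rightarrow> (('a, 'b) pre_digraph \<Rightarrow> bool) \<Rightarrow> real" where
  "local_resilience G P = (LEAST r. 0 \<le> r \<and> breaks P G r)"

lemma local_resilience_attained:
  fixes G :: "('a, 'b) pre_digraph"
  assumes fin: "fin_digraph G" and nP: "\<not> P (G\<lparr>arcs := {}\<rparr>)"
  shows "0 \<le> local_resilience G P" "breaks P G (local_resilience G P)"
    and "\<And>r. 0 \<le> r \<Longrightarrow> breaks P G r \<Longrightarrow> local_resilience G P \<le> r"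
proof -
  interpret fin_digraph G by (rule fin)
  define S where "S = {r::real. 0 \<le> r \<and> breaks P G r}"
  define g where "g E = G\<lparr>arcs := E\<rparr>" for E
  define T where "T E = {r::real. 0 \<le> r} \<inter> (\<Inter>v\<in>verts G.
      {r. real (out_degree (g E) v) \<le> r * real (out_degree G v)} \<inter>
      {r. real (in_degree (g E) v) \<le> r * real (in_degree G v)})" for E
  define F where "F = {E. E \<subseteq> arcs G \<and> \<not> P (G\<lparr>arcs := arcs G - E\<rparr>)}"
  have deg: "out_degree H v = out_degree (g (arcs H)) v" "in_degree H v = in_degree (g (arcs H)) v"
    if "subgraph H G" for H v
    using that by (auto simp: subgraph_def compatible_def out_degree_def out_arcs_def
        in_degree_def in_arcs_def g_def)
  have sg: "subgraph (g E) G" if "E \<subseteq> arcs G" for E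
    using that wf_digraph_axioms
    by (auto simp: subgraph_def compatible_def g_def wf_digraph_def)
  have S_eq: "S = (\<Union>E\<in>F. T E)"
  proof (intro equalityI subsetI)
    fix r assume "r \<in> S"
    then obtain H where H: "0 \<le> r" "subgraph H G" "\<not> P (delete_arcs G H)"
      "\<forall>v \<in> verts G. real (out_degree H v) \<le> r * real (out_degree G v) \<and>
                     real (in_degree H v) \<le> r * real (in_degree G v)"
      by (auto simp: S_def breaks_def)
    have "arcs H \<in> F" using H by (auto simp: F_def delete_arcs_def subgraph_def)
    moreover have "r \<in> T (arcs H)" using H deg[OF H(2)] by (auto simp: T_def)
    ultimately show "r \<in> (\<Union>E\<in>F. T E)" by blast
  next
    fix r assume "r \<in> (\<Union>E\<in>F. T E)"
    then obtain E where E: "E \<in> F" "r \<in> T E" by blast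
    have "breaks P G r" unfolding breaks_def
      by (rule exI[of _ "g E"]) (use E sg in \<open>auto simp: T_def F_def delete_arcs_def g_def\<close>)
    then show "r \<in> S" using E by (auto simp: S_def T_def)
  qed
  have "finite F" by (rule finite_subset[of _ "Pow (arcs G)"]) (auto simp: F_def)
  moreover have "closed (T E)" for E unfolding T_def
    by (intro closed_Int closed_INT ballI closed_Collect_le continuous_intros)
  ultimately have cl: "closed S" unfolding S_eq by (intro closed_UN) auto
  have "arcs G \<in> F" "1 \<in> T (arcs G)" using nP by (auto simp: F_def T_def g_def)
  then have ne: "S \<noteq> {}" unfolding S_eq by blast
  have bd: "bdd_below S" by (rule bdd_belowI[of _ 0]) (auto simp: S_def)
  have mem: "Inf S \<in> S" by (rule closed_contains_Inf[OF ne bd cl])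
  have "local_resilience G P = Inf S" unfolding local_resilience_def
    by (rule Least_equality) (use mem bd in \<open>auto simp: S_def intro: cInf_lower\<close>)
  then show "0 \<le> local_resilience G P" "breaks P G (local_resilience G P)"
    and "\<And>r. 0 \<le> r \<Longrightarrow> breaks P G r \<Longrightarrow> local_resilience G P \<le> r"
    using mem bd by (auto simp: S_def intro: cInf_lower)
qed

lemma not_hamiltonian_no_arcs: "\<not> hamiltonian (G\<lparr>arcs := {}\<rparr>)"
  by (auto simp: hamiltonian_def pre_digraph.cycle_def pre_digraph.awalk_def)

end

(*
  Deleting all arcs from one half of the vertices to the other destroys every Hamilton cycle, which
  gives the upper bound.  For the lower bound, two facts about G survive the deletion of H: every
  semidegree of G - H is at least (1/2 + b') n p, and for all vertex sets X, Y the number of arcs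
  from X to Y is at most (1 + d) p |X| |Y| + O(log n) (|X| + |Y|).  Together they make every set X
  expand, by a factor 8 or to more than half, into any set W that receives its fair share of all
  neighbourhoods; a random colouring provides polylogarithmically many disjoint sets W of this kind.

  A gadget is an alternating closed walk u_0 -> w_0 <- u_J -> w_J <- ... <- u_1 -> w_1 <- u_0 (J odd).
  Its arcs u_i -> w_i can be replaced by the arcs u_i -> w_{i+1}.  Directed paths link w_i to u_{i+1},
  and link the gadgets cyclically, so that all u_i with i > 0 lie on one cycle C.  Perfect matchings
  between consecutive blocks of the remaining vertices complete this to a 1-factor in which every
  cycle other than C contains the vertex u_0 of some gadget.  Switching a gadget whose u_0 is not on
  the cycle of its other u_i merges the two cycles; doing this for one gadget after the other leaves
  a Hamilton cycle.
*)
theory Submission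
  imports Defs "HOL-Real_Asymp.Real_Asymp"
begin

section \<open>Expansion and perfect matchings\<close>

text \<open>Semidegrees just above half of n p make every expansion stop slightly above half of its
  target. This suffices for two purposes. Two such sets in one layer meet, which closes a path
  searched from both ends. And Hall's condition cannot fail, because a violator and its counterpart
  on the other side would both have to exceed half. Neither controls the number of cycles of a
  1-factor; the matchings are therefore only asked for paths that end in prepared vertices u_0, and
  there are as many gadgets as such paths. A single J of order log n bounds the size of a gadget,
  the number of rounds, each of which routes half of the remaining requests, and half the length of
  the routes. J rounds, 2 J + 1 layers per round and layers of O(J) classes, which must outweigh J +
  1 requests per gadget, give O(J^3) colour classes. These are at most log^4 n for large n, so p n
  >= log^8 n leaves each class a share of order log^4 n in every neighbourhood. This dominates the
  O(log n) that concentration and the additive error in the arc counts require.\<close>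

text \<open>Hall's theorem by splitting at a tight set. If a proper nonempty \<open>X'\<close> has
  no surplus, it is matched into its own image; the rest keeps Hall's condition in
  \<open>R2\<close>, which avoids that image, because \<open>Y \<union> X'\<close> satisfies it in
  \<open>R\<close>. Otherwise every proper nonempty subset has a surplus of one, which pays for
  deleting an arbitrary matched pair.\<close>

lemma marriage:
  fixes R :: "('a \<times> 'b) set"
  assumes "finite X" "finite (R `` X)" "\<And>X'. X' \<subseteq> X \<Longrightarrow> card X' \<le> card (R `` X')"
  shows "\<exists>h. inj_on h X \<and> (\<forall>x\<in>X. (x, h x) \<in> R)"
  using assms
proof (induction "card X" arbitrary: X R rule: less_induct)
  case less
  note finX = less.prems(1) and finR = less.prems(2) and hall = less.prems(3)
  show ?case
  proof (cases "\<exists>X'. X' \<subset> X \<and> X' \<noteq> {} \<and> card (R `` X') \<le> card X'")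
    case True
    then obtain X' where X': "X' \<subset> X" "X' \<noteq> {}" "card (R `` X') \<le> card X'" by blast
    have finX': "finite X'" using X' finX by (meson finite_subset psubset_imp_subset)
    have finRX': "finite (R `` X')" by (rule finite_subset[OF _ finR]) (use X' in blast)
    have "\<exists>h. inj_on h X' \<and> (\<forall>x\<in>X'. (x, h x) \<in> R)"
    proof (rule less.hyps)
      show "card X' < card X" using X' finX by (simp add: psubset_card_mono)
      show "card Y \<le> card (R `` Y)" if "Y \<subseteq> X'" for Y using that X' hall by blast
    qed (use finX' finRX' in auto)
    then obtain h1 where h1: "inj_on h1 X'" "\<And>x. x \<in> X' \<Longrightarrow> (x, h1 x) \<in> R" by blast
    define R2 where "R2 = {(a, b) \<in> R. b \<notin> R `` X'}"
    have sub: "R2 \<subseteq> R" by (auto simp: R2_def)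
    have "\<exists>h. inj_on h (X - X') \<and> (\<forall>x\<in>X - X'. (x, h x) \<in> R2)"
    proof (rule less.hyps)
      have "X - X' \<subset> X" using X' by blast
      then show "card (X - X') < card X" using finX by (rule psubset_card_mono[rotated])
      show "finite (R2 `` (X - X'))"
        by (rule finite_subset[OF Image_mono[OF sub Diff_subset] finR])
      fix Y assume Y: "Y \<subseteq> X - X'"
      have finY: "finite Y" using Y finX finite_subset by blast
      have eq: "R `` (Y \<union> X') = R2 `` Y \<union> R `` X'" by (auto simp: R2_def)
      have fin2: "finite (R2 `` Y)"
        by (rule finite_subset[OF _ finR]) (use Y sub in blast)
      have "card Y + card X' = card (Y \<union> X')"
        using Y by (subst card_Un_disjoint) (auto simp: finY finX')
      also have "\<dots> \<le> card (R `` (Y \<union> X'))" by (rule hall) (use Y X' in auto)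
      also have "\<dots> = card (R2 `` Y) + card (R `` X')"
        unfolding eq by (subst card_Un_disjoint) (use fin2 finRX' in \<open>auto simp: R2_def\<close>)
      finally show "card Y \<le> card (R2 `` Y)" using X'(3) by linarith
    qed (use finX in auto)
    then obtain h2 where "inj_on h2 (X - X') \<and> (\<forall>x\<in>X - X'. (x, h2 x) \<in> R2)" ..
    note h2 = conjunct1[OF this] bspec[OF conjunct2[OF this]]
    define h where "h x = (if x \<in> X' then h1 x else h2 x)" for x
    have ne: "h1 x \<noteq> h2 z" if "x \<in> X'" "z \<in> X - X'" for x z
    proof -
      have "h2 z \<notin> R `` X'" using h2(2)[OF that(2)] by (simp add: R2_def)
      moreover have "h1 x \<in> R `` X'" by (rule ImageI[OF h1(2)[OF that(1)] that(1)])
      ultimately show ?thesis by metis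
    qed
    have "inj_on h X"
    proof (rule inj_onI)
      fix x z assume xz: "x \<in> X" "z \<in> X" "h x = h z"
      show "x = z"
        using xz ne[of x z] ne[of z x] inj_onD[OF h1(1), of x z] inj_onD[OF h2(1), of x z]
        by (cases "x \<in> X'"; cases "z \<in> X'") (simp_all add: h_def)
    qed
    moreover have "\<forall>x\<in>X. (x, h x) \<in> R"
      using h1(2) h2(2) sub by (simp add: h_def subset_iff)
    ultimately show ?thesis by blast
  next
    case False
    show ?thesis
    proof (cases "X = {}")
      case False': False
      then obtain x where x: "x \<in> X" by blast
      have "card {x} \<le> card (R `` {x})" by (rule hall) (use x in auto)
      then obtain y where y: "(x, y) \<in> R" by (cases "R `` {x} = {}") auto
      define R2 where "R2 = {(a, b) \<in> R. b \<noteq> y}"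
      have sub: "R2 \<subseteq> R" by (auto simp: R2_def)
      have "\<exists>h. inj_on h (X - {x}) \<and> (\<forall>z\<in>X - {x}. (z, h z) \<in> R2)"
      proof (rule less.hyps)
        show "card (X - {x}) < card X" by (rule card_Diff1_less[OF finX x])
        show "finite (R2 `` (X - {x}))"
          by (rule finite_subset[OF Image_mono[OF sub Diff_subset] finR])
        fix Y assume Y: "Y \<subseteq> X - {x}"
        show "card Y \<le> card (R2 `` Y)"
        proof (cases "Y = {}")
          case False'': False
          have fin: "finite (R `` Y)" by (rule finite_subset[OF _ finR]) (use Y in auto)
          have "R `` Y \<subseteq> insert y (R2 `` Y)" by (auto simp: R2_def)
          moreover have fin2: "finite (R2 `` Y)" by (rule finite_subset[OF _ fin]) (use sub in blast)
          ultimately have "card (R `` Y) \<le> card (insert y (R2 `` Y))" by (intro card_mono) auto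
          also have "\<dots> \<le> Suc (card (R2 `` Y))" using fin2 by (simp add: card_insert_if)
          finally have "card (R `` Y) \<le> Suc (card (R2 `` Y))" .
          moreover have "card Y < card (R `` Y)" proof -
            have "Y \<subset> X" using Y x by blast
            then show ?thesis using False False'' not_le by blast
          qed
          ultimately show ?thesis by linarith
        qed auto
      qed (use finX in auto)
      then obtain h where "inj_on h (X - {x}) \<and> (\<forall>z\<in>X - {x}. (z, h z) \<in> R2)" ..
      note h = conjunct1[OF this] bspec[OF conjunct2[OF this]]
      have ny: "h z \<noteq> y" if "z \<in> X - {x}" for z using h(2)[OF that] by (simp add: R2_def)
      have "inj_on (h(x := y)) X"
      proof (rule inj_onI)
        fix v w assume vw: "v \<in> X" "w \<in> X" "(h(x := y)) v = (h(x := y)) w"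
        show "v = w" using vw ny[of v] ny[of w] inj_onD[OF h(1), of v w]
          by (cases "v = x"; cases "w = x") simp_all
      qed
      moreover have "\<forall>z\<in>X. (z, (h(x := y)) z) \<in> R" using h(2) y sub by (simp add: subset_iff)
      ultimately show ?thesis by blast
    qed auto
  qed
qed

text \<open>In applications the cap \<theta> is at least half of the sets involved. The factor 8
  leaves room for discarding forbidden vertices and half of the sources in each step of a path
  search.\<close>

definition expands :: "('a \<times> 'b) set \<Rightarrow> 'a set \<Rightarrow> 'b set \<Rightarrow> real \<Rightarrow> bool" where
  "expands R D W \<theta> \<longleftrightarrow>
     (\<forall>X\<subseteq>D. min (8 * real (card X)) \<theta> \<le> real (card (R `` X \<inter> W)))"

lemma expandsD:
  "expands R D W \<theta> \<Longrightarrow> X \<subseteq> D \<Longrightarrow> min (8 * real (card X)) \<theta> \<le> real (card (R `` X \<inter> W))"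
  by (auto simp: expands_def)

lemma expands_subset: "expands R D W \<theta> \<Longrightarrow> D' \<subseteq> D \<Longrightarrow> expands R D' W \<theta>"
  unfolding expands_def by blast

text \<open>A Hall violator \<open>X'\<close> is larger than its image, so its expansion is capped
  and |X'| > \<theta>. The complement \<open>Y'\<close> of the image sees only
  \<open>X - X'\<close>, which is smaller than \<open>Y'\<close>, so it is capped as well and |X| -
  |X'| >= \<theta>. The sum contradicts |X| <= 2 \<theta>.\<close>

lemma perfect_matching:
  assumes fin: "finite X" "finite Y" "card X = card Y"
    and R: "expands R X Y \<theta>" "expands (R\<inverse>) Y X \<theta>" and th: "real (card X) \<le> 2 * \<theta>"
  shows "\<exists>h. bij_betw h X Y \<and> (\<forall>x\<in>X. (x, h x) \<in> R)"
proof -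
  define R2 where "R2 = R \<inter> UNIV \<times> Y"
  have im: "R2 `` X' = R `` X' \<inter> Y" for X' by (auto simp: R2_def)
  have "\<exists>h. inj_on h X \<and> (\<forall>x\<in>X. (x, h x) \<in> R2)"
  proof (rule marriage)
    show "finite (R2 `` X)" using fin im by simp
    fix X' assume X': "X' \<subseteq> X"
    have finX': "finite X'" using X' fin finite_subset by blast
    show "card X' \<le> card (R2 `` X')"
    proof (rule ccontr)
      assume neg: "\<not> ?thesis"
      have 1: "\<theta> < card X'"
        using expandsD[OF R(1) X'] neg unfolding im by linarith
      define Y' where "Y' = Y - R `` X'"
      have "R\<inverse> `` Y' \<inter> X \<subseteq> X - X'" by (auto simp: Y'_def)
      then have "card (R\<inverse> `` Y' \<inter> X) \<le> card (X - X')" by (intro card_mono) (use fin in auto)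
      also have "\<dots> = card X - card X'" using X' finX' by (simp add: card_Diff_subset)
      finally have 2: "card (R\<inverse> `` Y' \<inter> X) \<le> card X - card X'" .
      have "card Y = card (R `` X' \<inter> Y) + card Y'"
        unfolding Y'_def using fin by (metis Int_commute card_Int_Diff)
      then have 3: "card Y' + card X' > card X" using neg fin unfolding im by linarith
      have 4: "card X' \<le> card X" by (rule card_mono[OF fin(1) X'])
      have "min (8 * real (card Y')) \<theta> \<le> card (R\<inverse> `` Y' \<inter> X)"
        by (rule expandsD[OF R(2)]) (auto simp: Y'_def)
      then show False using 1 2 3 4 th by linarith
    qed
  qed (use fin in auto)
  then obtain h where h: "inj_on h X" "\<And>x. x \<in> X \<Longrightarrow> (x, h x) \<in> R2" by blast
  have "h ` X \<subseteq> Y" using h by (auto simp: R2_def)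
  then have "h ` X = Y" using fin h(1) by (metis card_image card_subset_eq)
  then show ?thesis using h by (auto simp: bij_betw_def R2_def)
qed


section \<open>Merging the cycles of a permutation\<close>

text \<open>For a permutation \<open>f\<close> of a finite \<open>V\<close>, the classes on
  \<open>V\<close> are the cycles of \<open>f\<close>. Closing under both directions turns the
  merging of cycles into an inclusion of relations.\<close>

definition cyc :: "'a set \<Rightarrow> ('a \<Rightarrow> 'a) \<Rightarrow> ('a \<times> 'a) set" where
  "cyc V f = ({(x, f x) |x. x \<in> V} \<union> {(f x, x) |x. x \<in> V})\<^sup>*"

lemma cyc_refl: "(x, x) \<in> cyc V f"
  by (simp add: cyc_def)

lemma cyc_step: "x \<in> V \<Longrightarrow> (x, f x) \<in> cyc V f"
  unfolding cyc_def by (rule r_into_rtrancl) blast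

lemma cyc_trans: "(x, y) \<in> cyc V f \<Longrightarrow> (y, z) \<in> cyc V f \<Longrightarrow> (x, z) \<in> cyc V f"
  unfolding cyc_def by (rule rtrancl_trans)

lemma cyc_sym: "(x, y) \<in> cyc V f \<Longrightarrow> (y, x) \<in> cyc V f"
  unfolding cyc_def by (rule symD[OF sym_rtrancl]) (auto simp: sym_def)

lemma cyc_mono:
  assumes "\<And>x. x \<in> V \<Longrightarrow> (x, f x) \<in> cyc V g"
  shows "cyc V f \<subseteq> cyc V g"
proof -
  have "{(x, f x) |x. x \<in> V} \<union> {(f x, x) |x. x \<in> V} \<subseteq> cyc V g"
    using assms cyc_sym by fast
  then have "cyc V f \<subseteq> (cyc V g)\<^sup>*" unfolding cyc_def[of V f] by (rule rtrancl_mono)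
  also have "\<dots> = cyc V g" by (simp add: cyc_def)
  finally show ?thesis .
qed

lemma funpow_mem: "f ` V \<subseteq> V \<Longrightarrow> x \<in> V \<Longrightarrow> (f ^^ m) x \<in> V"
  by (induction m) auto

lemma cyc_funpow:
  assumes "f ` V \<subseteq> V" "x \<in> V" "\<And>k. k < m \<Longrightarrow> g ((f ^^ k) x) = f ((f ^^ k) x)"
  shows "(x, (f ^^ m) x) \<in> cyc V g"
  using assms(3)
proof (induction m)
  case 0
  then show ?case by (simp add: cyc_refl)
next
  case (Suc m)
  have "((f ^^ m) x, g ((f ^^ m) x)) \<in> cyc V g"
    by (rule cyc_step) (rule funpow_mem[OF assms(1,2)])
  then have "((f ^^ m) x, (f ^^ Suc m) x) \<in> cyc V g" using Suc.prems by simp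
  moreover have "(x, (f ^^ m) x) \<in> cyc V g" by (rule Suc.IH) (use Suc.prems in simp)
  ultimately show ?case by (rule cyc_trans[rotated])
qed

text \<open>Pigeonhole gives a repetition, and injectivity on \<open>V\<close> cancels the common
  initial part. The form \<open>(f ^^ m) (f x)\<close> guarantees at least one step.\<close>

lemma funpow_returns:
  assumes "finite V" "bij_betw f V V" "x \<in> V"
  shows "\<exists>m. (f ^^ m) (f x) = x"
proof -
  have sub: "f ` V \<subseteq> V" using assms by (simp add: bij_betw_def)
  have "\<not> inj (\<lambda>m. (f ^^ m) x)"
  proof
    assume "inj (\<lambda>m. (f ^^ m) x)"
    moreover have "range (\<lambda>m. (f ^^ m) x) \<subseteq> V" using funpow_mem[OF sub assms(3)] by blast
    ultimately show False using assms(1) finite_subset finite_imageD infinite_UNIV_nat by metis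
  qed
  then obtain a b where "a \<noteq> b" "(f ^^ a) x = (f ^^ b) x" by (auto simp: inj_on_def)
  then obtain a b where ab: "a < b" "(f ^^ a) x = (f ^^ b) x" by (metis linorder_neqE_nat)
  have inj: "inj_on (f ^^ a) V" for a
  proof (induction a)
    case (Suc a)
    have "inj_on (f \<circ> f ^^ a) V"
      by (rule comp_inj_on[OF Suc]) (rule inj_on_subset[of _ V];
        use assms funpow_mem[OF sub] in \<open>auto simp: bij_betw_def\<close>)
    then show ?case by (simp add: comp_def)
  qed auto
  obtain c where c: "b = a + Suc c" using ab(1) less_iff_Suc_add by auto
  have "(f ^^ a) ((f ^^ Suc c) x) = (f ^^ a) x"
    using ab(2) c by (metis comp_apply funpow_add)
  then have "(f ^^ Suc c) x = x"
    using inj_onD[OF inj, of a] funpow_mem[OF sub assms(3)] assms(3) by metis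
  then show ?thesis by (metis funpow_swap1 funpow.simps(2) comp_apply)
qed

text \<open>
  Composing \<open>f\<close> with the cyclic shift of \<open>u 0, \<dots>, u J\<close>. The new cycles connect \<open>u i\<close> with
  \<open>u (i + 2)\<close> and \<open>u J\<close> with \<open>u 0\<close>; as \<open>J\<close> is odd, this joins all of them.
\<close>
lemma toggle_merges:
  fixes u :: "nat \<Rightarrow> 'a"
  assumes V: "finite V" "bij_betw f V V" and J: "odd J" and u: "u ` {..J} \<subseteq> V" "inj_on u {..J}"
    and link: "\<And>i. 1 \<le> i \<Longrightarrow> i < J \<Longrightarrow>
      \<exists>m. (f ^^ m) (f (u i)) = u (Suc i) \<and> (\<forall>k<m. (f ^^ k) (f (u i)) \<notin> u ` {..J})"
    and sep: "\<And>i. 1 \<le> i \<Longrightarrow> i \<le> J \<Longrightarrow> (u 0, u i) \<notin> cyc V f"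
    and g: "g (u J) = f (u 0)" "\<And>i. i < J \<Longrightarrow> g (u i) = f (u (Suc i))"
      "\<And>x. x \<notin> u ` {..J} \<Longrightarrow> g x = f x"
  shows "bij_betw g V V" "cyc V f \<subseteq> cyc V g" "(u 0, u 1) \<in> cyc V g"
proof -
  have fV: "f ` V = V" using V by (simp add: bij_betw_def)
  have uV: "u i \<in> V" if "i \<le> J" for i using u that by auto
  have gu: "\<exists>y\<in>V. g y = f (u i)" if "i \<le> J" for i
  proof (cases i)
    case 0
    then show ?thesis using g(1) uV by blast
  next
    case (Suc k)
    then show ?thesis using g(2)[of k] uV[of k] that by auto
  qed
  have "g x \<in> V" if "x \<in> V" for x
  proof (cases "x \<in> u ` {..J}")
    case True
    then obtain i where i: "i \<le> J" "x = u i" by auto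
    then show ?thesis using g(1) g(2)[of i] uV[of 0] uV[of "Suc i"] fV by (cases "i = J") auto
  qed (use g(3) fV that in auto)
  moreover have "y \<in> g ` V" if "y \<in> V" for y
  proof -
    have "y \<in> f ` V" using that by (simp add: fV)
    then obtain x where x: "x \<in> V" "y = f x" by (rule imageE) metis
    show ?thesis
    proof (cases "x \<in> u ` {..J}")
      case True
      then show ?thesis using gu x by (auto simp: image_iff) metis
    next
      case False
      then show ?thesis using g(3)[OF False] x by (metis image_eqI)
    qed
  qed
  ultimately have gV: "g ` V = V" by blast
  then show "bij_betw g V V" using V(1) by (simp add: bij_betw_def finite_surj_inj)
  have fsub: "f ` V \<subseteq> V" using fV by simp
  have fuV: "f (u i) \<in> V" if "i \<le> J" for i using uV[OF that] fV by blast
  \<comment> \<open>\<open>g\<close> jumps from \<open>u i\<close> to the old successor of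
    \<open>u (Suc i)\<close>; from there the link to \<open>u (i + 2)\<close> meets no earlier
    vertex where \<open>g\<close> and \<open>f\<close> differ.\<close>
  have two: "(u i, u (i + 2)) \<in> cyc V g" if "i + 2 \<le> J" for i
  proof -
    have "\<exists>m. (f ^^ m) (f (u (Suc i))) = u (i + 2) \<and>
        (\<forall>k<m. (f ^^ k) (f (u (Suc i))) \<notin> u ` {..J})"
      using link[of "Suc i"] that by simp
    then obtain m where "(f ^^ m) (f (u (Suc i))) = u (i + 2) \<and>
        (\<forall>k<m. (f ^^ k) (f (u (Suc i))) \<notin> u ` {..J})" ..
    note m = conjunct1[OF this] conjunct2[OF this, rule_format]
    have "(f (u (Suc i)), (f ^^ m) (f (u (Suc i)))) \<in> cyc V g"
      by (rule cyc_funpow[OF fsub fuV]) (use that m(2) g(3) in auto)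
    moreover have "(u i, f (u (Suc i))) \<in> cyc V g"
      using cyc_step[OF uV, of i g] g(2)[of i] that by simp
    ultimately show ?thesis using m(1) cyc_trans by metis
  qed
  have even: "(u a, u (a + 2 * k)) \<in> cyc V g" if "a + 2 * k \<le> J" for a k
    using that
  proof (induction k)
    case 0
    then show ?case by (simp add: cyc_refl)
  next
    case (Suc k)
    then show ?case using two[of "a + 2 * k"] cyc_trans[of "u a" "u (a + 2 * k)"] by auto
  qed
  have J1: "J \<ge> 1" using J by presburger
  \<comment> \<open>Following \<open>f\<close> from \<open>u 0\<close>, the first gadget vertex met
    lies on the cycle of \<open>u 0\<close>, so by \<open>sep\<close> it is \<open>u 0\<close>
    itself. The switch does not affect this return path, and it joins \<open>u J\<close>, whose new
    image is \<open>f (u 0)\<close>, to \<open>u 0\<close>.\<close>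
  have "\<exists>m. (f ^^ m) (f (u 0)) \<in> u ` {..J}"
    using funpow_returns[OF V uV[of 0]] by force
  then obtain m where m: "(f ^^ m) (f (u 0)) \<in> u ` {..J}"
    and least: "\<And>k. k < m \<Longrightarrow> (f ^^ k) (f (u 0)) \<notin> u ` {..J}"
    by (metis exists_least_iff[of "\<lambda>m. (f ^^ m) (f (u 0)) \<in> u ` {..J}"])
  obtain i where i: "i \<le> J" "(f ^^ m) (f (u 0)) = u i" using m by auto
  have "(f (u 0), u i) \<in> cyc V f"
    using cyc_funpow[OF fsub fuV, of 0 m f] i by simp
  then have "(u 0, u i) \<in> cyc V f" using cyc_step[OF uV, of 0 f] cyc_trans by fastforce
  then have i0: "i = 0" using sep[of i] i(1) by (cases i) auto
  have "(f (u 0), u 0) \<in> cyc V g"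
    using cyc_funpow[OF fsub fuV, of 0 m g] g(3)[OF least] i i0 by simp
  moreover have "(u J, f (u 0)) \<in> cyc V g" using cyc_step[OF uV, of J g] g(1) by simp
  ultimately have J0: "(u J, u 0) \<in> cyc V g" using cyc_trans by metis
  have odd: "(u 1, u i) \<in> cyc V g" if "i \<le> J" "odd i" for i
    using even[of 1 "i div 2"] that by (metis odd_two_times_div_two_succ add.commute Suc_eq_plus1)
  have all: "(u 0, u i) \<in> cyc V g" if "i \<le> J" for i
  proof (cases "odd i")
    case True
    then show ?thesis using odd[OF that] odd[of J] J J0 cyc_sym cyc_trans by (metis order.refl)
  next
    case False
    then show ?thesis using even[of 0 "i div 2"] that by auto
  qed
  then show "(u 0, u 1) \<in> cyc V g" using J1 by simp
  show "cyc V f \<subseteq> cyc V g"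
  proof (rule cyc_mono)
    fix x assume x: "x \<in> V"
    show "(x, f x) \<in> cyc V g"
    proof (cases "x \<in> u ` {..J}")
      case True
      then obtain i where i: "i \<le> J" "x = u i" by auto
      \<comment> \<open>Some \<open>u j\<close> takes over the old image of \<open>u i\<close>, and
        all gadget vertices are already known to be in one class.\<close>
      obtain j where j: "j \<le> J" "g (u j) = f (u i)"
        using g(1) g(2)[of "i - 1"] i(1) by (cases i) (auto, metis Suc_leD Suc_le_eq g(2))
      have "(u j, f (u i)) \<in> cyc V g" using cyc_step[OF uV[OF j(1)], of g] j by simp
      moreover have "(u i, u j) \<in> cyc V g"
        using all[OF i(1)] all[OF j(1)] cyc_sym cyc_trans by metis
      ultimately show ?thesis using i cyc_trans by metis
    next
      case False
      then show ?thesis using cyc_step[OF x, of g] g(3) by simp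
    qed
  qed
qed

text \<open>Induction over the gadgets processed so far. As \<open>f\<close> and \<open>f0\<close>
  agree off these gadgets and links avoid all gadget vertices, the links and switching arcs of the
  next gadget are still valid. A gadget whose \<open>u g 0\<close> already lies with
  \<open>u g 1\<close> is left alone, because switching it could split the cycle. Cycles only grow,
  so earlier merges persist.\<close>

lemma merge_all:
  fixes u :: "'g \<Rightarrow> nat \<Rightarrow> 'a"
  assumes V: "finite V" "bij_betw f0 V V" and J: "odd J" and G: "finite G"
    and u: "\<And>g i. g \<in> G \<Longrightarrow> i \<le> J \<Longrightarrow> u g i \<in> V" "inj_on (\<lambda>(g, i). u g i) (G \<times> {..J})"
    and link: "\<And>g i. g \<in> G \<Longrightarrow> 1 \<le> i \<Longrightarrow> i < J \<Longrightarrow> \<exists>m. (f0 ^^ m) (f0 (u g i)) = u g (Suc i) \<and>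
        (\<forall>k<m. (f0 ^^ k) (f0 (u g i)) \<notin> (\<lambda>(g, i). u g i) ` (G \<times> {..J}))"
    and spec: "\<And>g i. g \<in> G \<Longrightarrow> 1 \<le> i \<Longrightarrow> i \<le> J \<Longrightarrow> (u g i, u g 1) \<in> cyc V f0"
    and E: "\<And>x. x \<in> V \<Longrightarrow> (x, f0 x) \<in> E"
      "\<And>g i. g \<in> G \<Longrightarrow> i < J \<Longrightarrow> (u g i, f0 (u g (Suc i))) \<in> E"
      "\<And>g. g \<in> G \<Longrightarrow> (u g J, f0 (u g 0)) \<in> E"
  shows "\<exists>f. bij_betw f V V \<and> (\<forall>x\<in>V. (x, f x) \<in> E) \<and> cyc V f0 \<subseteq> cyc V f \<and>
    (\<forall>g\<in>G. (u g 0, u g 1) \<in> cyc V f)"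
proof -
  let ?u = "\<lambda>(g, i). u g i"
  have "\<exists>f. bij_betw f V V \<and> (\<forall>x\<in>V. (x, f x) \<in> E) \<and> cyc V f0 \<subseteq> cyc V f \<and>
    (\<forall>g\<in>H. (u g 0, u g 1) \<in> cyc V f) \<and> (\<forall>x. x \<notin> ?u ` (H \<times> {..J}) \<longrightarrow> f x = f0 x)"
    if "finite H" "H \<subseteq> G" for H
    using that
  proof (induction H)
    case empty
    then show ?case using V E by auto
  next
    case (insert h H)
    then obtain f where f: "bij_betw f V V" "\<And>x. x \<in> V \<Longrightarrow> (x, f x) \<in> E" "cyc V f0 \<subseteq> cyc V f"
      "\<And>g. g \<in> H \<Longrightarrow> (u g 0, u g 1) \<in> cyc V f" "\<And>x. x \<notin> ?u ` (H \<times> {..J}) \<Longrightarrow> f x = f0 x"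
      by blast
    have hG: "h \<in> G" using insert by simp
    show ?case
    proof (cases "(u h 0, u h 1) \<in> cyc V f")
      case True
      then show ?thesis using f
        by (intro exI[of _ f] conjI ballI allI impI) (auto simp: image_iff)
    next
      case False
      define U where "U = u h ` {..J}"
      have injh: "inj_on (u h) {..J}"
        using u(2) hG by (auto simp: inj_on_def)
      have notH: "u h i \<notin> ?u ` (H \<times> {..J})" if i: "i \<le> J" for i
      proof
        assume "u h i \<in> ?u ` (H \<times> {..J})"
        then obtain g j where gj: "g \<in> H" "j \<le> J" "u h i = u g j" by auto
        then have "(h, i) = (g, j)"
          using inj_onD[OF u(2), of "(h, i)" "(g, j)"] hG i insert.prems by auto
        then show False using gj insert.hyps by simp
      qed
      have fu: "f (u h i) = f0 (u h i)" if "i \<le> J" for i using f(5) notH that by blast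
      define g where "g x = (if x \<in> U then (let i = the_inv_into {..J} (u h) x in
         if i = J then f (u h 0) else f (u h (Suc i))) else f x)" for x
      have inv: "the_inv_into {..J} (u h) (u h i) = i" if "i \<le> J" for i
        using the_inv_into_f_f[OF injh] that by simp
      have g1: "g (u h J) = f (u h 0)" by (simp add: g_def U_def inv)
      have g2: "g (u h i) = f (u h (Suc i))" if "i < J" for i
        using that by (simp add: g_def U_def inv)
      have g3: "g x = f x" if "x \<notin> u h ` {..J}" for x using that by (simp add: g_def U_def)
      have link': "\<exists>m. (f ^^ m) (f (u h i)) = u h (Suc i) \<and>
          (\<forall>k<m. (f ^^ k) (f (u h i)) \<notin> u h ` {..J})" if i: "1 \<le> i" "i < J" for i
      proof -
        obtain m where m: "(f0 ^^ m) (f0 (u h i)) = u h (Suc i)"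
          "\<And>k. k < m \<Longrightarrow> (f0 ^^ k) (f0 (u h i)) \<notin> ?u ` (G \<times> {..J})"
          using link[OF hG i] by blast
        have "(f ^^ k) (f (u h i)) = (f0 ^^ k) (f0 (u h i))" if "k \<le> m" for k
          using that
        proof (induction k)
          case 0
          then show ?case using fu i by simp
        next
          case (Suc k)
          have "(f0 ^^ k) (f0 (u h i)) \<notin> ?u ` (H \<times> {..J})"
            using m(2)[of k] Suc.prems insert.prems by (auto simp: image_iff)
          then show ?case using Suc f(5) by simp
        qed
        then show ?thesis using m hG by (intro exI[of _ m]) (auto simp: image_iff)
      qed
      have sep: "(u h 0, u h i) \<notin> cyc V f" if "1 \<le> i" "i \<le> J" for i
        using False spec[OF hG that] cyc_trans[of "u h 0" "u h i" V f "u h 1"] subsetD[OF f(3)] by metis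
      have uV: "u h ` {..J} \<subseteq> V" using u(1) hG by auto
      have tog: "bij_betw g V V" "cyc V f \<subseteq> cyc V g" "(u h 0, u h 1) \<in> cyc V g"
        by (rule toggle_merges[of V f J "u h" g]; (rule V(1) f(1) J uV injh link' sep g1 g2 g3)?; assumption)+
      have "(x, g x) \<in> E" if x: "x \<in> V" for x
      proof (cases "x \<in> u h ` {..J}")
        case True
        then obtain i where i: "i \<le> J" "x = u h i" by auto
        show ?thesis
        proof (cases "i = J")
          case True
          then show ?thesis using E(3)[OF hG] g1 fu[of 0] i by simp
        next
          case False
          then show ?thesis using E(2)[OF hG, of i] g2[of i] fu[of "Suc i"] i by simp
        qed
      qed (use g3 f(2) x in simp)
      moreover have "g x = f0 x" if "x \<notin> ?u ` (insert h H \<times> {..J})" for x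
      proof -
        have "x \<notin> u h ` {..J}" "x \<notin> ?u ` (H \<times> {..J})" using that by force+
        then show ?thesis using g3 f(5) by simp
      qed
      ultimately show ?thesis using tog f(3,4) by (intro exI[of _ g]) blast
    qed
  qed
  from this[OF G order.refl] show ?thesis by blast
qed


section \<open>Disjoint connecting paths\<close>

text \<open>Sources are indices of an arbitrary type rather than vertices, so that the search from
  start points through \<open>S\<close> and the search from end points through
  \<open>T\<inverse>\<close> are instances of the same function.\<close>

primrec reach :: "('i \<times> 'b) set \<Rightarrow> (nat \<Rightarrow> ('b \<times> 'b) set) \<Rightarrow> (nat \<Rightarrow> 'b set) \<Rightarrow> 'i set \<Rightarrow> nat \<Rightarrow> 'b set" where
  "reach S R U A 0 = S `` A \<inter> U 0"
| "reach S R U A (Suc j) = R j `` reach S R U A j \<inter> U (Suc j)"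

lemma reach_Un: "reach S R U (A \<union> B) j = reach S R U A j \<union> reach S R U B j"
  by (induction j) auto

lemma reach_subset: "reach S R U A j \<subseteq> U j"
  by (cases j) auto

lemma reach_path:
  assumes "w \<in> reach S R U {i} j"
  shows "\<exists>x. (i, x 0) \<in> S \<and> (\<forall>k\<le>j. x k \<in> U k) \<and> (\<forall>k<j. (x k, x (Suc k)) \<in> R k) \<and> x j = w"
  using assms
proof (induction j arbitrary: w)
  case 0
  then show ?case by (intro exI[of _ "\<lambda>_. w"]) auto
next
  case (Suc j)
  then obtain v where v: "v \<in> reach S R U {i} j" "(v, w) \<in> R j" "w \<in> U (Suc j)" by auto
  obtain x where x: "(i, x 0) \<in> S" "\<forall>k\<le>j. x k \<in> U k" "\<forall>k<j. (x k, x (Suc k)) \<in> R k" "x j = v"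
    using Suc.IH[OF v(1)] by blast
  have "\<forall>k<Suc j. ((x(Suc j := w)) k, (x(Suc j := w)) (Suc k)) \<in> R k"
    using x v by (auto simp: less_Suc_eq)
  moreover have "\<forall>k\<le>Suc j. (x(Suc j := w)) k \<in> U k" using x v by (auto simp: le_Suc_eq)
  ultimately show ?case using x(1) by (intro exI[of _ "x(Suc j := w)"]) auto
qed

text \<open>Reaching is additive in the sources, so one of two halves of \<open>B\<close> still
  reaches at least half. A singleton cannot be split and is returned unchanged, whence the +
  1.\<close>

lemma reach_halve:
  assumes "finite B" "B \<noteq> {}" "finite (U j)"
  shows "\<exists>B'\<subseteq>B. B' \<noteq> {} \<and> 2 * card B' \<le> card B + 1 \<and>
    card (reach S R U B j) \<le> 2 * card (reach S R U B' j)"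
proof (cases "card B = 1")
  case True
  then show ?thesis using assms by (intro exI[of _ B]) auto
next
  case False
  then have B2: "card B \<ge> 2" using assms by (metis One_nat_def Suc_1 card_0_eq le_SucE le_less_linear less_2_cases not_less_eq_eq)
  obtain B1 where B1: "B1 \<subseteq> B" "card B1 = card B div 2"
    by (metis obtain_subset_with_card_n div_le_dividend)
  have fin1: "finite B1" using B1 assms finite_subset by blast
  have cB2: "card (B - B1) = card B - card B div 2" using B1 fin1 by (simp add: card_Diff_subset)
  have "B = B1 \<union> (B - B1)" using B1 by blast
  then have "reach S R U B j = reach S R U B1 j \<union> reach S R U (B - B1) j" using reach_Un by metis
  then have le: "card (reach S R U B j) \<le> card (reach S R U B1 j) + card (reach S R U (B - B1) j)"
    using card_Un_le by metis
  have ne: "B1 \<noteq> {}" "B - B1 \<noteq> {}" using B1 B2 cB2 by auto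
  show ?thesis
  proof (cases "card (reach S R U B1 j) \<ge> card (reach S R U (B - B1) j)")
    case True
    then show ?thesis using B1 ne le by (intro exI[of _ B1]) auto
  next
    case False
    then show ?thesis using B1 ne le cB2 by (intro exI[of _ "B - B1"]) auto
  qed
qed

text \<open>
  Growing the reached set and halving the set of sources at the same time isolates a single
  source with a large reached set, even though the neighbourhoods of a few sources may be
  contained in the forbidden sets \<open>Z j\<close>.
\<close>
lemma reach_single:
  fixes \<theta> s :: real
  assumes A: "finite A" "A \<noteq> {}" "card A < 2 ^ J" and J: "J \<ge> 1"
    and ex0: "expands S A (W 0) \<theta>"
    and ex: "\<And>j. j < J \<Longrightarrow> expands (R j) (W j) (W (Suc j)) \<theta>"
    and W: "\<And>j. j \<le> J \<Longrightarrow> finite (W j)"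
    and U: "\<And>j. j \<le> J \<Longrightarrow> U j = W j - Z j"
    and Z: "\<And>j. j \<le> J \<Longrightarrow> finite (Z j)" "\<And>j. j \<le> J \<Longrightarrow> real (card (Z j)) \<le> s"
      "\<And>j. j \<le> J \<Longrightarrow> card (Z j) \<le> 2 * card A"
    and th: "2 * s \<le> \<theta>" "\<theta> \<le> 4 * 2 ^ J"
  shows "\<exists>i\<in>A. \<theta> - s \<le> card (reach S R U {i} J)"
proof -
  have minus: "real (card (X \<inter> W j)) - card (Z j) \<le> card (X \<inter> U j)" if "j \<le> J" for X j
  proof -
    have "X \<inter> U j = X \<inter> W j - Z j" using U[OF that] by blast
    moreover
    have "card (X \<inter> W j) - card (Z j) \<le> card (X \<inter> W j - Z j)"
      by (rule diff_card_le_card_Diff[OF Z(1)[OF that]])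
    then have "real (card (X \<inter> W j)) - card (Z j) \<le> card (X \<inter> W j - Z j)" by linarith
    ultimately show ?thesis by simp
  qed
  have finU: "finite (U j)" if "j \<le> J" for j using U W that by simp
  have reachW: "reach S R U B j \<subseteq> W j" if "j \<le> J" for B j
    using reach_subset[of S R U B j] U[OF that] by blast
  have cA: "1 \<le> card A" using A by (simp add: Suc_leI card_gt_0_iff)
  \<comment> \<open>Invariant after layer \<open>j\<close>: the sources have been halved
    \<open>j + 1\<close> times, up to rounding, while the guaranteed size of the reached set doubles
    with each layer until it is \<theta> / 8.\<close>
  have claim: "\<exists>B\<subseteq>A. B \<noteq> {} \<and> real (card B) \<le> 1 + card A / 2 ^ Suc j \<and>
      min (2 ^ j * real (card A)) (\<theta> / 8) \<le> card (reach S R U B j)" if "j < J" for j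
    using that
  proof (induction j)
    case 0
    obtain B where B: "B \<subseteq> A" "B \<noteq> {}" "2 * card B \<le> card A + 1"
      "card (reach S R U A 0) \<le> 2 * card (reach S R U B 0)"
      using reach_halve[OF A(1,2), of U 0 S R] finU by auto
    have "min (8 * real (card A)) \<theta> \<le> card (S `` A \<inter> W 0)" by (rule expandsD[OF ex0]) simp
    then have 1: "min (8 * real (card A)) \<theta> - card (Z 0) \<le> card (reach S R U A 0)"
      using minus[of 0 "S `` A"] by simp
    \<comment> \<open>Below the cap, at most 2 |A| of the 8 |A| vertices are forbidden, and halving
      leaves at least 3 |A|. At the cap, at most s <= \<theta> / 2 are forbidden, and at least
      \<theta> / 4 remain.\<close>
    have "min (card A) (\<theta> / 8) \<le> card (reach S R U B 0)"
      using 1 B(4) Z(2)[of 0] Z(3)[of 0] th by linarith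
    then show ?case using B by (intro exI[of _ B]) auto
  next
    case (Suc j)
    then obtain B0 where B0: "B0 \<subseteq> A" "B0 \<noteq> {}" "real (card B0) \<le> 1 + card A / 2 ^ Suc j"
      "min (2 ^ j * real (card A)) (\<theta> / 8) \<le> card (reach S R U B0 j)" by auto
    have finB0: "finite B0" using B0 A finite_subset by blast
    obtain B where B: "B \<subseteq> B0" "B \<noteq> {}" "2 * card B \<le> card B0 + 1"
      "card (reach S R U B0 (Suc j)) \<le> 2 * card (reach S R U B (Suc j))"
      using reach_halve[OF finB0 B0(2), of U "Suc j" S R] finU Suc.prems by auto
    define X where "X = real (card (reach S R U B0 j))"
    have "min (8 * X) \<theta> \<le> card (R j `` reach S R U B0 j \<inter> W (Suc j))"
      unfolding X_def by (rule expandsD[OF ex]) (use Suc.prems reachW in auto)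
    then have 1: "min (8 * X) \<theta> - card (Z (Suc j)) \<le> card (reach S R U B0 (Suc j))"
      using minus[of "Suc j" "R j `` reach S R U B0 j"] Suc.prems by simp
    define c where "c = (2::real) ^ j * card A"
    have c: "real (card A) \<le> c" unfolding c_def by (simp add: mult_le_cancel_right1)
    have "real (card (Z (Suc j))) \<le> s" "real (card (Z (Suc j))) \<le> 2 * real (card A)"
      using Z(2)[of "Suc j"] Z(3)[of "Suc j"] Suc.prems by linarith+
    moreover have "real (card (reach S R U B0 (Suc j))) \<le> 2 * real (card (reach S R U B (Suc j)))"
      using B(4) by linarith
    moreover have "min c (\<theta> / 8) \<le> X" using B0(4) by (simp add: X_def c_def)
    moreover have "0 \<le> real (card (Z (Suc j)))" by simp
    ultimately have "min (2 * c) (\<theta> / 8) \<le> card (reach S R U B (Suc j))"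
      using 1 th(1) c by linarith
    moreover have "real (card B) \<le> 1 + card A / 2 ^ Suc (Suc j)"
    proof -
      define a where "a = real (card A) / 2 ^ Suc j"
      have "real (card A) / 2 ^ Suc (Suc j) = a / 2" by (simp add: a_def)
      moreover have "2 * real (card B) \<le> real (card B0) + 1" using B(3) by linarith
      ultimately show ?thesis using B0(3)[folded a_def] by linarith
    qed
    ultimately show ?case using B B0(1) by (intro exI[of _ B]) (auto simp: c_def mult.assoc)
  qed
  obtain k where k: "J = Suc k" using J by (cases J) auto
  obtain B where B: "B \<subseteq> A" "B \<noteq> {}" "real (card B) \<le> 1 + card A / 2 ^ J"
    "min (2 ^ k * real (card A)) (\<theta> / 8) \<le> card (reach S R U B k)" using claim[of k] k by auto
  have "real (card A) / 2 ^ J < 1" using A(3) by (simp add: divide_less_eq)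
  then have "card B < 2" using B(3) by linarith
  moreover have "card B > 0" using B A(1) finite_subset card_gt_0_iff by metis
  ultimately have "card B = 1" by linarith
  then obtain i where i: "B = {i}" by (metis card_1_singletonE)
  \<comment> \<open>Since 2^J is at least \<theta> / 4, the doubling has reached \<theta> / 8. The
    last layer expands this to \<theta> without further halving.\<close>
  have "\<theta> / 8 \<le> 2 ^ k * 1" using th k by simp
  also have "\<dots> \<le> 2 ^ k * real (card A)" using cA by simp
  finally have 1: "\<theta> / 8 \<le> card (reach S R U B k)" using B(4) by linarith
  have "min (8 * real (card (reach S R U B k))) \<theta> \<le> card (R k `` reach S R U B k \<inter> W J)"
    unfolding k by (rule expandsD[OF ex]) (use k reachW in auto)
  then have "\<theta> \<le> card (R k `` reach S R U B k \<inter> W J)" using 1 by linarith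
  then have "\<theta> - s \<le> card (reach S R U B J)"
    using minus[of J "R k `` reach S R U B k"] Z(2)[of J] k by simp
  then show ?thesis using i B by auto
qed

text \<open>The index \<open>i\<close> codes both ends, so a closed walk at one vertex and a path
  between two different vertices are the same kind of request.\<close>

definition route :: "('i \<times> 'b) set \<Rightarrow> (nat \<Rightarrow> ('b \<times> 'b) set) \<Rightarrow> ('b \<times> 'i) set \<Rightarrow> (nat \<Rightarrow> 'b set) \<Rightarrow>
    nat \<Rightarrow> 'i \<Rightarrow> (nat \<Rightarrow> 'b) \<Rightarrow> bool" where
  "route S R T W l i x \<longleftrightarrow> (i, x 0) \<in> S \<and> (\<forall>j\<le>l. x j \<in> W j) \<and>
     (\<forall>j<l. (x j, x (Suc j)) \<in> R j) \<and> (x l, i) \<in> T"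

text \<open>A maximal family of disjoint routes serves at least half of the requests. Otherwise it
  would use fewer vertices of each layer than there are unserved requests. By
  \<open>reach_single\<close>, fewer than half of the latter fail to reach
  \<open>\<theta> - s\<close> vertices of the middle layer from the front, and likewise from the
  back. Some request then succeeds from both ends, and its two sets meet because the middle layer
  has fewer than \<open>2 * (\<theta> - s)\<close> vertices.\<close>

lemma connect_half:
  fixes \<theta> s :: real
  assumes I: "finite I" "real (card I) \<le> s" "card I < 2 ^ J" and J: "J \<ge> 1"
    and W: "\<And>j. j \<le> 2 * J \<Longrightarrow> finite (W j)"
    and ex0: "expands S I (W 0) \<theta>" "expands (T\<inverse>) I (W (2 * J)) \<theta>"
    and ex: "\<And>j. j < 2 * J \<Longrightarrow> expands (R j) (W j) (W (Suc j)) \<theta>"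
      "\<And>j. j < 2 * J \<Longrightarrow> expands ((R j)\<inverse>) (W (Suc j)) (W j) \<theta>"
    and th: "2 * s \<le> \<theta>" "\<theta> \<le> 4 * 2 ^ J" "real (card (W J)) < 2 * (\<theta> - s)"
  shows "\<exists>I0\<subseteq>I. card I \<le> 2 * card I0 \<and> (\<exists>x. (\<forall>i\<in>I0. route S R T W (2 * J) i (x i)) \<and>
    (\<forall>i\<in>I0. \<forall>i'\<in>I0. \<forall>j\<le>2 * J. i \<noteq> i' \<longrightarrow> x i j \<noteq> x i' j))"
proof -
  define good where "good I0 \<longleftrightarrow> I0 \<subseteq> I \<and> (\<exists>x. (\<forall>i\<in>I0. route S R T W (2 * J) i (x i)) \<and>
    (\<forall>i\<in>I0. \<forall>i'\<in>I0. \<forall>j\<le>2 * J. i \<noteq> i' \<longrightarrow> x i j \<noteq> x i' j))" for I0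
  have "good {}" by (simp add: good_def)
  moreover have "\<forall>I0. good I0 \<longrightarrow> card I0 < Suc (card I)" using I by (simp add: good_def card_mono less_Suc_eq_le)
  ultimately have "\<exists>I0. good I0 \<and> (\<forall>I'. good I' \<longrightarrow> card I' \<le> card I0)"
    by (rule ex_has_greatest_nat)
  then obtain I0 where I0: "good I0" and maxi: "\<And>I'. good I' \<Longrightarrow> card I' \<le> card I0"
    by blast
  have half: "card I \<le> 2 * card I0"
  proof (rule ccontr)
    assume "\<not> ?thesis"
    then have less: "2 * card I0 < card I" by simp
    obtain x where x: "\<And>i. i \<in> I0 \<Longrightarrow> route S R T W (2 * J) i (x i)"
      "\<And>i i' j. i \<in> I0 \<Longrightarrow> i' \<in> I0 \<Longrightarrow> j \<le> 2 * J \<Longrightarrow> i \<noteq> i' \<Longrightarrow> x i j \<noteq> x i' j"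
      using I0 unfolding good_def by metis
    have sub: "I0 \<subseteq> I" using I0 by (simp add: good_def)
    have finI0: "finite I0" by (rule finite_subset[OF sub I(1)])
    define Z where "Z j = (\<lambda>i. x i j) ` I0" for j
    define S' where "S' = I - I0"
    have cS': "card S' > card I0" "card S' \<le> card I"
      using less sub finI0 I by (auto simp: S'_def card_Diff_subset)
    have finS': "finite S'" using I by (simp add: S'_def)
    have cZ: "card (Z j) \<le> card I0" "finite (Z j)" for j
      using finI0 by (auto simp: Z_def card_image_le)
    define U where "U j = W j - Z j" for j
    \<comment> \<open>The search from the back is a forward search in the reversed layers.\<close>
    define R' where "R' j = (R (2 * J - Suc j))\<inverse>" for j
    define W' where "W' j = W (2 * J - j)" for j
    define U' where "U' j = U (2 * J - j)" for j
    define Bad where "Bad = {i \<in> S'. card (reach S R U {i} J) < \<theta> - s}"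
    define Bad' where "Bad' = {i \<in> S'. card (reach (T\<inverse>) R' U' {i} J) < \<theta> - s}"
    have Zs: "real (card (Z j)) \<le> s" for j using cZ(1)[of j] less I(2) by linarith
    have bad: "2 * card Bad < card S'"
    proof (rule ccontr)
      assume neg: "\<not> ?thesis"
      have fin: "finite Bad" using finS' by (simp add: Bad_def)
      have BI: "Bad \<subseteq> I" by (auto simp: Bad_def S'_def)
      have "\<exists>i\<in>Bad. \<theta> - s \<le> card (reach S R U {i} J)"
      proof (rule reach_single[where Z = Z and W = W])
        show "Bad \<noteq> {}" using neg cS' by auto
        show "card Bad < 2 ^ J" using card_mono[OF I(1) BI] I(3) by simp
        show "expands S Bad (W 0) \<theta>" by (rule expands_subset[OF ex0(1) BI])
        show "card (Z j) \<le> 2 * card Bad" for j using cZ(1)[of j] cS' neg by linarith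
      qed (use fin J ex W U_def cZ Zs th in auto)
      then show False by (auto simp: Bad_def)
    qed
    have bad': "2 * card Bad' < card S'"
    proof (rule ccontr)
      assume neg: "\<not> ?thesis"
      have fin: "finite Bad'" using finS' by (simp add: Bad'_def)
      have BI: "Bad' \<subseteq> I" by (auto simp: Bad'_def S'_def)
      have "\<exists>i\<in>Bad'. \<theta> - s \<le> card (reach (T\<inverse>) R' U' {i} J)"
      proof (rule reach_single[where Z = "\<lambda>j. Z (2 * J - j)" and W = W'])
        show "Bad' \<noteq> {}" using neg cS' by auto
        show "card Bad' < 2 ^ J" using card_mono[OF I(1) BI] I(3) by simp
        show "expands (T\<inverse>) Bad' (W' 0) \<theta>"
          using expands_subset[OF ex0(2) BI] by (simp add: W'_def)
        show "card (Z (2 * J - j)) \<le> 2 * card Bad'" for j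
          using cZ(1)[of "2 * J - j"] cS' neg by linarith
        show "expands (R' j) (W' j) (W' (Suc j)) \<theta>" if "j < J" for j
          using ex(2)[of "2 * J - Suc j"] that unfolding R'_def W'_def
          by (simp add: Suc_diff_Suc)
      qed (use fin J W U_def cZ Zs th in \<open>auto simp: W'_def U'_def\<close>)
      then show False by (auto simp: Bad'_def)
    qed
    have "card (Bad \<union> Bad') < card S'" using card_Un_le[of Bad Bad'] bad bad' by linarith
    moreover have "Bad \<union> Bad' \<subseteq> S'" by (auto simp: Bad_def Bad'_def)
    ultimately have "Bad \<union> Bad' \<subset> S'" by (metis less_irrefl psubsetI)
    then obtain i where i: "i \<in> S'" "i \<notin> Bad" "i \<notin> Bad'" by blast
    let ?F = "reach S R U {i} J" and ?F' = "reach (T\<inverse>) R' U' {i} J"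
    have c: "\<theta> - s \<le> card ?F" "\<theta> - s \<le> card ?F'" using i by (auto simp: Bad_def Bad'_def)
    have FW: "?F \<subseteq> W J" "?F' \<subseteq> W J"
      using reach_subset[of S R U "{i}" J] reach_subset[of "T\<inverse>" R' U' "{i}" J]
      by (auto simp: U_def U'_def)
    have "?F \<inter> ?F' \<noteq> {}"
    proof
      assume e: "?F \<inter> ?F' = {}"
      have finW: "finite (W J)" using W by simp
      have "card ?F + card ?F' = card (?F \<union> ?F')"
        using e FW finW finite_subset by (subst card_Un_disjoint) blast+
      also have "\<dots> \<le> card (W J)" by (rule card_mono[OF finW]) (use FW in blast)
      finally have "real (card ?F) + real (card ?F') \<le> real (card (W J))"
        by (metis of_nat_add of_nat_le_iff)
      then show False using c th(3) by simp
    qed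
    then obtain w where w: "w \<in> ?F" "w \<in> ?F'" by blast
    obtain a where a: "(i, a 0) \<in> S" "\<And>k. k \<le> J \<Longrightarrow> a k \<in> U k"
      "\<And>k. k < J \<Longrightarrow> (a k, a (Suc k)) \<in> R k" "a J = w" using reach_path[OF w(1)] by metis
    obtain b where b: "(i, b 0) \<in> T\<inverse>" "\<And>k. k \<le> J \<Longrightarrow> b k \<in> U' k"
      "\<And>k. k < J \<Longrightarrow> (b k, b (Suc k)) \<in> R' k" "b J = w" using reach_path[OF w(2)] by metis
    define y where "y k = (if k \<le> J then a k else b (2 * J - k))" for k
    have yJ: "y k = b (2 * J - k)" if "J \<le> k" for k
      using that a(4) b(4) by (cases "k = J") (auto simp: y_def mult_2)
    have yU: "y k \<in> U k" if "k \<le> 2 * J" for k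
    proof (cases "k \<le> J")
      case False
      then show ?thesis using b(2)[of "2 * J - k"] that by (auto simp: y_def U'_def)
    qed (use a(2) in \<open>auto simp: y_def\<close>)
    have "(y k, y (Suc k)) \<in> R k" if k: "k < 2 * J" for k
    proof (cases "k < J")
      case True
      then show ?thesis using a(3)[of k] by (simp add: y_def)
    next
      case False
      have "(b (2 * J - Suc k), b (Suc (2 * J - Suc k))) \<in> R' (2 * J - Suc k)"
        by (rule b(3)) (use k False in auto)
      then show ?thesis using yJ[of k] yJ[of "Suc k"] False k
        by (auto simp: R'_def Suc_diff_Suc)
    qed
    moreover have "(y (2 * J), i) \<in> T" using b(1) yJ[of "2 * J"] by simp
    moreover have "(i, y 0) \<in> S" using a(1) by (simp add: y_def)
    ultimately have ry: "route S R T W (2 * J) i y" using yU by (auto simp: route_def U_def)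
    have iI0: "i \<notin> I0" "i \<in> I" using i by (auto simp: S'_def)
    have dist: "y j \<noteq> x i' j" if "i' \<in> I0" "j \<le> 2 * J" for i' j
      using yU[OF that(2)] that(1) by (auto simp: U_def Z_def)
    have "good (insert i I0)"
      unfolding good_def
    proof (intro conjI exI[of _ "x(i := y)"] ballI allI impI)
      show "insert i I0 \<subseteq> I" using sub iI0 by simp
      show "route S R T W (2 * J) k ((x(i := y)) k)" if "k \<in> insert i I0" for k
        using that ry x(1) iI0 by auto
      show "(x(i := y)) k j \<noteq> (x(i := y)) k' j"
        if "k \<in> insert i I0" "k' \<in> insert i I0" "j \<le> 2 * J" "k \<noteq> k'" for k k' j
        using that x(2)[of k k' j] dist[of k j] dist[of k' j] iI0 by auto
    qed
    then have "card (insert i I0) \<le> card I0" by (rule maxi)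
    then show False using finI0 iI0 by simp
  qed
  have "I0 \<subseteq> I" "\<exists>x. (\<forall>i\<in>I0. route S R T W (2 * J) i (x i)) \<and>
    (\<forall>i\<in>I0. \<forall>i'\<in>I0. \<forall>j\<le>2 * J. i \<noteq> i' \<longrightarrow> x i j \<noteq> x i' j)"
    using I0 by (simp_all only: good_def)
  then show ?thesis by (intro exI[of _ I0] conjI half)
qed

text \<open>Here \<open>n\<close> counts rounds. Each round has its own layers \<open>W k\<close>
  and serves at least half of what is left, so \<open>n\<close> rounds suffice for fewer than
  \<open>2 ^ n\<close> requests. Distinctness is claimed only for equal round and equal position;
  disjointness of the layers will exclude all other coincidences.\<close>

lemma connect_all:
  fixes \<theta> s :: real
  assumes I: "finite I" "I \<subseteq> D" "real (card I) \<le> s" "card I < 2 ^ J" "card I < 2 ^ n" and J: "J \<ge> 1"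
    and W: "\<And>k j. k < n \<Longrightarrow> j \<le> 2 * J \<Longrightarrow> finite (W k j)"
    and ex0: "\<And>k. k < n \<Longrightarrow> expands S D (W k 0) \<theta>" "\<And>k. k < n \<Longrightarrow> expands (T\<inverse>) D (W k (2 * J)) \<theta>"
    and ex: "\<And>k j. k < n \<Longrightarrow> j < 2 * J \<Longrightarrow> expands (R j) (W k j) (W k (Suc j)) \<theta>"
      "\<And>k j. k < n \<Longrightarrow> j < 2 * J \<Longrightarrow> expands ((R j)\<inverse>) (W k (Suc j)) (W k j) \<theta>"
    and th: "2 * s \<le> \<theta>" "\<theta> \<le> 4 * 2 ^ J" "\<And>k. k < n \<Longrightarrow> real (card (W k J)) < 2 * (\<theta> - s)"
  shows "\<exists>st x. (\<forall>i\<in>I. st i < n \<and> route S R T (W (st i)) (2 * J) i (x i)) \<and>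
    (\<forall>i\<in>I. \<forall>i'\<in>I. \<forall>j\<le>2 * J. i \<noteq> i' \<longrightarrow> st i = st i' \<longrightarrow> x i j \<noteq> x i' j)"
  using I W ex0 ex th(3)
proof (induction n arbitrary: I)
  case 0
  then show ?case by simp
next
  case (Suc n)
  note I = Suc.prems(1-5)
  have "\<exists>I0\<subseteq>I. card I \<le> 2 * card I0 \<and> (\<exists>x. (\<forall>i\<in>I0. route S R T (W n) (2 * J) i (x i)) \<and>
    (\<forall>i\<in>I0. \<forall>i'\<in>I0. \<forall>j\<le>2 * J. i \<noteq> i' \<longrightarrow> x i j \<noteq> x i' j))"
  proof (rule connect_half[where \<theta> = \<theta> and s = s])
    show "expands S I (W n 0) \<theta>" "expands (T\<inverse>) I (W n (2 * J)) \<theta>"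
      using expands_subset[OF Suc.prems(7)[of n] I(2)] expands_subset[OF Suc.prems(8)[of n] I(2)]
      by simp_all
  qed (use I J Suc.prems(6) Suc.prems(9-) th(1,2) in simp_all)
  then obtain I0 x0 where I0: "I0 \<subseteq> I" "card I \<le> 2 * card I0"
    "\<And>i. i \<in> I0 \<Longrightarrow> route S R T (W n) (2 * J) i (x0 i)"
    "\<And>i i' j. i \<in> I0 \<Longrightarrow> i' \<in> I0 \<Longrightarrow> j \<le> 2 * J \<Longrightarrow> i \<noteq> i' \<Longrightarrow> x0 i j \<noteq> x0 i' j" by metis
  have finI0: "finite I0" by (rule finite_subset[OF I0(1) I(1)])
  have c: "card (I - I0) = card I - card I0" using I0 finI0 by (simp add: card_Diff_subset)
  have cn: "card (I - I0) < 2 ^ n" using I0(2) I(5) c by simp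
  have cs: "real (card (I - I0)) \<le> s" "card (I - I0) < 2 ^ J" using I c by linarith+
  have "\<exists>st x. (\<forall>i\<in>I - I0. st i < n \<and> route S R T (W (st i)) (2 * J) i (x i)) \<and>
    (\<forall>i\<in>I - I0. \<forall>i'\<in>I - I0. \<forall>j\<le>2 * J. i \<noteq> i' \<longrightarrow> st i = st i' \<longrightarrow> x i j \<noteq> x i' j)"
    by (rule Suc.IH) (use I cn cs Suc.prems(6-) in auto)
  then obtain st x where IH: "\<And>i. i \<in> I - I0 \<Longrightarrow> st i < n \<and> route S R T (W (st i)) (2 * J) i (x i)"
    "\<And>i i' j. i \<in> I - I0 \<Longrightarrow> i' \<in> I - I0 \<Longrightarrow> j \<le> 2 * J \<Longrightarrow> i \<noteq> i' \<Longrightarrow> st i = st i' \<Longrightarrow> x i j \<noteq> x i' j"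
    by metis
  define st' where "st' i = (if i \<in> I0 then n else st i)" for i
  define x' where "x' i = (if i \<in> I0 then x0 i else x i)" for i
  have neq: "st i \<noteq> n" if "i \<in> I" "i \<notin> I0" for i using IH(1)[of i] that by auto
  show ?case
  proof (intro exI[of _ st'] exI[of _ x'] conjI ballI allI impI)
    fix i assume i: "i \<in> I"
    show "st' i < Suc n" using IH(1)[of i] i by (auto simp: st'_def)
    show "route S R T (W (st' i)) (2 * J) i (x' i)"
      using IH(1)[of i] I0(3)[of i] i by (auto simp: st'_def x'_def)
  next
    fix i i' j assume a: "i \<in> I" "i' \<in> I" "j \<le> 2 * J" "i \<noteq> i'" "st' i = st' i'"
    show "x' i j \<noteq> x' i' j"
      using a neq[of i] neq[of i'] I0(4)[of i i' j] IH(2)[of i i' j]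
      by (auto simp: st'_def x'_def split: if_splits)
  qed
qed


section \<open>Gadgets\<close>

text \<open>\<open>t g i 0\<close> is the vertex w_i, and \<open>t g i 1\<close>, ...,
  \<open>t g i L\<close> is the link leaving it. The link of \<open>u g 0\<close> leads to
  \<open>b g\<close>, the start of a covering path, and that of \<open>u g J\<close> to the next
  gadget. Hence all \<open>u g i\<close> with \<open>i > 0\<close> share a cycle, while
  \<open>u g 0\<close> is entered only from a covering path. Every vertex of \<open>O'\<close> runs
  into some \<open>u g 0\<close>, so one cycle is left once every \<open>u g 0\<close> has been
  merged.\<close>

lemma assemble:
  fixes V :: "'a set" and u :: "nat \<Rightarrow> nat \<Rightarrow> 'a" and t :: "nat \<Rightarrow> nat \<Rightarrow> nat \<Rightarrow> 'a"
  assumes V: "finite V" and J: "odd J" and T: "T \<ge> 1"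
    and Us: "Us = (\<lambda>(g, i). u g i) ` ({..<T} \<times> {..J})" "inj_on (\<lambda>(g, i). u g i) ({..<T} \<times> {..J})"
    and Ts: "Ts = (\<lambda>(g, i, m). t g i m) ` ({..<T} \<times> {..J} \<times> {..L})"
      "inj_on (\<lambda>(g, i, m). t g i m) ({..<T} \<times> {..J} \<times> {..L})"
    and parts: "V = Us \<union> Ts \<union> O'" "Us \<inter> Ts = {}" "Us \<inter> O' = {}" "Ts \<inter> O' = {}"
    and b: "b ` {..<T} \<subseteq> O'"
    and h: "h ` O' = (O' - b ` {..<T}) \<union> (\<lambda>g. u g 0) ` {..<T}"
    and reach: "\<And>v. v \<in> O' \<Longrightarrow> \<exists>m. (h ^^ m) v \<in> (\<lambda>g. u g 0) ` {..<T} \<and> (\<forall>k<m. (h ^^ k) v \<in> O')"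
    and nx: "\<And>g i. nx g i = (if i = 0 then b g else if i = J then u (Suc g mod T) 1 else u g (Suc i))"
    and E: "\<And>g i. g < T \<Longrightarrow> i \<le> J \<Longrightarrow> (u g i, t g i 0) \<in> E"
      "\<And>g i m. g < T \<Longrightarrow> i \<le> J \<Longrightarrow> m < L \<Longrightarrow> (t g i m, t g i (Suc m)) \<in> E"
      "\<And>g i. g < T \<Longrightarrow> i \<le> J \<Longrightarrow> (t g i L, nx g i) \<in> E"
      "\<And>g i. g < T \<Longrightarrow> i < J \<Longrightarrow> (u g i, t g (Suc i) 0) \<in> E"
      "\<And>g. g < T \<Longrightarrow> (u g J, t g 0 0) \<in> E"
      "\<And>v. v \<in> O' \<Longrightarrow> (v, h v) \<in> E"
  shows "\<exists>f. bij_betw f V V \<and> (\<forall>x\<in>V. (x, f x) \<in> E) \<and> V \<times> V \<subseteq> cyc V f"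
proof -
  let ?u = "\<lambda>(g, i). u g i" and ?t = "\<lambda>(g, i, m). t g i m"
  define f0 where "f0 v = (if v \<in> Us then (case the_inv_into ({..<T} \<times> {..J}) ?u v of (g, i) \<Rightarrow> t g i 0)
    else if v \<in> Ts then (case the_inv_into ({..<T} \<times> {..J} \<times> {..L}) ?t v of (g, i, m) \<Rightarrow>
      if m = L then nx g i else t g i (Suc m)) else h v)" for v
  have J1: "J \<ge> 1" using J by presburger
  have uU: "u g i \<in> Us" if "g < T" "i \<le> J" for g i using that Us(1) by force
  have tT: "t g i m \<in> Ts" if "g < T" "i \<le> J" "m \<le> L" for g i m using that Ts(1) by force
  have UsE: "\<exists>g i. g < T \<and> i \<le> J \<and> v = u g i" if "v \<in> Us" for v using that Us(1) by auto
  have TsE: "\<exists>g i m. g < T \<and> i \<le> J \<and> m \<le> L \<and> v = t g i m" if "v \<in> Ts" for v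
    using that Ts(1) by auto
  have f0u: "f0 (u g i) = t g i 0" if "g < T" "i \<le> J" for g i
    using the_inv_into_f_f[OF Us(2), of "(g, i)"] that uU[OF that] by (simp add: f0_def)
  have f0t: "f0 (t g i m) = (if m = L then nx g i else t g i (Suc m))"
    if "g < T" "i \<le> J" "m \<le> L" for g i m
  proof -
    have "t g i m \<notin> Us" using tT[OF that] parts(2) by blast
    then show ?thesis
      using the_inv_into_f_f[OF Ts(2), of "(g, i, m)"] that tT[OF that] by (simp add: f0_def)
  qed
  have f0h: "f0 v = h v" if "v \<in> O'" for v
  proof -
    have "v \<notin> Us" "v \<notin> Ts" using that parts by blast+
    then show ?thesis by (simp add: f0_def)
  qed
  have AU: "(\<lambda>g. u g 0) ` {..<T} \<subseteq> Us" using uU by auto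
  have sT: "Suc g mod T < T" for g using T by simp
  have nxV: "nx g i \<in> V" if "g < T" "i \<le> J" for g i
    using that b uU[OF sT J1] uU[of g "Suc i"] by (auto simp: nx parts(1))
  have f0V: "f0 v \<in> V" if "v \<in> V" for v
  proof -
    consider "v \<in> Us" | "v \<in> Ts" | "v \<in> O'" using \<open>v \<in> V\<close> parts(1) by blast
    then show ?thesis
    proof cases
      case 1
      then obtain g i where "g < T" "i \<le> J" "v = u g i" using UsE by blast
      then show ?thesis using f0u tT[of g i 0] parts(1) by simp
    next
      case 2
      then obtain g i m where "g < T" "i \<le> J" "m \<le> L" "v = t g i m" using TsE by blast
      then show ?thesis using f0t tT[of g i "Suc m"] nxV parts(1) by simp
    next
      case 3
      then have "h v \<in> h ` O'" by simp
      then show ?thesis using f0h[OF 3] h AU parts(1) by auto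
    qed
  qed
  have tV: "t g i m \<in> V" if "g < T" "i \<le> J" "m \<le> L" for g i m using tT[OF that] parts(1) by blast
  have uV: "u g i \<in> V" if "g < T" "i \<le> J" for g i using uU[OF that] parts(1) by blast
  have OV: "v \<in> V" if "v \<in> O'" for v using that parts(1) by blast
  have f0nx: "f0 (t g i L) = nx g i" if "g < T" "i \<le> J" for g i using f0t that by simp
  have prev: "\<exists>g'<T. Suc g' mod T = g" if "g < T" for g
  proof (cases g)
    case 0
    then show ?thesis using T by (intro exI[of _ "T - 1"]) simp
  next
    case (Suc g')
    then show ?thesis using that by (intro exI[of _ g']) simp
  qed
  \<comment> \<open>As \<open>V\<close> is finite, surjectivity suffices; it is shown by naming a
    predecessor for each kind of vertex.\<close>
  have surj: "\<exists>x\<in>V. f0 x = v" if "v \<in> V" for v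
  proof -
    consider (u) "v \<in> Us" | (t) "v \<in> Ts" | (b) "v \<in> b ` {..<T}" | (r) "v \<in> O' - b ` {..<T}"
      using \<open>v \<in> V\<close> parts(1) by blast
    then show ?thesis
    proof cases
      case u
      then obtain g i where gi: "g < T" "i \<le> J" "v = u g i" using UsE by blast
      consider "i = 0" | "i = 1" | "i \<ge> 2" by linarith
      then show ?thesis
      proof cases
        case 1
        then have "v \<in> h ` O'" using gi h by auto
        then obtain w where "w \<in> O'" "v = h w" by (rule imageE) metis
        then show ?thesis using f0h OV by metis
      next
        case 2
        obtain g' where g': "g' < T" "Suc g' mod T = g" using prev gi by blast
        have "f0 (t g' J L) = v" using f0nx[OF g'(1), of J] nx J1 g' gi 2 by simp
        then show ?thesis using tV[OF g'(1), of J L] by blast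
      next
        case 3
        have "i - 1 \<noteq> J" "i - 1 \<le> J" "i - 1 \<noteq> 0" "Suc (i - 1) = i" using gi(2) 3 by linarith+
        then have "f0 (t g (i - 1) L) = v" using f0nx[OF gi(1), of "i - 1"] nx gi by simp
        then show ?thesis using tV[OF gi(1), of "i - 1" L] gi by auto
      qed
    next
      case t
      then obtain g i m where gi: "g < T" "i \<le> J" "m \<le> L" "v = t g i m" using TsE by blast
      show ?thesis
      proof (cases m)
        case 0
        then show ?thesis using f0u[OF gi(1,2)] uV[OF gi(1,2)] gi by metis
      next
        case (Suc m')
        have "f0 (t g i m') = v" using f0t[OF gi(1,2), of m'] gi Suc by simp
        then show ?thesis using tV[OF gi(1,2), of m'] gi Suc by auto
      qed
    next
      case b
      then obtain g where g: "g < T" "v = b g" by auto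
      have "f0 (t g 0 L) = v" using f0nx[OF g(1), of 0] nx g by simp
      then show ?thesis using tV[OF g(1), of 0 L] by auto
    next
      case r
      then have "v \<in> h ` O'" using h by auto
      then obtain w where "w \<in> O'" "v = h w" by (rule imageE) metis
      then show ?thesis using f0h OV by metis
    qed
  qed
  have "f0 ` V = V" using f0V surj by blast
  then have bij: "bij_betw f0 V V" using V by (simp add: bij_betw_def finite_surj_inj)
  have pow: "(f0 ^^ m) (t g i 0) = t g i m" if "g < T" "i \<le> J" "m \<le> L" for g i m
    using that(3)
  proof (induction m)
    case (Suc m)
    then show ?case using f0t[OF that(1,2), of m] by simp
  qed simp
  have fV: "f0 ` V \<subseteq> V" using f0V by blast
  have u_t: "(u g i, t g i m) \<in> cyc V f0" if "g < T" "i \<le> J" "m \<le> L" for g i m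
  proof -
    have "(u g i, t g i 0) \<in> cyc V f0" using cyc_step[OF uV[OF that(1,2)], of f0] f0u that by simp
    moreover have "(t g i 0, (f0 ^^ m) (t g i 0)) \<in> cyc V f0"
      by (rule cyc_funpow[OF fV tV]) (use that in auto)
    ultimately show ?thesis using pow[OF that] cyc_trans by metis
  qed
  have u_nx: "(u g i, nx g i) \<in> cyc V f0" if "g < T" "i \<le> J" for g i
    using u_t[OF that order.refl] cyc_step[OF tV[OF that order.refl], of f0] f0nx[OF that] cyc_trans
    by metis
  have u_1: "(u g 1, u g i) \<in> cyc V f0" if "g < T" "1 \<le> i" "i \<le> J" for g i
    using that(2,3)
  proof (induction i rule: dec_induct)
    case base
    then show ?case by (simp add: cyc_refl)
  next
    case (step i)
    have "(u g i, u g (Suc i)) \<in> cyc V f0" using u_nx[OF that(1), of i] step nx by simp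
    then show ?case using step cyc_trans by (metis Suc_leD)
  qed
  have u_g: "(u 0 1, u g 1) \<in> cyc V f0" if "g < T" for g
    using that
  proof (induction g)
    case 0
    then show ?case by (simp add: cyc_refl)
  next
    case (Suc g)
    have "(u g J, u (Suc g) 1) \<in> cyc V f0" using u_nx[of g J] Suc.prems nx J1 by simp
    moreover have "(u g 1, u g J) \<in> cyc V f0" using u_1[of g J] Suc.prems J1 by simp
    ultimately show ?case using Suc cyc_trans by (metis Suc_lessD)
  qed
  have "\<exists>f. bij_betw f V V \<and> (\<forall>x\<in>V. (x, f x) \<in> E) \<and> cyc V f0 \<subseteq> cyc V f \<and>
    (\<forall>g\<in>{..<T}. (u g 0, u g 1) \<in> cyc V f)"
  proof (rule merge_all[OF V bij J])
    show "inj_on ?u ({..<T} \<times> {..J})" by (rule Us(2))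
    show "u g i \<in> V" if "g \<in> {..<T}" "i \<le> J" for g i using uV that by simp
    show "(u g i, u g 1) \<in> cyc V f0" if "g \<in> {..<T}" "1 \<le> i" "i \<le> J" for g i
      using cyc_sym[OF u_1[of g i]] that by simp
    show "(u g i, f0 (u g (Suc i))) \<in> E" if "g \<in> {..<T}" "i < J" for g i
      using f0u E(4) that by simp
    show "(u g J, f0 (u g 0)) \<in> E" if "g \<in> {..<T}" for g using f0u E(5) that by simp
    show "\<exists>m. (f0 ^^ m) (f0 (u g i)) = u g (Suc i) \<and>
        (\<forall>k<m. (f0 ^^ k) (f0 (u g i)) \<notin> ?u ` ({..<T} \<times> {..J}))"
      if "g \<in> {..<T}" "1 \<le> i" "i < J" for g i
    \<comment> \<open>\<open>L\<close> steps along the chain that starts in \<open>t g i 0\<close>,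
      and one more to \<open>u g (Suc i)\<close>; all vertices before that belong to
      \<open>Ts\<close>.\<close>
    proof (intro exI[of _ "Suc L"] conjI allI impI)
      have gi: "g < T" "i \<le> J" using that by auto
      show "(f0 ^^ Suc L) (f0 (u g i)) = u g (Suc i)"
        using f0u[OF gi] pow[OF gi, of L] f0nx[OF gi] nx that by simp
      fix k assume "k < Suc L"
      then have "(f0 ^^ k) (f0 (u g i)) \<in> Ts" using f0u[OF gi] pow[OF gi, of k] tT[OF gi] by simp
      then show "(f0 ^^ k) (f0 (u g i)) \<notin> ?u ` ({..<T} \<times> {..J})"
        using parts(2) Us(1) by blast
    qed
    show "(x, f0 x) \<in> E" if "x \<in> V" for x
    proof -
      consider "x \<in> Us" | "x \<in> Ts" | "x \<in> O'" using \<open>x \<in> V\<close> parts(1) by blast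
      then show ?thesis
      proof cases
        case 1
        then obtain g i where "g < T" "i \<le> J" "x = u g i" using UsE by blast
        then show ?thesis using f0u E(1) by simp
      next
        case 2
        then obtain g i m where "g < T" "i \<le> J" "m \<le> L" "x = t g i m" using TsE by blast
        then show ?thesis using f0t E(2,3) by simp
      next
        case 3
        then show ?thesis using f0h E(6) by simp
      qed
    qed
  qed simp
  then obtain f where f: "bij_betw f V V" "\<And>x. x \<in> V \<Longrightarrow> (x, f x) \<in> E" "cyc V f0 \<subseteq> cyc V f"
    "\<And>g. g < T \<Longrightarrow> (u g 0, u g 1) \<in> cyc V f" by auto
  have allu: "(u 0 1, u g i) \<in> cyc V f" if "g < T" "i \<le> J" for g i
  proof (cases "i = 0")
    case True
    then show ?thesis
      using cyc_trans[OF subsetD[OF f(3) u_g[OF that(1)]] cyc_sym[OF f(4)[OF that(1)]]] by simp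
  next
    case False
    then have "(u g 1, u g i) \<in> cyc V f0" using u_1 that by simp
    then show ?thesis by (rule subsetD[OF f(3) cyc_trans[OF u_g[OF that(1)]]])
  qed
  have all: "(u 0 1, v) \<in> cyc V f" if "v \<in> V" for v
  proof -
    consider "v \<in> Us" | "v \<in> Ts" | "v \<in> O'" using \<open>v \<in> V\<close> parts(1) by blast
    then show ?thesis
    proof cases
      case 1
      then show ?thesis using allu UsE by blast
    next
      case 2
      then obtain g i m where gi: "g < T" "i \<le> J" "m \<le> L" "v = t g i m" using TsE by blast
      have "(u g i, v) \<in> cyc V f" using u_t[OF gi(1-3)] gi(4) f(3) by blast
      then show ?thesis using allu[OF gi(1,2)] cyc_trans by metis
    next
      case 3
      then obtain m where m: "(h ^^ m) v \<in> (\<lambda>g. u g 0) ` {..<T}" "\<And>k. k < m \<Longrightarrow> (h ^^ k) v \<in> O'"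
        using reach by blast
      have eq: "(f0 ^^ k) v = (h ^^ k) v" if "k \<le> m" for k
        using that
      proof (induction k)
        case (Suc k)
        then show ?case using f0h[OF m(2)[of k]] by simp
      qed simp
      have "(v, (f0 ^^ m) v) \<in> cyc V f0" by (rule cyc_funpow[OF fV that]) simp
      then have 1: "(v, (h ^^ m) v) \<in> cyc V f" using eq f(3) by auto
      obtain g where "g < T" "(h ^^ m) v = u g 0" using m(1) by auto
      then have "(u 0 1, (h ^^ m) v) \<in> cyc V f" using allu[of g 0] by simp
      then show ?thesis using cyc_trans[OF _ cyc_sym[OF 1]] by blast
    qed
  qed
  have "(v, w) \<in> cyc V f" if "v \<in> V" "w \<in> V" for v w
    by (rule cyc_trans[OF cyc_sym[OF all[OF that(1)]] all[OF that(2)]])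
  then have "V \<times> V \<subseteq> cyc V f" by auto
  then show ?thesis using f by blast
qed

section \<open>Expansion on index sets, and routes with pairwise distinct vertices\<close>

lemma expands_mono:
  assumes "expands R D W \<theta>" "D' \<subseteq> D" "W \<subseteq> W'" "finite W'"
  shows "expands R D' W' \<theta>"
  unfolding expands_def
proof (intro allI impI)
  fix X assume "X \<subseteq> D'"
  then have "min (8 * real (card X)) \<theta> \<le> card (R `` X \<inter> W)"
    using assms(1,2) by (intro expandsD[OF assms(1)]) auto
  also have "\<dots> \<le> card (R `` X \<inter> W')" using assms(3,4) by (intro of_nat_mono card_mono) auto
  finally show "min (8 * real (card X)) \<theta> \<le> card (R `` X \<inter> W')" .
qed

lemma expands_inj:
  assumes "expands R D W \<theta>" "inj_on f I" "f ` I \<subseteq> D"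
  shows "expands {(i, v). (f i, v) \<in> R} I W \<theta>"
  unfolding expands_def
proof (intro allI impI)
  fix X assume X: "X \<subseteq> I"
  have "min (8 * real (card (f ` X))) \<theta> \<le> card (R `` (f ` X) \<inter> W)"
    by (rule expandsD[OF assms(1)]) (use X assms(3) in auto)
  moreover have "card (f ` X) = card X" using X assms(2) inj_on_subset card_image by blast
  moreover have "{(i, v). (f i, v) \<in> R} `` X = R `` (f ` X)" by auto
  ultimately show "min (8 * real (card X)) \<theta> \<le> card ({(i, v). (f i, v) \<in> R} `` X \<inter> W)" by simp
qed

text \<open>The layers of all rounds and positions are disjoint here, which turns the distinctness
  within one layer into distinctness of all vertices of all routes. \<open>J\<close> rounds suffice
  because \<open>card I < 2 ^ J\<close>.\<close>

lemma connect_inj: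
  fixes \<theta> s :: real
  assumes I: "finite I" "real (card I) \<le> s" "card I < 2 ^ J" and J: "J \<ge> 1"
    and W: "\<And>k j. k < J \<Longrightarrow> j \<le> 2 * J \<Longrightarrow> finite (W k j)"
    and disj: "\<And>k j k' j'. k < J \<Longrightarrow> j \<le> 2 * J \<Longrightarrow> k' < J \<Longrightarrow> j' \<le> 2 * J \<Longrightarrow> W k j \<inter> W k' j' \<noteq> {} \<Longrightarrow>
      k = k' \<and> j = j'"
    and ex0: "\<And>k. k < J \<Longrightarrow> expands S I (W k 0) \<theta>" "\<And>k. k < J \<Longrightarrow> expands (T\<inverse>) I (W k (2 * J)) \<theta>"
    and ex: "\<And>k j. k < J \<Longrightarrow> j < 2 * J \<Longrightarrow> expands (R j) (W k j) (W k (Suc j)) \<theta>"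
      "\<And>k j. k < J \<Longrightarrow> j < 2 * J \<Longrightarrow> expands ((R j)\<inverse>) (W k (Suc j)) (W k j) \<theta>"
    and th: "2 * s \<le> \<theta>" "\<theta> \<le> 4 * 2 ^ J" "\<And>k. k < J \<Longrightarrow> real (card (W k J)) < 2 * (\<theta> - s)"
  shows "\<exists>x. (\<forall>i\<in>I. (i, x i 0) \<in> S \<and> (x i (2 * J), i) \<in> T \<and> (\<forall>j<2 * J. (x i j, x i (Suc j)) \<in> R j) \<and>
      (\<forall>j\<le>2 * J. x i j \<in> (\<Union>k<J. W k j))) \<and> inj_on (\<lambda>(i, j). x i j) (I \<times> {..2 * J})"
proof -
  have "\<exists>st x. (\<forall>i\<in>I. st i < J \<and> route S R T (W (st i)) (2 * J) i (x i)) \<and>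
    (\<forall>i\<in>I. \<forall>i'\<in>I. \<forall>j\<le>2 * J. i \<noteq> i' \<longrightarrow> st i = st i' \<longrightarrow> x i j \<noteq> x i' j)"
    by (rule connect_all[OF I(1) subset_refl I(2,3,3) J W ex0 ex th])
  then obtain st x where x: "\<And>i. i \<in> I \<Longrightarrow> st i < J" "\<And>i. i \<in> I \<Longrightarrow> route S R T (W (st i)) (2 * J) i (x i)"
    "\<And>i i' j. i \<in> I \<Longrightarrow> i' \<in> I \<Longrightarrow> j \<le> 2 * J \<Longrightarrow> i \<noteq> i' \<Longrightarrow> st i = st i' \<Longrightarrow> x i j \<noteq> x i' j"
    by metis
  have xW: "x i j \<in> W (st i) j" if "i \<in> I" "j \<le> 2 * J" for i j
    using x(2)[OF that(1)] that(2) by (simp add: route_def)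
  have "inj_on (\<lambda>(i, j). x i j) (I \<times> {..2 * J})"
  proof (rule inj_onI, clarsimp)
    fix i j i' j' assume a: "i \<in> I" "j \<le> 2 * J" "i' \<in> I" "j' \<le> 2 * J" "x i j = x i' j'"
    have "W (st i) j \<inter> W (st i') j' \<noteq> {}" using xW[OF a(1,2)] xW[OF a(3,4)] a(5) by auto
    then have "st i = st i'" "j = j'" using disj[of "st i" j "st i'" j'] x(1) a by auto
    then show "i = i' \<and> j = j'" using x(3)[of i i' j] a by metis
  qed
  moreover have "\<forall>i\<in>I. (i, x i 0) \<in> S \<and> (x i (2 * J), i) \<in> T \<and> (\<forall>j<2 * J. (x i j, x i (Suc j)) \<in> R j) \<and>
      (\<forall>j\<le>2 * J. x i j \<in> (\<Union>k<J. W k j))"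
    using x(1,2) xW unfolding route_def by (intro ballI) blast
  ultimately show ?thesis by blast
qed


section \<open>Covering the remaining vertices by paths\<close>

lemma disjoint_subsets_of_card:
  fixes k :: nat
  assumes "finite L" "(\<Sum>i<k. c i) \<le> card L"
  shows "\<exists>X. (\<forall>i<k. X i \<subseteq> L \<and> card (X i) = c i) \<and> disjoint_family_on X {..<k}"
  using assms(2)
proof (induction k)
  case 0
  then show ?case by (simp add: disjoint_family_on_def)
next
  case (Suc k)
  then obtain X where X: "\<And>i. i < k \<Longrightarrow> X i \<subseteq> L \<and> card (X i) = c i" "disjoint_family_on X {..<k}"
    by auto
  have fin: "finite (X i)" if "i < k" for i using X(1)[OF that] assms(1) finite_subset by blast
  have "card (\<Union>i<k. X i) = (\<Sum>i<k. card (X i))"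
    by (rule card_UN_disjoint) (use fin X(2) in \<open>auto simp: disjoint_family_on_def\<close>)
  also have "\<dots> = (\<Sum>i<k. c i)" using X(1) by simp
  finally have "card (\<Union>i<k. X i) = (\<Sum>i<k. c i)" .
  moreover have "(\<Union>i<k. X i) \<subseteq> L" using X(1) by auto
  ultimately have "c k \<le> card (L - (\<Union>i<k. X i))"
    using Suc.prems fin by (subst card_Diff_subset) auto
  then obtain Y where Y: "Y \<subseteq> L - (\<Union>i<k. X i)" "card Y = c k"
    by (metis obtain_subset_with_card_n)
  show ?case
  proof (intro exI[of _ "X(k := Y)"] conjI allI impI)
    fix i assume "i < Suc k"
    then show "(X(k := Y)) i \<subseteq> L" "card ((X(k := Y)) i) = c i" using X(1)[of i] Y by auto
  next
    show "disjoint_family_on (X(k := Y)) {..<Suc k}"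
      using X(2) Y(1) unfolding disjoint_family_on_def by (auto simp: less_Suc_eq) blast+
  qed
qed

text \<open>Each core \<open>Vc i\<close> is topped up to exactly \<open>T\<close> vertices. A block
  that contains its core inherits the expansion of the core, whatever vertices are added.\<close>

lemma fill_blocks:
  assumes R: "finite R" "card R = T * k + e"
    and Vc: "\<And>i. i < k \<Longrightarrow> Vc i \<subseteq> R" "\<And>i. i < k \<Longrightarrow> card (Vc i) \<le> T" "disjoint_family_on Vc {..<k}"
  shows "\<exists>U. (\<forall>i<k. Vc i \<subseteq> U i \<and> U i \<subseteq> R \<and> card (U i) = T) \<and> disjoint_family_on U {..<k} \<and>
    card (R - (\<Union>i<k. U i)) = e"
proof -
  define L where "L = R - (\<Union>i<k. Vc i)"
  have fin: "finite (Vc i)" if "i < k" for i using Vc(1)[OF that] R finite_subset by blast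
  have "card (\<Union>i<k. Vc i) = (\<Sum>i<k. card (Vc i))"
    by (rule card_UN_disjoint) (use fin Vc(3) in \<open>auto simp: disjoint_family_on_def\<close>)
  then have cL: "card L = T * k + e - (\<Sum>i<k. card (Vc i))"
    unfolding L_def using R Vc(1) fin by (subst card_Diff_subset) auto
  have "(\<Sum>i<k. T - card (Vc i)) + (\<Sum>i<k. card (Vc i)) = (\<Sum>i<k. T)"
    unfolding sum.distrib[symmetric] using Vc(2) by (intro sum.cong) auto
  then have "(\<Sum>i<k. T - card (Vc i)) \<le> card L" using cL by (simp add: mult.commute)
  then obtain X where X: "\<And>i. i < k \<Longrightarrow> X i \<subseteq> L" "\<And>i. i < k \<Longrightarrow> card (X i) = T - card (Vc i)"
    "disjoint_family_on X {..<k}"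
    using disjoint_subsets_of_card[where L = L and k = k and c = "\<lambda>i. T - card (Vc i)"] R by (auto simp: L_def)
  define U where "U i = Vc i \<union> X i" for i
  have finX: "finite (X i)" if "i < k" for i
    using finite_subset[OF X(1)[OF that]] R by (simp add: L_def)
  have cU: "card (U i) = T" if "i < k" for i
  proof -
    have "Vc i \<inter> X i = {}" using X(1)[OF that] that by (auto simp: L_def)
    then show ?thesis using X(2)[OF that] Vc(2)[OF that] fin[OF that] finX[OF that]
      by (simp add: U_def card_Un_disjoint)
  qed
  have UR: "U i \<subseteq> R" if "i < k" for i using X(1)[OF that] Vc(1)[OF that] by (auto simp: U_def L_def)
  have dU: "disjoint_family_on U {..<k}"
    unfolding disjoint_family_on_def
  proof (intro ballI impI)
    fix i j assume ij: "i \<in> {..<k}" "j \<in> {..<k}" "i \<noteq> j"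
    have "Vc i \<inter> Vc j = {}" "X i \<inter> X j = {}" using ij Vc(3) X(3) unfolding disjoint_family_on_def by auto
    moreover have "X i \<inter> Vc j = {}" "X j \<inter> Vc i = {}" using X(1)[of i] X(1)[of j] ij by (auto simp: L_def)
    ultimately show "U i \<inter> U j = {}" unfolding U_def by blast
  qed
  have "card (\<Union>i<k. U i) = (\<Sum>i<k. card (U i))"
    by (rule card_UN_disjoint) (use fin finX dU in \<open>auto simp: disjoint_family_on_def U_def\<close>)
  also have "\<dots> = T * k" using cU by (simp add: mult.commute)
  finally have "card (R - (\<Union>i<k. U i)) = e"
    using R UR fin finX by (subst card_Diff_subset) (auto simp: U_def)
  then show ?thesis using cU UR dU by (intro exI[of _ U]) (auto simp: U_def)
qed

text \<open>
  The few vertices \<open>Z\<close> left over by the blocks \<open>U i\<close> are placed on both sides of the first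
  matching; since arcs inside \<open>Z\<close> are excluded there, every path still moves forward.
\<close>
lemma path_cover:
  fixes V :: "'a set" and \<theta> :: real
  assumes V: "finite V" "A \<subseteq> V" "B \<subseteq> V" "Rest \<subseteq> V"
    and disj: "A \<inter> Rest = {}" "B \<inter> Rest = {}"
    and card: "card A = T" "card B = T" "card Rest = T * k + e" and k: "k \<ge> 1"
    and Vc: "\<And>i. i < k \<Longrightarrow> Vc i \<subseteq> Rest" "\<And>i. i < k \<Longrightarrow> card (Vc i) \<le> T" "disjoint_family_on Vc {..<k}"
    and ex: "\<And>i. i < k \<Longrightarrow> expands E V (Vc i) \<theta>" "\<And>i. i < k \<Longrightarrow> expands (E\<inverse>) V (Vc i) \<theta>"
      "expands E V A \<theta>" "expands (E\<inverse>) V B \<theta>"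
    and th: "real (T + e) \<le> 2 * \<theta>"
  shows "\<exists>h. h ` (B \<union> Rest) = Rest \<union> A \<and> (\<forall>v\<in>B \<union> Rest. (v, h v) \<in> E) \<and>
    (\<forall>v\<in>B \<union> Rest. \<exists>m. (h ^^ m) v \<in> A \<and> (\<forall>j<m. (h ^^ j) v \<in> B \<union> Rest))"
proof -
  have finR: "finite Rest" using V finite_subset by blast
  obtain U where U: "\<And>i. i < k \<Longrightarrow> Vc i \<subseteq> U i" "\<And>i. i < k \<Longrightarrow> U i \<subseteq> Rest"
    "\<And>i. i < k \<Longrightarrow> card (U i) = T" "disjoint_family_on U {..<k}" "card (Rest - (\<Union>i<k. U i)) = e"
    using fill_blocks[OF finR card(3) Vc] by metis
  define Z where "Z = Rest - (\<Union>i<k. U i)"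
  define E2 where "E2 = E - Z \<times> Z"
  have UZ: "U i \<inter> Z = {}" if "i < k" for i using that by (auto simp: Z_def)
  have Udis: "U i \<inter> U j = {}" if "i < k" "j < k" "i \<noteq> j" for i j
    using U(4) that by (auto simp: disjoint_family_on_def)
  \<comment> \<open>Only arcs with both ends in \<open>Z\<close> were removed, so neighbourhoods
    inside a set disjoint from \<open>Z\<close> are unchanged.\<close>
  have tr: "expands E2 V W \<theta>" if "expands E V W \<theta>" "W \<inter> Z = {}" for W
  proof -
    have "E2 `` X \<inter> W = E `` X \<inter> W" for X using that(2) by (auto simp: E2_def)
    then show ?thesis using that(1) by (simp add: expands_def)
  qed
  have tr': "expands (E2\<inverse>) V W \<theta>" if "expands (E\<inverse>) V W \<theta>" "W \<inter> Z = {}" for W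
  proof -
    have "E2\<inverse> `` X \<inter> W = E\<inverse> `` X \<inter> W" for X using that(2) by (auto simp: E2_def)
    then show ?thesis using that(1) by (simp add: expands_def)
  qed
  have VcZ: "Vc i \<inter> Z = {}" if "i < k" for i using UZ[OF that] U(1)[OF that] by blast
  have ABZ: "A \<inter> Z = {}" "B \<inter> Z = {}" using disj by (auto simp: Z_def)
  have finU: "finite (U i)" if "i < k" for i using U(2)[OF that] finR finite_subset by blast
  have finABZ: "finite A" "finite B" "finite Z"
    using finite_subset[OF V(2,1)] finite_subset[OF V(3,1)] finR by (simp_all add: Z_def)
  \<comment> \<open>The \<open>i\<close>-th matching leads from \<open>D i\<close> to
    \<open>C i\<close>. Each target contains a core or \<open>A\<close>, and each source contains a
    core or \<open>B\<close>. These subsets are disjoint from \<open>Z\<close> and provide all the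
    expansion.\<close>
  define D where "D i = (if i = 0 then B \<union> Z else U (i - 1))" for i
  define C where "C i = (if i = k then A else if i = 0 then U 0 \<union> Z else U i)" for i
  have subV: "D i \<subseteq> V" "C i \<subseteq> V" if "i \<le> k" for i
  proof -
    have "i - 1 < k" "i = k \<or> i < k" using that k by linarith+
    then show "D i \<subseteq> V" "C i \<subseteq> V"
      using V U(2)[of "i - 1"] U(2)[of i] U(2)[of 0] k unfolding D_def C_def Z_def by auto
  qed
  have finDC: "finite (D i)" "finite (C i)" if "i \<le> k" for i
    using subV[OF that] V(1) finite_subset by blast+
  have cardDC: "card (D i) = card (C i)" "card (D i) \<le> T + e" if "i \<le> k" for i
  proof -
    have cZ: "card (B \<union> Z) = T + e" "card (U 0 \<union> Z) = T + e"
      using finABZ ABZ UZ[of 0] finU[of 0] U(3)[of 0] U(5) card k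
      by (auto simp: card_Un_disjoint Z_def[symmetric])
    show "card (D i) = card (C i)" "card (D i) \<le> T + e"
      using cZ U(3)[of "i - 1"] U(3)[of i] card that k by (auto simp: D_def C_def)
  qed
  have "\<exists>h. bij_betw h (D i) (C i) \<and> (\<forall>x\<in>D i. (x, h x) \<in> E2)" if i: "i \<le> k" for i
  proof (rule perfect_matching[where \<theta> = \<theta>])
    show "expands E2 (D i) (C i) \<theta>"
    proof (cases "i = k")
      case True
      show ?thesis
        by (rule expands_mono[OF tr[OF ex(3) ABZ(1)]]) (use subV[OF i] finDC[OF i] True in \<open>auto simp: C_def\<close>)
    next
      case False
      then have "i < k" using i by simp
      show ?thesis
        by (rule expands_mono[OF tr[OF ex(1) VcZ, OF \<open>i < k\<close> \<open>i < k\<close>]])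
          (use subV[OF i] finDC[OF i] U(1)[OF \<open>i < k\<close>] False in \<open>auto simp: C_def\<close>)
    qed
    show "expands (E2\<inverse>) (C i) (D i) \<theta>"
    proof (cases "i = 0")
      case True
      show ?thesis
        by (rule expands_mono[OF tr'[OF ex(4) ABZ(2)]]) (use subV[OF i] finDC[OF i] True in \<open>auto simp: D_def\<close>)
    next
      case False
      then have "i - 1 < k" using i by simp
      show ?thesis
        by (rule expands_mono[OF tr'[OF ex(2) VcZ, OF \<open>i - 1 < k\<close> \<open>i - 1 < k\<close>]])
          (use subV[OF i] finDC[OF i] U(1)[OF \<open>i - 1 < k\<close>] False in \<open>auto simp: D_def\<close>)
    qed
    show "real (card (D i)) \<le> 2 * \<theta>" using cardDC[OF i] th by linarith
  qed (use finDC[OF i] cardDC[OF i] in auto)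
  then obtain hs where hs: "\<And>i. i \<le> k \<Longrightarrow> bij_betw (hs i) (D i) (C i)"
    "\<And>i x. i \<le> k \<Longrightarrow> x \<in> D i \<Longrightarrow> (x, hs i x) \<in> E2" by metis
  have BU: "B \<inter> U i = {}" if "i < k" for i using U(2)[OF that] disj by blast
  have Ddis: "i = j" if "i \<le> k" "j \<le> k" "x \<in> D i" "x \<in> D j" for i j x
  proof -
    have "D 0 \<inter> D j = {}" if "0 < j" "j \<le> k" for j
    proof -
      have "j - 1 < k" using that by linarith
      then show ?thesis using UZ[of "j - 1"] BU[of "j - 1"] that by (auto simp: D_def)
    qed
    moreover have "D i \<inter> D j = {}" if "0 < i" "0 < j" "i \<noteq> j" "i \<le> k" "j \<le> k" for i j
      using Udis[of "i - 1" "j - 1"] that by (auto simp: D_def)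
    ultimately show ?thesis using that by (cases "i = 0"; cases "j = 0") (auto, metis IntI emptyE)
  qed
  define h where "h v = hs (THE i. i \<le> k \<and> v \<in> D i) v" for v
  have h: "h v = hs i v" if "i \<le> k" "v \<in> D i" for i v
  proof -
    have "(THE j. j \<le> k \<and> v \<in> D j) = i" by (rule the_equality) (use that Ddis in blast)+
    then show ?thesis by (simp add: h_def)
  qed
  have RestU: "Rest = Z \<union> (\<Union>i<k. U i)" using U(2) by (auto simp: Z_def)
  have D: "(\<Union>i\<le>k. D i) = B \<union> Rest"
  proof -
    have "{..k} = insert 0 (Suc ` {..<k})" by (auto simp: image_iff Bex_def) presburger
    then have "(\<Union>i\<le>k. D i) = D 0 \<union> (\<Union>i<k. D (Suc i))" by auto
    then show ?thesis using RestU by (auto simp: D_def)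
  qed
  have C: "(\<Union>i\<le>k. C i) = Rest \<union> A"
  proof -
    have "{..k} = insert k {..<k}" by auto
    then have "(\<Union>i\<le>k. C i) = C k \<union> (\<Union>i<k. C i)" by auto
    also have "(\<Union>i<k. C i) = (\<Union>i<k. U i \<union> (if i = 0 then Z else {}))"
      by (rule SUP_cong) (auto simp: C_def)
    also have "\<dots> = Z \<union> (\<Union>i<k. U i)"
    proof -
      have "Z \<subseteq> U 0 \<union> (if (0::nat) = 0 then Z else {})" by simp
      moreover have "0 \<in> {..<k}" using k by simp
      ultimately have "Z \<subseteq> (\<Union>i<k. U i \<union> (if i = 0 then Z else {}))" by blast
      then show ?thesis by (auto split: if_splits)
    qed
    finally show ?thesis using RestU by (auto simp: C_def)
  qed
  have hD: "h ` D i = C i" if "i \<le> k" for i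
  proof -
    have "h ` D i = hs i ` D i" by (rule image_cong) (use h that in auto)
    then show ?thesis using hs(1)[OF that] by (simp add: bij_betw_def)
  qed
  have im: "h ` (B \<union> Rest) = Rest \<union> A" unfolding D[symmetric] C[symmetric] image_UN using hD by simp
  have arc: "(v, h v) \<in> E2" if "v \<in> B \<union> Rest" for v
  proof -
    have "v \<in> (\<Union>i\<le>k. D i)" using that by (simp add: D)
    then obtain i where "i \<le> k" "v \<in> D i" by (rule UN_E) simp
    then show ?thesis using h hs(2) by simp
  qed
  define rch where "rch v \<longleftrightarrow> (\<exists>m. (h ^^ m) v \<in> A \<and> (\<forall>j<m. (h ^^ j) v \<in> B \<union> Rest))" for v
  have rA: "rch v" if "v \<in> A" for v unfolding rch_def using that by (intro exI[of _ 0]) simp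
  have rS: "rch v" if r: "rch (h v)" "v \<in> B \<union> Rest" for v
  proof -
    obtain m where m: "(h ^^ m) (h v) \<in> A" "\<And>j. j < m \<Longrightarrow> (h ^^ j) (h v) \<in> B \<union> Rest"
      using r(1) unfolding rch_def by metis
    have "(h ^^ j) v \<in> B \<union> Rest" if "j < Suc m" for j
      using m(2)[of "j - 1"] that \<open>v \<in> B \<union> Rest\<close> by (cases j) (simp_all add: funpow_swap1)
    moreover have "(h ^^ Suc m) v \<in> A" using m(1) by (simp add: funpow_swap1)
    ultimately show ?thesis unfolding rch_def by blast
  qed
  have DO: "v \<in> B \<union> Rest" if "v \<in> D i" "i \<le> k" for v i using D that by blast
  have pos: "rch v" if "1 \<le> i" "i \<le> k" "v \<in> D i" for i v
    using that
  proof (induction "k - i" arbitrary: i v)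
    case 0
    then have "h v \<in> A" using hD[of i] by (auto simp: C_def)
    then show ?case using rA rS DO 0 by blast
  next
    case (Suc n)
    then have "i < k" "h v \<in> C i" using hD[of i] by auto
    then have "h v \<in> D (Suc i)" using Suc.prems by (auto simp: C_def D_def)
    then have "rch (h v)" using Suc by (intro Suc.hyps(1)[of "Suc i"]) auto
    then show ?case using rS DO Suc by blast
  qed
  have h0: "h v \<in> D 1 \<union> Z" if "v \<in> B \<union> Z" for v
    using hD[of 0] that k by (auto simp: C_def D_def)
  \<comment> \<open>A vertex of \<open>Z\<close> is not matched into \<open>Z\<close>, so it enters
    the first block. A path from \<open>B\<close> therefore passes through \<open>Z\<close> at most
    once.\<close>
  have rZ: "rch v" if "v \<in> Z" for v
  proof -
    have vO: "v \<in> B \<union> Rest" using that RestU by blast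
    have "h v \<notin> Z" using arc[OF vO] that by (auto simp: E2_def)
    then have "h v \<in> D 1" using h0[of v] that by blast
    then show ?thesis using rS[OF pos[of 1] vO] k by blast
  qed
  have rB: "rch v" if "v \<in> B" for v
  proof -
    have vO: "v \<in> B \<union> Rest" using that by blast
    have "rch (h v)" using h0[of v] that rZ pos[of 1] k by blast
    then show ?thesis by (rule rS[OF _ vO])
  qed
  have rU: "rch v" if "i < k" "v \<in> U i" for v i
    by (rule pos[of "Suc i"]) (use that in \<open>auto simp: D_def\<close>)
  have "rch v" if "v \<in> B \<union> Rest" for v
    using that rB rZ rU RestU by blast
  then show ?thesis using im arc unfolding rch_def by (intro exI[of _ h]) (auto simp: E2_def)
qed


section \<open>The deterministic construction\<close>

text \<open>
  \<open>Seed\<close> are the vertices $u_0$ of the gadgets and \<open>Start\<close> the first vertices of the covering paths.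
  The vertices of the alternating walks and of the links are taken from the layers \<open>Alt q j\<close> and
  \<open>Link q j\<close>, where \<open>q\<close> is the round of the connection procedure and \<open>j\<close> the position on the path;
  \<open>Spare\<close> vertices are used to adjust the sizes of \<open>Seed\<close> and \<open>Start\<close>.
\<close>
datatype role = Seed | Start | Alt nat nat | Link nat nat | Block nat | Spare nat

definition role_class :: "'a set \<Rightarrow> ('a \<Rightarrow> role) \<Rightarrow> role \<Rightarrow> 'a set" where
  "role_class V col c = {v \<in> V. col v = c}"

lemma role_class_subset: "role_class V col c \<subseteq> V"
  by (auto simp: role_class_def)

text \<open>Two strengths of expansion occur: \<theta> for the layers, which must survive the loss
  of up to \<open>s\<close> used vertices, and \<theta>' for the classes used in matchings. One
  gadget takes \<open>J + 1\<close> vertices u_i and as many chains of \<open>2 * J + 2\<close>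
  vertices, together \<open>(J + 1) * (2 * J + 3)\<close>. One vertex of \<open>Start\<close> and
  one from each of \<open>k\<close> blocks complete its share of \<open>V\<close>; \<open>e\<close>
  is the remainder.\<close>

lemma hamilton_core:
  fixes V :: "'a set" and \<theta> \<theta>' s :: real and col :: "'a \<Rightarrow> role"
  assumes V: "finite V" and J: "odd J" and T: "T \<ge> 1" and k: "k \<ge> 1"
    and ends: "card (role_class V col Seed) = T" "card (role_class V col Start) = T"
    and blocks: "\<And>i. i < k \<Longrightarrow> card (role_class V col (Block i)) \<le> T"
    and layers: "\<And>q j c. q < J \<Longrightarrow> j \<le> 2 * J \<Longrightarrow> c \<in> {Alt q j, Link q j} \<Longrightarrow>
       expands E V (role_class V col c) \<theta> \<and> expands (E\<inverse>) V (role_class V col c) \<theta> \<and>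
       real (card (role_class V col c)) < 2 * (\<theta> - s)"
    and ex': "\<And>c. c \<in> {Seed, Start} \<union> Block ` {..<k} \<Longrightarrow>
       expands E V (role_class V col c) \<theta>' \<and> expands (E\<inverse>) V (role_class V col c) \<theta>'"
    and s: "real (T * (J + 1)) \<le> s" "T * (J + 1) < 2 ^ J" "2 * s \<le> \<theta>" "\<theta> \<le> 4 * 2 ^ J"
    and n: "card V = T * (k + (J + 1) * (2 * J + 3) + 1) + e" and e: "real (T + e) \<le> 2 * \<theta>'"
  shows "\<exists>f. bij_betw f V V \<and> (\<forall>x\<in>V. (x, f x) \<in> E) \<and> V \<times> V \<subseteq> cyc V f"
proof -
  note cls = role_class_def[of V col]
  have J1: "J \<ge> 1" using J by presburger
  let ?A = "role_class V col Seed" and ?B = "role_class V col Start"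
  have fincls: "finite (role_class V col c)" for c using V role_class_subset finite_subset by metis
  obtain a where a: "bij_betw a {..<T} ?A"
    using ex_bij_betw_nat_finite[OF fincls, of Seed] ends by (auto simp: atLeast0LessThan)
  obtain b where b: "bij_betw b {..<T} ?B"
    using ex_bij_betw_nat_finite[OF fincls, of Start] ends by (auto simp: atLeast0LessThan)
  have a_in: "a g \<in> V" "col (a g) = Seed" if "g < T" for g
    using bij_betwE[OF a] that by (auto simp: cls)
  have b_in: "b g \<in> V" "col (b g) = Start" if "g < T" for g
    using bij_betwE[OF b] that by (auto simp: cls)
  have a_inj: "g = g'" if "a g = a g'" "g < T" "g' < T" for g g'
    using inj_onD[OF bij_betw_imp_inj_on[OF a] that(1)] that by simp
  have b_inj: "g = g'" if "b g = b g'" "g < T" "g' < T" for g g'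
    using inj_onD[OF bij_betw_imp_inj_on[OF b] that(1)] that by simp
  have TJ: "T \<le> T * (J + 1)" by simp
  have aV: "a ` {..<T} \<subseteq> V" using a_in by auto

  \<comment> \<open>Alternating closed walks through the seeds\<close>
  have layA: "expands E V (role_class V col (Alt q j)) \<theta>" "expands (E\<inverse>) V (role_class V col (Alt q j)) \<theta>"
    "real (card (role_class V col (Alt q j))) < 2 * (\<theta> - s)" if "q < J" "j \<le> 2 * J" for q j
    using layers[OF that, of "Alt q j"] by auto
  have layL: "expands E V (role_class V col (Link q j)) \<theta>" "expands (E\<inverse>) V (role_class V col (Link q j)) \<theta>"
    "real (card (role_class V col (Link q j))) < 2 * (\<theta> - s)" if "q < J" "j \<le> 2 * J" for q j
    using layers[OF that, of "Link q j"] by auto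
  \<comment> \<open>Positions with even index are heads and those with odd index are tails. Both
    \<open>x g 0\<close> and \<open>x g (2 * J)\<close> are out-neighbours of the seed, which closes
    the walk.\<close>
  define R where "R j = (if even j then E\<inverse> else E)" for j :: nat
  have convS: "{(v, g). (a g, v) \<in> E}\<inverse> = {(g, v). (a g, v) \<in> E}" by auto
  have exS: "expands {(g, v). (a g, v) \<in> E} {..<T} (role_class V col (Alt q j)) \<theta>"
    if "q < J" "j \<le> 2 * J" for q j
    by (rule expands_inj[OF layA(1)[OF that] bij_betw_imp_inj_on[OF a] aV])
  have "\<exists>x. (\<forall>i\<in>{..<T}. (i, x i 0) \<in> {(g, v). (a g, v) \<in> E} \<and> (x i (2 * J), i) \<in> {(v, g). (a g, v) \<in> E} \<and>
      (\<forall>j<2 * J. (x i j, x i (Suc j)) \<in> R j) \<and> (\<forall>j\<le>2 * J. x i j \<in> (\<Union>q<J. role_class V col (Alt q j)))) \<and>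
      inj_on (\<lambda>(i, j). x i j) ({..<T} \<times> {..2 * J})"
  proof (rule connect_inj[where \<theta> = \<theta> and s = s])
    show "real (card {..<T}) \<le> s" using s(1) TJ by (simp add: of_nat_mono[OF TJ, THEN order_trans])
    show "card {..<T} < 2 ^ J" using s(2) TJ by simp
    show "q = q' \<and> j = j'" if "role_class V col (Alt q j) \<inter> role_class V col (Alt q' j') \<noteq> {}" for q j q' j'
      using that by (auto simp: cls)
    show "expands (R j) (role_class V col (Alt q j)) (role_class V col (Alt q (Suc j))) \<theta>"
      "expands ((R j)\<inverse>) (role_class V col (Alt q (Suc j))) (role_class V col (Alt q j)) \<theta>"
      if "q < J" "j < 2 * J" for q j
      using expands_subset[OF layA(1) role_class_subset] expands_subset[OF layA(2) role_class_subset] that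
      by (simp_all add: R_def)
  qed (use J1 fincls exS convS layA(3) s in auto)
  then obtain x where xx: "(\<forall>i\<in>{..<T}. (i, x i 0) \<in> {(g, v). (a g, v) \<in> E} \<and> (x i (2 * J), i) \<in> {(v, g). (a g, v) \<in> E} \<and>
      (\<forall>j<2 * J. (x i j, x i (Suc j)) \<in> R j) \<and> (\<forall>j\<le>2 * J. x i j \<in> (\<Union>q<J. role_class V col (Alt q j)))) \<and>
      inj_on (\<lambda>(i, j). x i j) ({..<T} \<times> {..2 * J})" ..
  have x: "(a g, x g 0) \<in> E" "(a g, x g (2 * J)) \<in> E" "\<And>j. j < 2 * J \<Longrightarrow> (x g j, x g (Suc j)) \<in> R j"
    "\<And>j. j \<le> 2 * J \<Longrightarrow> x g j \<in> (\<Union>q<J. role_class V col (Alt q j))" if "g < T" for g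
    using conjunct1[OF xx] that by simp_all
  note xinj = conjunct2[OF xx]
  have x_in: "x g j \<in> V" "\<exists>q. col (x g j) = Alt q j" if "g < T" "j \<le> 2 * J" for g j
    using x(4)[OF that] by (auto simp: cls)
  have x_inj: "g = g'" "j = j'" if "x g j = x g' j'" "g < T" "g' < T" "j \<le> 2 * J" "j' \<le> 2 * J" for g g' j j'
    using inj_onD[OF xinj, of "(g, j)" "(g', j')"] that by auto
  \<comment> \<open>The numbering gives \<open>u g i\<close> arcs to \<open>w g i\<close> and
    \<open>w g (Suc i)\<close>. Index 0 closes the walk, with the seed between
    \<open>x g (2 * J)\<close> and \<open>x g 0\<close>; the truncated subtractions matter only for
    \<open>i > 0\<close>.\<close>
  define u where "u g i = (if i = 0 then a g else x g (2 * i - 1))" for g i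
  define w where "w g i = (if i = 0 then x g (2 * J) else x g (2 * i - 2))" for g i
  define nx where "nx g i = (if i = 0 then b g else if i = J then u (Suc g mod T) 1 else u g (Suc i))" for g i
  have sT: "Suc g mod T < T" for g using T by simp
  have u_in: "u g i \<in> V" "col (u g i) = Seed \<or> (\<exists>q. col (u g i) = Alt q (2 * i - 1))"
    if "g < T" "i \<le> J" for g i
    using a_in[OF that(1)] x_in[OF that(1), of "2 * i - 1"] that(2) by (auto simp: u_def)
  have w_in: "w g i \<in> V" "\<exists>q j. col (w g i) = Alt q (2 * j)" if "g < T" "i \<le> J" for g i
  proof -
    define j where "j = (if i = 0 then J else i - 1)"
    have "w g i = x g (2 * j)" by (simp add: w_def j_def right_diff_distrib')
    moreover have "2 * j \<le> 2 * J" using that by (cases i) (simp_all add: j_def)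
    ultimately show "w g i \<in> V" "\<exists>q j. col (w g i) = Alt q (2 * j)"
      using x_in[OF that(1), of "2 * j"] by auto
  qed
  have u_inj: "g = g'" "i = i'" if "u g i = u g' i'" "g < T" "g' < T" "i \<le> J" "i' \<le> J" for g g' i i'
  proof -
    have le: "2 * i - 1 \<le> 2 * J" "2 * i' - 1 \<le> 2 * J" using that by linarith+
    have iff: "i = 0 \<longleftrightarrow> i' = 0"
      using that a_in(2)[of g] a_in(2)[of g'] x_in(2)[OF that(2) le(1)] x_in(2)[OF that(3) le(2)]
      by (auto simp: u_def split: if_splits)
    have "g = g' \<and> i = i'"
    proof (cases "i = 0")
      case True
      then show ?thesis using iff that a_inj[of g g'] by (simp add: u_def)
    next
      case False
      then have "x g (2 * i - 1) = x g' (2 * i' - 1)" using iff that(1) by (simp add: u_def)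
      from x_inj[OF this that(2,3) le] show ?thesis using False iff by linarith
    qed
    then show "g = g'" "i = i'" by simp_all
  qed
  have w_inj: "g = g'" "i = i'" if "w g i = w g' i'" "g < T" "g' < T" "i \<le> J" "i' \<le> J" for g g' i i'
  proof -
    define j where "j i = (if i = 0 then J else i - 1)" for i
    have "w g i = x g (2 * j i)" for g i by (simp add: w_def j_def right_diff_distrib')
    moreover have "2 * j i \<le> 2 * J" "2 * j i' \<le> 2 * J" using that by (auto simp: j_def)
    ultimately have "g = g'" "2 * j i = 2 * j i'" using x_inj[of g "2 * j i" g' "2 * j i'"] that by auto
    then show "g = g'" "i = i'" using that by (auto simp: j_def split: if_splits)
  qed
  have nx_in: "nx g i \<in> V" if "g < T" "i \<le> J" for g i
    using that b_in u_in(1)[OF sT J1] u_in(1)[of g "Suc i"] by (auto simp: nx_def)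
  have nx_inj: "g = g' \<and> i = i'" if nn: "nx g i = nx g' i'" "g < T" "g' < T" "i \<le> J" "i' \<le> J" for g g' i i'
  proof -
    \<comment> \<open>For \<open>i > 0\<close> the link ends in \<open>u (G g i) (I i)\<close> with
      second index at least 1, so injectivity of \<open>nx\<close> reduces to that of
      \<open>u\<close> and of \<open>b\<close>.\<close>
    define G where "G g i = (if i = J then Suc g mod T else g)" for g i
    define I where "I i = (if i = J then 1 else Suc i)" for i
    have GI: "nx g i = u (G g i) (I i)" "G g i < T" "I i \<le> J" "1 \<le> I i"
      if "i \<noteq> 0" "g < T" "i \<le> J" for g i
      using that sT J1 by (auto simp: nx_def G_def I_def)
    have nu: "u g i \<noteq> b g'" if "g < T" "i \<le> J" "g' < T" for g g' i
      using u_in(2)[OF that(1,2)] b_in(2)[OF that(3)] by auto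
    have z: "i = 0 \<longleftrightarrow> i' = 0"
    proof -
      have False if "i = 0" "i' \<noteq> 0"
      proof -
        note G = GI[OF that(2) nn(3,5)]
        show False using nu[OF G(2,3) nn(2)] G(1) nn(1) that(1) by (simp add: nx_def)
      qed
      moreover have False if "i' = 0" "i \<noteq> 0"
      proof -
        note G = GI[OF that(2) nn(2,4)]
        show False using nu[OF G(2,3) nn(3)] G(1) nn(1) that(1) by (simp add: nx_def)
      qed
      ultimately show ?thesis by blast
    qed
    show ?thesis
    proof (cases "i = 0")
      case True
      then show ?thesis using z that b_inj[of g g'] by (auto simp: nx_def)
    next
      case False
      then have "i' \<noteq> 0" using z by simp
      note 1 = GI[OF False that(2,4)] and 2 = GI[OF this that(3,5)]
      have "u (G g i) (I i) = u (G g' i') (I i')" using that(1) 1(1) 2(1) by simp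
      from u_inj[OF this 1(2) 2(2) 1(3) 2(3)]
      have eq: "G g i = G g' i'" "I i = I i'" by auto
      then have ii: "i = i'" using False \<open>i' \<noteq> 0\<close> by (auto simp: I_def split: if_splits)
      have "g = g'"
        using eq(1) ii that(2,3) by (auto simp: G_def mod_if split: if_splits)
      then show ?thesis using ii by simp
    qed
  qed

  \<comment> \<open>Links between the gadgets\<close>
  define D where "D = {..<T} \<times> {..J}"
  have cD: "card D = T * (J + 1)" by (simp add: D_def)
  have winj: "inj_on (\<lambda>(g, i). w g i) D" using w_inj by (auto simp: inj_on_def D_def)
  have nxinj: "inj_on (\<lambda>(g, i). nx g i) D" using nx_inj by (auto simp: inj_on_def D_def)
  have wV: "(\<lambda>(g, i). w g i) ` D \<subseteq> V" using w_in(1) by (auto simp: D_def)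
  have nxV: "(\<lambda>(g, i). nx g i) ` D \<subseteq> V" using nx_in by (auto simp: D_def)
  let ?S = "{(gi, v). ((\<lambda>(g, i). w g i) gi, v) \<in> E}"
  let ?N = "{(v, gi). (v, (\<lambda>(g, i). nx g i) gi) \<in> E}"
  have convN: "?N\<inverse> = {(gi, v). ((\<lambda>(g, i). nx g i) gi, v) \<in> E\<inverse>}" by auto
  have "\<exists>y. (\<forall>gi\<in>D. (gi, y gi 0) \<in> ?S \<and> (y gi (2 * J), gi) \<in> ?N \<and>
      (\<forall>j<2 * J. (y gi j, y gi (Suc j)) \<in> E) \<and> (\<forall>j\<le>2 * J. y gi j \<in> (\<Union>q<J. role_class V col (Link q j)))) \<and>
      inj_on (\<lambda>(i, j). y i j) (D \<times> {..2 * J})"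
  proof (rule connect_inj[where \<theta> = \<theta> and s = s and R = "\<lambda>_. E"])
    show "finite D" by (simp add: D_def)
    show "q = q' \<and> j = j'" if "role_class V col (Link q j) \<inter> role_class V col (Link q' j') \<noteq> {}" for q j q' j'
      using that by (auto simp: cls)
    show "expands E (role_class V col (Link q j)) (role_class V col (Link q (Suc j))) \<theta>"
      "expands (E\<inverse>) (role_class V col (Link q (Suc j))) (role_class V col (Link q j)) \<theta>"
      if "q < J" "j < 2 * J" for q j
      using expands_subset[OF layL(1) role_class_subset] expands_subset[OF layL(2) role_class_subset] that
      by simp_all
    show "expands ?S D (role_class V col (Link q 0)) \<theta>" if "q < J" for q
      by (rule expands_inj[OF layL(1) winj wV]) (use that in auto)
    show "expands (?N\<inverse>) D (role_class V col (Link q (2 * J))) \<theta>" if "q < J" for q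
      unfolding convN by (rule expands_inj[OF layL(2) nxinj nxV]) (use that in auto)
  qed (use J1 fincls layL(3) s cD in auto)
  then obtain y where y: "\<And>gi. gi \<in> D \<Longrightarrow> (gi, y gi 0) \<in> ?S" "\<And>gi. gi \<in> D \<Longrightarrow> (y gi (2 * J), gi) \<in> ?N"
    "\<And>gi j. gi \<in> D \<Longrightarrow> j < 2 * J \<Longrightarrow> (y gi j, y gi (Suc j)) \<in> E"
    "\<And>gi j. gi \<in> D \<Longrightarrow> j \<le> 2 * J \<Longrightarrow> y gi j \<in> (\<Union>q<J. role_class V col (Link q j))"
    "inj_on (\<lambda>(i, j). y i j) (D \<times> {..2 * J})"
    by metis
  have y_in: "y (g, i) j \<in> V" "\<exists>q. col (y (g, i) j) = Link q j" if "g < T" "i \<le> J" "j \<le> 2 * J" for g i j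
    using y(4)[of "(g, i)" j] that by (auto simp: cls D_def)
  have y_inj: "g = g' \<and> i = i' \<and> j = j'"
    if "y (g, i) j = y (g', i') j'" "g < T" "g' < T" "i \<le> J" "i' \<le> J" "j \<le> 2 * J" "j' \<le> 2 * J" for g g' i i' j j'
    using inj_onD[OF y(5), of "((g, i), j)" "((g', i'), j')"] that by (auto simp: D_def)
  \<comment> \<open>A chain consists of \<open>w g i\<close>, at index 0, and
    \<open>2 * J + 1\<close> link vertices, so its last index is \<open>2 * J + 1\<close>.\<close>
  define L where "L = 2 * J + 1"
  define t where "t g i m = (if m = 0 then w g i else y (g, i) (m - 1))" for g i m
  have t_in: "t g i m \<in> V" "(\<exists>q j. col (t g i m) = Alt q (2 * j)) \<or> (\<exists>q. col (t g i m) = Link q (m - 1))"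
    if "g < T" "i \<le> J" "m \<le> L" for g i m
    using w_in[OF that(1,2)] y_in[OF that(1,2), of "m - 1"] that(3) by (auto simp: t_def L_def)
  have t_inj: "g = g' \<and> i = i' \<and> m = m'"
    if "t g i m = t g' i' m'" "g < T" "g' < T" "i \<le> J" "i' \<le> J" "m \<le> L" "m' \<le> L" for g g' i i' m m'
  proof -
    have mm: "m - 1 \<le> 2 * J" "m' - 1 \<le> 2 * J" using that by (auto simp: L_def)
    have "m = 0 \<longleftrightarrow> m' = 0"
      using that(1) w_in(2)[OF that(2,4)] w_in(2)[OF that(3,5)] y_in(2)[OF that(2,4) mm(1)] y_in(2)[OF that(3,5) mm(2)]
      by (auto simp: t_def split: if_splits)
    then show ?thesis
      using that w_inj[of g i g' i'] y_inj[of g i "m - 1" g' i' "m' - 1"] mm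
      by (auto simp: t_def split: if_splits)
  qed
  define Us where "Us = (\<lambda>(g, i). u g i) ` ({..<T} \<times> {..J})"
  define Ts where "Ts = (\<lambda>(g, i, m). t g i m) ` ({..<T} \<times> {..J} \<times> {..L})"
  define O' where "O' = V - (Us \<union> Ts)"
  have uinj: "inj_on (\<lambda>(g, i). u g i) ({..<T} \<times> {..J})" using u_inj by (auto simp: inj_on_def)
  have tinj: "inj_on (\<lambda>(g, i, m). t g i m) ({..<T} \<times> {..J} \<times> {..L})"
    using t_inj by (auto simp: inj_on_def)
  have UsV: "Us \<subseteq> V" using u_in(1) by (auto simp: Us_def)
  have TsV: "Ts \<subseteq> V" using t_in(1) by (auto simp: Ts_def)
  \<comment> \<open>The parity of the position within \<open>Alt\<close> separates tails from heads;
    the colours \<open>Seed\<close> and \<open>Link\<close> separate the remaining kinds.\<close>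
  have Uschi: "col v = Seed \<or> (\<exists>q j. odd j \<and> col v = Alt q j)" if vU: "v \<in> Us" for v
  proof -
    obtain g i where gi: "g < T" "i \<le> J" "v = u g i" using vU by (auto simp: Us_def)
    show ?thesis
    proof (cases "i = 0")
      case True
      then show ?thesis using gi a_in(2) by (simp add: u_def)
    next
      case False
      then have "odd (2 * i - 1)" by simp
      moreover have "\<exists>q. col v = Alt q (2 * i - 1)"
        using gi False x_in(2)[OF gi(1), of "2 * i - 1"] by (simp add: u_def)
      ultimately show ?thesis by blast
    qed
  qed
  have Tschi: "(\<exists>q j. col v = Alt q (2 * j)) \<or> (\<exists>q j. col v = Link q j)" if vT: "v \<in> Ts" for v
  proof -
    obtain g i m where "g < T" "i \<le> J" "m \<le> L" "v = t g i m" using vT by (auto simp: Ts_def)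
    then show ?thesis using t_in(2)[of g i m] by metis
  qed
  have UT: "Us \<inter> Ts = {}"
  proof (rule ccontr)
    assume "Us \<inter> Ts \<noteq> {}"
    then obtain v where "v \<in> Us" "v \<in> Ts" by blast
    then show False using Uschi[of v] Tschi[of v] by auto
  qed
  have cUs: "card Us = T * (J + 1)" unfolding Us_def by (subst card_image[OF uinj]) simp
  have cTs: "card Ts = T * (J + 1) * (2 * J + 2)"
  proof -
    have "card Ts = T * (Suc J * Suc L)"
      unfolding Ts_def by (subst card_image[OF tinj]) (simp add: card_cartesian_product)
    also have "\<dots> = T * (J + 1) * (2 * J + 2)"
      by (simp only: L_def mult.assoc Suc_eq_plus1 add.assoc one_add_one)
    finally show ?thesis .
  qed
  have finUT: "finite Us" "finite Ts" by (simp_all add: Us_def Ts_def)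
  have cUT: "card (Us \<union> Ts) = T * ((J + 1) * (2 * J + 3))"
  proof -
    have "T * (J + 1) + T * (J + 1) * (2 * J + 2) = T * (J + 1) * (1 + (2 * J + 2))"
      by (simp only: distrib_left mult_1_right)
    also have "1 + (2 * J + 2) = 2 * J + 3" by simp
    finally show ?thesis using cUs cTs UT finUT by (simp only: card_Un_disjoint mult.assoc)
  qed

  \<comment> \<open>Covering paths for the remaining vertices\<close>
  have bB: "b ` {..<T} = ?B" using b by (simp add: bij_betw_def)
  have aA: "(\<lambda>g. u g 0) ` {..<T} = ?A" using a by (simp add: bij_betw_def u_def)
  have notUT: "v \<in> O'" if "v \<in> V" "col v = Start \<or> (\<exists>i. col v = Block i)" for v
    using that Uschi[of v] Tschi[of v] by (auto simp: O'_def)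
  have BO: "?B \<subseteq> O'" using notUT by (auto simp: cls)
  \<comment> \<open>Besides the blocks, \<open>Rest\<close> contains the vertices of layers and of
    \<open>Spare\<close> that no gadget uses.\<close>
  define Rest where "Rest = O' - ?B"
  have cRest: "card Rest = T * k + e"
  proof -
    have "card O' = card V - card (Us \<union> Ts)"
      unfolding O'_def using finUT UsV TsV by (subst card_Diff_subset) auto
    moreover have "card Rest = card O' - card ?B"
      unfolding Rest_def using fincls BO by (subst card_Diff_subset) auto
    ultimately show ?thesis using n cUT ends(2) by (simp add: algebra_simps)
  qed
  have "\<exists>h. h ` (?B \<union> Rest) = Rest \<union> ?A \<and> (\<forall>v\<in>?B \<union> Rest. (v, h v) \<in> E) \<and>
    (\<forall>v\<in>?B \<union> Rest. \<exists>m. (h ^^ m) v \<in> ?A \<and> (\<forall>j<m. (h ^^ j) v \<in> ?B \<union> Rest))"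
  proof (rule path_cover[where V = V and Vc = "\<lambda>i. role_class V col (Block i)" and \<theta> = \<theta>'])
    have "(\<lambda>g. u g 0) ` {..<T} \<subseteq> Us" unfolding Us_def by force
    then have "?A \<subseteq> Us" by (simp only: aA)
    then show "?A \<inter> Rest = {}" by (auto simp: Rest_def O'_def)
    show "role_class V col (Block i) \<subseteq> Rest" for i using notUT by (auto simp: Rest_def cls)
    show "disjoint_family_on (\<lambda>i. role_class V col (Block i)) {..<k}"
      by (auto simp: disjoint_family_on_def cls)
    show "expands E V ?A \<theta>'" "expands (E\<inverse>) V ?B \<theta>'" using ex'[of Seed] ex'[of Start] by auto
    show "expands E V (role_class V col (Block i)) \<theta>'" "expands (E\<inverse>) V (role_class V col (Block i)) \<theta>'"
      if "i < k" for i using ex'[of "Block i"] that by auto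
    show "?A \<subseteq> V" "?B \<subseteq> V" by (rule role_class_subset)+
    show "Rest \<subseteq> V" "?B \<inter> Rest = {}" by (auto simp: Rest_def O'_def)
  qed (use V ends cRest k blocks e in auto)
  then obtain h where h: "h ` (?B \<union> Rest) = Rest \<union> ?A" "\<And>v. v \<in> ?B \<union> Rest \<Longrightarrow> (v, h v) \<in> E"
    "\<And>v. v \<in> ?B \<union> Rest \<Longrightarrow> \<exists>m. (h ^^ m) v \<in> ?A \<and> (\<forall>j<m. (h ^^ j) v \<in> ?B \<union> Rest)"
    by metis
  have OR: "?B \<union> Rest = O'" using BO by (auto simp: Rest_def)
  show ?thesis
  proof (rule assemble[OF V J T Us_def uinj Ts_def tinj, where O' = O' and b = b and h = h and nx = nx])
    show "V = Us \<union> Ts \<union> O'" using UsV TsV by (auto simp: O'_def)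
    show "Us \<inter> Ts = {}" by (rule UT)
    show "b ` {..<T} \<subseteq> O'" using bB BO by simp
    have "h ` O' = Rest \<union> ?A" using h(1) by (simp only: OR)
    then show "h ` O' = (O' - b ` {..<T}) \<union> (\<lambda>g. u g 0) ` {..<T}"
      by (simp only: bB aA Rest_def)
    show "\<exists>m. (h ^^ m) v \<in> (\<lambda>g. u g 0) ` {..<T} \<and> (\<forall>k<m. (h ^^ k) v \<in> O')" if "v \<in> O'" for v
      using h(3)[of v] that unfolding OR aA .
    show "(v, h v) \<in> E" if "v \<in> O'" for v using h(2) that unfolding OR .
    show "(u g i, t g i 0) \<in> E" if "g < T" "i \<le> J" for g i
    proof (cases "i = 0")
      case True
      then show ?thesis using x(2)[OF that(1)] by (simp add: u_def t_def w_def)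
    next
      case False
      have "(x g (2 * i - 2), x g (Suc (2 * i - 2))) \<in> R (2 * i - 2)"
        by (rule x(3)[OF that(1)]) (use that False in linarith)
      moreover have "Suc (2 * i - 2) = 2 * i - 1" using False by linarith
      ultimately show ?thesis using False by (simp add: u_def t_def w_def R_def)
    qed
    show "(u g i, t g (Suc i) 0) \<in> E" if "g < T" "i < J" for g i
    proof (cases "i = 0")
      case True
      then show ?thesis using x(1)[OF that(1)] by (simp add: u_def t_def w_def)
    next
      case False
      have "(x g (2 * i - 1), x g (Suc (2 * i - 1))) \<in> R (2 * i - 1)"
        by (rule x(3)[OF that(1)]) (use that in linarith)
      moreover have "Suc (2 * i - 1) = 2 * i" using False by linarith
      ultimately show ?thesis using False by (simp add: u_def t_def w_def R_def)
    qed
    show "(u g J, t g 0 0) \<in> E" if "g < T" for g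
    proof -
      have "(x g (2 * J - 1), x g (Suc (2 * J - 1))) \<in> R (2 * J - 1)"
        by (rule x(3)[OF that(1)]) (use J1 in linarith)
      moreover have "Suc (2 * J - 1) = 2 * J" using J1 by linarith
      ultimately show ?thesis using J1 by (simp add: u_def t_def w_def R_def)
    qed
    show "(t g i m, t g i (Suc m)) \<in> E" if "g < T" "i \<le> J" "m < L" for g i m
      using y(1)[of "(g, i)"] y(3)[of "(g, i)" "m - 1"] that by (cases m) (auto simp: t_def D_def L_def)
    show "(t g i L, nx g i) \<in> E" if "g < T" "i \<le> J" for g i
      using y(2)[of "(g, i)"] that by (auto simp: t_def D_def L_def)
  qed (auto simp: O'_def nx_def)
qed


section \<open>From densities to expansion\<close>

text \<open>Double counting of the arcs from \<open>X\<close> to its neighbourhood \<open>Y\<close>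
  in \<open>W\<close>: at least \<open>D * card X\<close> by the degrees, at most the density bound.
  If |Y| < 8 |X|, the error term is at most 9 \<Lambda> |X|, and dividing by |X| leaves
  \<open>\<theta> \<le> card Y\<close>.\<close>

lemma expands_of_density:
  fixes V :: "'a set" and p \<delta> \<Lambda> D \<theta> :: real
  assumes V: "finite V" "W \<subseteq> V"
    and density: "\<And>X Y. X \<subseteq> V \<Longrightarrow> Y \<subseteq> V \<Longrightarrow>
      real (card (E \<inter> X \<times> Y)) \<le> (1 + \<delta>) * p * card X * card Y + \<Lambda> * (real (card X) + card Y)"
    and deg: "\<And>v. v \<in> V \<Longrightarrow> D \<le> card (E `` {v} \<inter> W)"
    and D: "(1 + \<delta>) * p * \<theta> + 9 * \<Lambda> \<le> D" and pos: "(1 + \<delta>) * p > 0" "\<Lambda> \<ge> 0"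
  shows "expands E V W \<theta>"
  unfolding expands_def
proof (intro allI impI)
  fix X assume X: "X \<subseteq> V"
  have finX: "finite X" and finW: "finite W" using X V finite_subset by auto
  define Y where "Y = E `` X \<inter> W"
  show "min (8 * real (card X)) \<theta> \<le> card (E `` X \<inter> W)"
  proof (cases "8 * real (card X) \<le> card Y")
    case True
    then show ?thesis by (simp add: Y_def)
  next
    case False
    then have Xpos: "real (card X) > 0" by (cases "card X = 0") auto
    have "E \<inter> X \<times> Y = Sigma X (\<lambda>v. E `` {v} \<inter> W)" by (auto simp: Y_def)
    then have "real (card (E \<inter> X \<times> Y)) = (\<Sum>v\<in>X. real (card (E `` {v} \<inter> W)))"
      using finX finW by (simp add: card_SigmaI)
    also have "\<dots> \<ge> (\<Sum>v\<in>X. D)" by (rule sum_mono) (use deg X in auto)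
    finally have "D * card X \<le> card (E \<inter> X \<times> Y)" by (simp add: mult.commute)
    also have "\<dots> \<le> (1 + \<delta>) * p * card X * card Y + \<Lambda> * (real (card X) + card Y)"
      by (rule density) (use X V in \<open>auto simp: Y_def\<close>)
    also have "\<Lambda> * (real (card X) + card Y) \<le> \<Lambda> * (9 * real (card X))"
      using False pos(2) by (intro mult_left_mono) auto
    finally have "D * card X \<le> ((1 + \<delta>) * p * card Y + 9 * \<Lambda>) * card X"
      by (simp add: algebra_simps)
    then have "D \<le> (1 + \<delta>) * p * card Y + 9 * \<Lambda>" using Xpos by simp
    then have "(1 + \<delta>) * p * \<theta> \<le> (1 + \<delta>) * p * card Y" using D by linarith
    then have "\<theta> \<le> card Y" by (rule mult_left_le_imp_le[OF _ pos(1)])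
    then show ?thesis by (simp add: Y_def)
  qed
qed

lemma expands_converse_of_density:
  fixes V :: "'a set" and p \<delta> \<Lambda> D \<theta> :: real
  assumes V: "finite V" "W \<subseteq> V"
    and density: "\<And>X Y. X \<subseteq> V \<Longrightarrow> Y \<subseteq> V \<Longrightarrow>
      real (card (E \<inter> X \<times> Y)) \<le> (1 + \<delta>) * p * card X * card Y + \<Lambda> * (real (card X) + card Y)"
    and deg: "\<And>v. v \<in> V \<Longrightarrow> D \<le> card (E\<inverse> `` {v} \<inter> W)"
    and D: "(1 + \<delta>) * p * \<theta> + 9 * \<Lambda> \<le> D" and pos: "(1 + \<delta>) * p > 0" "\<Lambda> \<ge> 0"
  shows "expands (E\<inverse>) V W \<theta>"
proof (rule expands_of_density[OF V _ deg D pos])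
  fix X Y assume XY: "X \<subseteq> V" "Y \<subseteq> V"
  have "E\<inverse> \<inter> X \<times> Y = (E \<inter> Y \<times> X)\<inverse>" by auto
  then have "card (E\<inverse> \<inter> X \<times> Y) = card (E \<inter> Y \<times> X)" by simp
  then show "real (card (E\<inverse> \<inter> X \<times> Y)) \<le> (1 + \<delta>) * p * card X * card Y + \<Lambda> * (real (card X) + card Y)"
    using density[OF XY(2,1)] by (simp add: mult.commute mult.left_commute add.commute)
qed

text \<open>The number of colour classes that form one layer. Twice the expansion into a class
  exceeds its size by about 1 / d of the average class size \<nu>, whereas up to
  \<open>T * (J + 1)\<close> requests with \<open>T \<le> 2 * \<nu>\<close> may occupy a layer.
  Outweighing them takes a multiple of \<open>d * (J + 1)\<close> classes.\<close>

definition layer_parts :: "nat \<Rightarrow> nat \<Rightarrow> nat" where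
  "layer_parts d J = 6 * d * (J + 1)"

text \<open>The classes other than blocks: four for seeds, starts and spares, and \<open>J\<close>
  rounds of \<open>2 * J + 1\<close> layers for each of the two kinds of routes.\<close>

definition special_parts :: "nat \<Rightarrow> nat \<Rightarrow> nat" where
  "special_parts d J = 4 + 2 * (J * (2 * J + 1) * layer_parts d J)"

text \<open>The second component splits a layer into classes of the common expected size, so that
  one uniform colouring serves all roles. Blocks outnumber the other classes by the factor
  \<open>d\<close>, which keeps \<open>T\<close> below \<open>1 + 1 / d\<close> times the average
  class size.\<close>

definition parts :: "nat \<Rightarrow> nat \<Rightarrow> (role \<times> nat) set" where
  "parts d J = {(Seed, 0), (Start, 0), (Spare 0, 0), (Spare 1, 0)} \<union>
     (\<lambda>(q, j, c). (Alt q j, c)) ` ({..<J} \<times> {..2 * J} \<times> {..<layer_parts d J}) \<union>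
     (\<lambda>(q, j, c). (Link q j, c)) ` ({..<J} \<times> {..2 * J} \<times> {..<layer_parts d J}) \<union>
     (\<lambda>i. (Block i, 0)) ` {..<d * special_parts d J}"

lemma finite_parts: "finite (parts d J)"
  by (simp add: parts_def)

lemma card_parts: "card (parts d J) = (d + 1) * special_parts d J"
proof -
  let ?L = "{..<J} \<times> {..2 * J} \<times> {..<layer_parts d J}"
  let ?P = "{(Seed, 0), (Start, 0), (Spare 0, 0), (Spare 1, 0)} :: (role \<times> nat) set"
  let ?A = "(\<lambda>(q, j, c). (Alt q j, c)) ` ?L" and ?K = "(\<lambda>(q, j, c). (Link q j, c)) ` ?L"
  let ?B = "(\<lambda>i. (Block i, 0::nat)) ` {..<d * special_parts d J}"
  have cL: "card ?L = J * (2 * J + 1) * layer_parts d J"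
    by (simp only: card_cartesian_product card_lessThan card_atMost Suc_eq_plus1 mult.assoc)
  have A: "card ?A = card ?L" by (rule card_image) (auto simp: inj_on_def)
  have K: "card ?K = card ?L" by (rule card_image) (auto simp: inj_on_def)
  have B: "card ?B = d * special_parts d J" by (subst card_image) (auto simp: inj_on_def)
  have P: "card ?P = 4" by simp
  have "card (?P \<union> ?A \<union> ?K \<union> ?B) = card ?P + card ?A + card ?K + card ?B"
    by (subst card_Un_disjoint; (auto; fail)?)+
  then show ?thesis unfolding parts_def P A K B cL by (simp add: special_parts_def)
qed

text \<open>\<open>T\<close> has to be at least the largest class, so that cores fit into blocks and
  seeds can be filled up, and matchings of size \<open>T + e\<close> must stay within twice the
  expansion. With 1 / d = 8 \<delta> and \<nu> the average class size, \<open>T\<close> is placed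
  between \<open>(1 + 2 * \<delta>) * \<nu>\<close> and
  \<open>(1 + 1 / real d) * \<nu>\<close>.\<close>

lemma hamilton_of_colouring:
  fixes V :: "'a set" and E :: "('a \<times> 'a) set" and d J :: nat and p \<Lambda> \<kappa> \<delta> \<nu> :: real and \<phi> :: "'a \<Rightarrow> role \<times> nat"
  defines "\<delta> \<equiv> 1 / (8 * real d)" and "\<nu> \<equiv> card V / card (parts d J)"
  assumes V: "finite V" and J: "odd J" and d: "d \<ge> 2"
    and density: "\<And>X Y. X \<subseteq> V \<Longrightarrow> Y \<subseteq> V \<Longrightarrow>
      real (card (E \<inter> X \<times> Y)) \<le> (1 + \<delta>) * p * card X * card Y + \<Lambda> * (real (card X) + card Y)"
    and p: "p > 0" and \<Lambda>: "\<Lambda> \<ge> 0" "9 * \<Lambda> \<le> \<delta> * (p * \<nu>)"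
    and \<kappa>: "1 / 2 + 2 / real d \<le> \<kappa>" "\<kappa> \<le> 1"
    and n: "card V < 2 ^ J" "real (card (parts d J)) \<le> \<delta> * \<nu>"
    and \<phi>: "\<And>v. v \<in> V \<Longrightarrow> \<phi> v \<in> parts d J"
    and deg: "\<And>v c. v \<in> V \<Longrightarrow> c \<in> parts d J \<Longrightarrow>
        (1 - 2 * \<delta>) * (\<kappa> * p * \<nu>) \<le> card (E `` {v} \<inter> {w \<in> V. \<phi> w = c}) \<and>
        (1 - 2 * \<delta>) * (\<kappa> * p * \<nu>) \<le> card (E\<inverse> `` {v} \<inter> {w \<in> V. \<phi> w = c})"
    and size: "\<And>c. c \<in> parts d J \<Longrightarrow> (1 - 2 * \<delta>) * \<nu> \<le> card {w \<in> V. \<phi> w = c} \<and>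
        card {w \<in> V. \<phi> w = c} \<le> (1 + 2 * \<delta>) * \<nu>"
  shows "\<exists>f. bij_betw f V V \<and> (\<forall>x\<in>V. (x, f x) \<in> E) \<and> V \<times> V \<subseteq> cyc V f"
proof -
  define b where "b = layer_parts d J"
  define m where "m = special_parts d J"
  define k where "k = d * m"
  define c where "c = (J + 1) * (2 * J + 3) + 1"
  define M where "M = card (parts d J)"
  define T where "T = card V div (k + c)"
  define e where "e = card V mod (k + c)"
  \<comment> \<open>\<open>2 * \<theta>'\<close> covers \<open>T + e\<close>, as
    \<open>e \<le> \<delta> * \<nu>\<close>, and exceeds the bound
    \<open>(1 + 2 * \<delta>) * \<nu>\<close> on the class sizes by \<nu> / d.\<close>
  define \<theta>' where "\<theta>' = \<nu> * (1 / 2 + 1 / (2 * real d) + \<delta>)"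
  define s where "s = real (T * (J + 1))"
  define cl where "cl c = {w \<in> V. \<phi> w = c}" for c
  have J1: "J \<ge> 1" using J by presburger
  have M: "M = (d + 1) * m" by (simp add: M_def card_parts m_def)
  have bJ: "b = 6 * d * (J + 1)" by (simp add: b_def layer_parts_def)
  have b1: "b \<ge> 1" using d by (simp add: bJ)
  have m_eq: "m = 4 + 2 * (J * (2 * J + 1) * b)" by (simp add: m_def special_parts_def b_def)
  \<comment> \<open>The special classes number \<open>m\<close>, but gadgets and starts use up only
    \<open>c * T\<close> vertices. The surplus flows into the blocks and raises \<open>T\<close>
    above \<nu>.\<close>
  have c4: "4 * c \<le> m"
  proof -
    have "2 \<le> J * (2 * J)" using mult_le_mono[OF J1 J1] by simp
    then have "J + 2 \<le> J * (2 * J + 1)" by (simp add: distrib_left)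
    have "4 * c \<le> 8 * ((J + 1) * (J + 2)) + 4" by (simp add: c_def algebra_simps)
    also have "\<dots> \<le> 24 * ((J + 1) * (J * (2 * J + 1))) + 4"
      using mult_le_mono2[OF \<open>J + 2 \<le> J * (2 * J + 1)\<close>, of "J + 1"] by linarith
    also have "24 * ((J + 1) * (J * (2 * J + 1))) \<le> 2 * (J * (2 * J + 1) * b)"
    proof -
      have "12 * (J + 1) \<le> b" unfolding bJ using d by (intro mult_le_mono1) simp
      from mult_le_mono2[OF this, of "2 * (J * (2 * J + 1))"] show ?thesis
        by (simp only: mult.assoc mult.commute mult.left_commute)
    qed
    finally show ?thesis by (simp add: m_eq)
  qed
  have m_pos: "m > 0" by (simp add: m_eq)
  have kc: "k + c \<ge> 1" by (simp add: c_def)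
  have \<delta>: "\<delta> > 0" "8 * real d * \<delta> = 1" "\<delta> \<le> 1 / 16" using d by (auto simp: \<delta>_def field_simps)
  have M1: "real M \<ge> 1" using M m_eq by simp
  have \<nu>1: "\<nu> \<ge> 8 * real d"
  proof -
    have "1 \<le> \<delta> * \<nu>" using n(2) M1 by (simp add: M_def)
    then have "8 * real d * 1 \<le> 8 * real d * (\<delta> * \<nu>)" by (intro mult_left_mono) auto
    also have "\<dots> = \<nu>" using \<delta>(2) by (simp add: mult.assoc[symmetric])
    finally show ?thesis by simp
  qed
  have \<nu>0: "\<nu> > 0" using \<nu>1 d by linarith
  have nM: "real (card V) = \<nu> * M" using M1 by (simp add: \<nu>_def M_def)
  have dr: "real d \<ge> 2" using d by simp
  have "T * (k + c) + e = card V" unfolding T_def e_def by (rule div_mult_mod_eq)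
  then have n_eq: "card V = T * (k + c) + e" by simp
  have e_less: "e < k + c" unfolding e_def using kc by (intro mod_less_divisor) linarith
  have kM: "k + c \<le> M" using c4 by (simp add: M k_def)
  have T_upper: "real T \<le> (1 + 1 / real d) * \<nu>"
  proof -
    have "real T * (real d * real m) \<le> real T * real (k + c)"
      by (intro mult_left_mono) (simp_all add: k_def)
    also have "\<dots> \<le> real (card V)" unfolding n_eq by simp
    also have "\<dots> = \<nu> * ((real d + 1) * real m)" by (simp add: nM M algebra_simps)
    finally have "real T * real d * real m \<le> \<nu> * (real d + 1) * real m" by (simp add: mult.assoc)
    moreover have "real m > 0" using m_pos by simp
    ultimately have "real T * real d \<le> \<nu> * (real d + 1)" by simp
    then show ?thesis using dr by (simp add: field_simps)
  qed
  \<comment> \<open>As \<open>k + c\<close> is at most \<open>(d + 1 / 4) * m\<close> while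
    \<open>M = (d + 1) * m\<close>, the quotient gains a factor of at least
    \<open>1 + 4 * \<delta>\<close> over \<nu>; rounding costs at most
    \<open>1 \<le> 2 * \<delta> * \<nu>\<close>.\<close>
  have T_lower: "(1 + 2 * \<delta>) * \<nu> \<le> real T"
  proof -
    have "real (card V) = real T * real (k + c) + real e" unfolding n_eq by simp
    also have "\<dots> \<le> real T * real (k + c) + real (k + c)" using e_less by simp
    also have "\<dots> = (real T + 1) * real (k + c)" by (simp add: algebra_simps)
    also have "\<dots> \<le> (real T + 1) * ((real d + 1 / 4) * real m)"
      using c4 by (intro mult_left_mono) (simp_all add: k_def algebra_simps)
    finally have "\<nu> * (real d + 1) * real m \<le> (real T + 1) * (real d + 1 / 4) * real m"
      by (simp add: nM M algebra_simps)
    moreover have "real m > 0" using m_pos by simp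
    ultimately have 1: "\<nu> * (real d + 1) \<le> (real T + 1) * (real d + 1 / 4)" by simp
    have "(1 + 4 * \<delta>) * (real d + 1 / 4) = real d + 1 / 4 + (8 * real d * \<delta>) / 2 + \<delta>"
      by (simp add: algebra_simps)
    also have "\<dots> \<le> real d + 1" using \<delta> by simp
    finally have "\<nu> * ((1 + 4 * \<delta>) * (real d + 1 / 4)) \<le> \<nu> * (real d + 1)"
      using \<nu>0 by (intro mult_left_mono) auto
    then have "\<nu> * (1 + 4 * \<delta>) * (real d + 1 / 4) \<le> (real T + 1) * (real d + 1 / 4)"
      using order_trans[OF _ 1] by (simp only: mult.assoc)
    moreover have "real d + 1 / 4 > 0" using dr by simp
    ultimately have "\<nu> * (1 + 4 * \<delta>) \<le> real T + 1" by (rule mult_right_le_imp_le)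
    moreover have "1 \<le> 2 * \<delta> * \<nu>"
    proof -
      have "1 \<le> \<delta> * \<nu>" using n(2) M1 by (simp add: M_def)
      then show ?thesis by simp
    qed
    ultimately show ?thesis by (simp add: algebra_simps)
  qed
  have T1: "T \<ge> 1"
  proof -
    have "0 < (1 + 2 * \<delta>) * \<nu>" using \<delta> \<nu>0 by simp
    then have "0 < real T" using T_lower by linarith
    then show ?thesis by simp
  qed
  have bP: "b * \<theta>' \<le> card V"
  proof -
    have "1 / (2 * real d) \<le> 1 / 4" using dr by (simp add: field_simps)
    then have "1 / 2 + 1 / (2 * real d) + \<delta> \<le> 1" using \<delta>(3) by linarith
    then have "\<theta>' \<le> \<nu> * 1" unfolding \<theta>'_def using \<nu>0 by (intro mult_left_mono) auto
    then have "b * \<theta>' \<le> real b * \<nu>" by (intro mult_left_mono) auto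
    also have "\<dots> \<le> real M * \<nu>"
    proof -
      have "b \<le> J * (2 * J + 1) * b" using J1 by simp
      then have "b \<le> m" unfolding m_eq by linarith
      then have "b \<le> M" unfolding M by simp
      then show ?thesis using \<nu>0 by simp
    qed
    finally show ?thesis using nM by (simp add: mult.commute)
  qed
  \<comment> \<open>In units of p \<nu>: \<theta>' is (1/2 + 5 \<delta>) \<nu>, so the left side is
    at most 1/2 + 7 \<delta>, while \<kappa> >= 1/2 + 16 \<delta> leaves at least 1/2 + 14 \<delta>
    on the right.\<close>
  have key: "(1 + \<delta>) * p * \<theta>' + 9 * \<Lambda> \<le> (1 - 2 * \<delta>) * (\<kappa> * p * \<nu>)"
  proof -
    define x where "x = 1 / 2 + 1 / (2 * real d) + \<delta>"
    have d8: "1 / real d = 8 * \<delta>" using dr by (simp add: \<delta>_def)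
    have x: "x = 1 / 2 + 5 * \<delta>" using d8 by (simp add: x_def field_simps)
    have "\<delta> * \<delta> \<le> \<delta> * (1 / 16)" using \<delta> by (intro mult_left_mono) auto
    moreover have "(1 + \<delta>) * x + \<delta> = 1 / 2 + 13 / 2 * \<delta> + 5 * (\<delta> * \<delta>)"
      unfolding x by (simp add: field_simps)
    ultimately have "(1 + \<delta>) * x + \<delta> \<le> 1 / 2 + 7 * \<delta>" using \<delta>(1) by linarith
    also have "\<dots> \<le> \<kappa> - 2 * \<delta>" using \<kappa>(1) d8 \<delta> by (simp add: field_simps)
    also have "\<dots> \<le> (1 - 2 * \<delta>) * \<kappa>" using \<delta> \<kappa>(2) by (simp add: algebra_simps)
    finally have "((1 + \<delta>) * x + \<delta>) * (p * \<nu>) \<le> ((1 - 2 * \<delta>) * \<kappa>) * (p * \<nu>)"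
      using p \<nu>0 by (intro mult_right_mono) auto
    moreover have "\<theta>' = \<nu> * x" by (simp add: \<theta>'_def x_def)
    ultimately show ?thesis using \<Lambda>(2) by (simp add: algebra_simps)
  qed
  \<comment> \<open>The error \<open>9 * \<Lambda>\<close> is not multiplied by \<open>b\<close>, so
    a union of \<open>b\<close> classes is no worse than a single class.\<close>
  have key_b: "(1 + \<delta>) * p * (b * \<theta>') + 9 * \<Lambda> \<le> b * ((1 - 2 * \<delta>) * (\<kappa> * p * \<nu>))"
  proof -
    have "(1 + \<delta>) * p * (b * \<theta>') + 9 * \<Lambda> * 1 \<le> (1 + \<delta>) * p * (b * \<theta>') + 9 * \<Lambda> * b"
      using b1 \<Lambda>(1) by (intro add_left_mono mult_left_mono) auto
    also have "\<dots> = b * ((1 + \<delta>) * p * \<theta>' + 9 * \<Lambda>)" by (simp add: algebra_simps)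
    also have "\<dots> \<le> b * ((1 - 2 * \<delta>) * (\<kappa> * p * \<nu>))" using key by (intro mult_left_mono) auto
    finally show ?thesis by simp
  qed

  \<comment> \<open>Expansion into classes and layers\<close>
  have pos: "(1 + \<delta>) * p > 0" using \<delta> p by simp
  have clV: "cl c \<subseteq> V" "finite (cl c)" for c using V by (auto simp: cl_def)
  have expand1: "expands E V W \<theta>' \<and> expands (E\<inverse>) V W \<theta>'" if "cl c \<subseteq> W" "W \<subseteq> V" "c \<in> parts d J" for W c
  proof -
    have "expands E V (cl c) \<theta>'"
      by (rule expands_of_density[OF V clV(1) density _ key pos \<Lambda>(1)]) (use deg that in \<open>auto simp: cl_def\<close>)
    moreover have "expands (E\<inverse>) V (cl c) \<theta>'"
      by (rule expands_converse_of_density[OF V clV(1) density _ key pos \<Lambda>(1)])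
        (use deg that in \<open>auto simp: cl_def\<close>)
    moreover have "finite W" using that(2) V finite_subset by blast
    ultimately show ?thesis using expands_mono[OF _ subset_refl that(1)] by blast
  qed
  have expand_b: "expands E V W (b * \<theta>') \<and> expands (E\<inverse>) V W (b * \<theta>') \<and>
      real (card W) \<le> b * ((1 + 2 * \<delta>) * \<nu>)"
    if W: "W = (\<Union>i<b. cl (r, i))" "\<And>i. i < b \<Longrightarrow> (r, i) \<in> parts d J" for W r
  proof -
    have WV: "W \<subseteq> V" unfolding W(1) using clV by auto
    have sum: "card (X \<inter> W) = (\<Sum>i<b. card (X \<inter> cl (r, i)))" for X
    proof -
      have "X \<inter> W = (\<Union>i<b. X \<inter> cl (r, i))" unfolding W(1) by auto
      also have "card \<dots> = (\<Sum>i<b. card (X \<inter> cl (r, i)))"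
      proof (rule card_UN_disjoint)
        show "\<forall>i\<in>{..<b}. \<forall>j\<in>{..<b}. i \<noteq> j \<longrightarrow> X \<inter> cl (r, i) \<inter> (X \<inter> cl (r, j)) = {}"
          by (auto simp: cl_def)
      qed (use clV(2) in auto)
      finally show ?thesis .
    qed
    have degb: "b * ((1 - 2 * \<delta>) * (\<kappa> * p * \<nu>)) \<le> card (E `` {v} \<inter> W)"
      "b * ((1 - 2 * \<delta>) * (\<kappa> * p * \<nu>)) \<le> card (E\<inverse> `` {v} \<inter> W)" if "v \<in> V" for v
    proof -
      have "(\<Sum>i<b. (1 - 2 * \<delta>) * (\<kappa> * p * \<nu>)) \<le> (\<Sum>i<b. real (card (E `` {v} \<inter> cl (r, i))))"
        by (rule sum_mono) (use deg[OF that] W(2) in \<open>auto simp: cl_def\<close>)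
      then show "b * ((1 - 2 * \<delta>) * (\<kappa> * p * \<nu>)) \<le> card (E `` {v} \<inter> W)" by (simp add: sum)
      have "(\<Sum>i<b. (1 - 2 * \<delta>) * (\<kappa> * p * \<nu>)) \<le> (\<Sum>i<b. real (card (E\<inverse> `` {v} \<inter> cl (r, i))))"
        by (rule sum_mono) (use deg[OF that] W(2) in \<open>auto simp: cl_def\<close>)
      then show "b * ((1 - 2 * \<delta>) * (\<kappa> * p * \<nu>)) \<le> card (E\<inverse> `` {v} \<inter> W)" by (simp add: sum)
    qed
    have "real (card W) = (\<Sum>i<b. real (card (cl (r, i))))" using sum[of UNIV] by simp
    also have "\<dots> \<le> (\<Sum>i<b. (1 + 2 * \<delta>) * \<nu>)"
      by (rule sum_mono) (use size W(2) in \<open>auto simp: cl_def\<close>)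
    finally have "real (card W) \<le> b * ((1 + 2 * \<delta>) * \<nu>)" by simp
    moreover have "expands E V W (b * \<theta>')"
      by (rule expands_of_density[OF V WV density degb(1) key_b pos \<Lambda>(1)])
    moreover have "expands (E\<inverse>) V W (b * \<theta>')"
      by (rule expands_converse_of_density[OF V WV density degb(2) key_b pos \<Lambda>(1)])
    ultimately show ?thesis by blast
  qed
  have s_le: "s * (6 * real d) \<le> 2 * b * \<nu>"
  proof -
    have "real T \<le> 2 * \<nu>"
    proof -
      have "(1 + 1 / real d) * \<nu> \<le> 2 * \<nu>"
        using \<nu>0 dr by (intro mult_right_mono) (auto simp: field_simps)
      then show ?thesis using T_upper by linarith
    qed
    then have "real T * (real (J + 1) * (6 * real d)) \<le> 2 * \<nu> * (real (J + 1) * (6 * real d))"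
      by (intro mult_right_mono) auto
    then show ?thesis by (simp add: s_def bJ algebra_simps)
  qed
  have s_small: "s \<le> b * \<nu> / (3 * real d)" using s_le dr by (simp add: field_simps)
  \<comment> \<open>Twice the expansion exceeds the layer by \<open>Y = b * \<nu> / real d\<close>,
    and the doubled load \<open>2 * s\<close> is at most two thirds of this.\<close>
  have layer_bound: "b * ((1 + 2 * \<delta>) * \<nu>) < 2 * (b * \<theta>' - s)"
  proof -
    have b\<nu>: "b * \<nu> > 0" using b1 \<nu>0 by simp
    define X Y where "X = b * ((1 + 2 * \<delta>) * \<nu>)" and "Y = b * \<nu> / real d"
    have "2 * (b * \<theta>') = X + Y" by (simp add: \<theta>'_def X_def Y_def algebra_simps)
    moreover have "2 * s < Y"
    proof -
      have "2 * s \<le> (2 / 3) * Y" using s_small by (simp add: Y_def)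
      also have "\<dots> < 1 * Y" using b\<nu> dr by (intro mult_strict_right_mono) (auto simp: Y_def)
      finally show ?thesis by simp
    qed
    ultimately have "X < 2 * (b * \<theta>') - 2 * s" by linarith
    then show ?thesis by (simp add: X_def)
  qed
  have s2: "2 * s \<le> b * \<theta>'"
  proof -
    have b\<nu>: "b * \<nu> \<ge> 0" using \<nu>0 by simp
    have "2 * s \<le> b * \<nu> * (2 / (3 * real d))" using s_small by simp
    also have "\<dots> \<le> b * \<nu> * (1 / 2)" using dr b\<nu> by (intro mult_left_mono) (auto simp: field_simps)
    also have "\<dots> \<le> b * \<nu> * (1 / 2 + 1 / (2 * real d) + \<delta>)"
      using \<delta> b\<nu> by (intro mult_left_mono) auto
    finally show ?thesis by (simp add: \<theta>'_def mult.assoc)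
  qed
  have Te: "real (T + e) \<le> 2 * \<theta>'"
  proof -
    have "real e \<le> real M" using e_less kM by linarith
    also have "\<dots> \<le> \<delta> * \<nu>" using n(2) by (simp add: M_def)
    finally have "real (T + e) \<le> (1 + 1 / real d) * \<nu> + \<delta> * \<nu>" using T_upper by simp
    also have "\<dots> \<le> 2 * \<theta>'" using \<delta> \<nu>0 by (simp add: \<theta>'_def algebra_simps)
    finally show ?thesis .
  qed
  have in_parts: "(Seed, 0) \<in> parts d J" "(Start, 0) \<in> parts d J" "(Spare 0, 0) \<in> parts d J"
    "(Spare 1, 0) \<in> parts d J" "\<And>i. i < k \<Longrightarrow> (Block i, 0) \<in> parts d J"
    by (simp_all add: parts_def k_def m_def)
  have in_parts_layer: "(Alt q j, i) \<in> parts d J" "(Link q j, i) \<in> parts d J"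
    if "q < J" "j \<le> 2 * J" "i < b" for q j i
  proof -
    have "(q, j, i) \<in> {..<J} \<times> {..2 * J} \<times> {..<layer_parts d J}" using that by (simp add: b_def)
    from imageI[OF this, of "\<lambda>(q, j, c). (Alt q j, c)"] imageI[OF this, of "\<lambda>(q, j, c). (Link q j, c)"]
    show "(Alt q j, i) \<in> parts d J" "(Link q j, i) \<in> parts d J" by (simp_all add: parts_def)
  qed
  have cl_upper: "card (cl c) \<le> T" if "c \<in> parts d J" for c
    using size[OF that] T_lower by (simp add: cl_def)
  \<comment> \<open>Two classes have at least \<open>2 * (1 - 2 * \<delta>) * \<nu>\<close> vertices
    together and \<open>T\<close> is at most \<open>(1 + 8 * \<delta>) * \<nu>\<close>, so one spare
    class can fill up another class to \<open>T\<close>.\<close>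
  have spare: "T - card (cl c) \<le> card (cl c')" if "c \<in> parts d J" "c' \<in> parts d J" for c c'
  proof -
    have "1 / real d = 8 * \<delta>" using dr by (simp add: \<delta>_def)
    then have "real T \<le> (1 + 8 * \<delta>) * \<nu>" using T_upper by simp
    also have "\<dots> \<le> 2 * ((1 - 2 * \<delta>) * \<nu>)"
      using mult_right_mono[of "12 * \<delta>" 1 \<nu>] \<delta> \<nu>0 by (simp add: algebra_simps)
    finally have "real T \<le> real (card (cl c)) + real (card (cl c'))"
      using size[OF that(1)] size[OF that(2)] by (simp add: cl_def)
    then show ?thesis by linarith
  qed

  \<comment> \<open>Recolouring spare vertices to give \<open>Seed\<close> and \<open>Start\<close>
    exactly \<open>T\<close> vertices\<close>
  obtain FA where FA: "FA \<subseteq> cl (Spare 0, 0)" "card FA = T - card (cl (Seed, 0))"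
    using spare[OF in_parts(1,3)] by (metis obtain_subset_with_card_n)
  obtain FB where FB: "FB \<subseteq> cl (Spare 1, 0)" "card FB = T - card (cl (Start, 0))"
    using spare[OF in_parts(2,4)] by (metis obtain_subset_with_card_n)
  have finF: "finite FA" "finite FB" using FA(1) FB(1) clV finite_subset by blast+
  have FA': "v \<in> V" "\<phi> v = (Spare 0, 0)" if "v \<in> FA" for v using that FA(1) by (auto simp: cl_def)
  have FB': "v \<in> V" "\<phi> v = (Spare 1, 0)" if "v \<in> FB" for v using that FB(1) by (auto simp: cl_def)
  define col where "col v = (if v \<in> FA then Seed else if v \<in> FB then Start else fst (\<phi> v))" for v
  have zero: "i = 0" if "(r, i) \<in> parts d J" "r \<in> {Seed, Start} \<union> range Block" for r i
    using that by (auto simp: parts_def)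
  have phi0: "\<phi> v = (r, 0)" if "v \<in> V" "fst (\<phi> v) = r" "r \<in> {Seed, Start} \<union> range Block" for v r
    using zero[of r "snd (\<phi> v)"] \<phi>[OF that(1)] that by (cases "\<phi> v") auto
  have phi0_iff: "fst (\<phi> v) = r \<longleftrightarrow> \<phi> v = (r, 0)" if "v \<in> V" "r \<in> {Seed, Start} \<union> range Block" for v r
    using phi0[OF that(1) _ that(2)] by auto
  have clsSeed: "role_class V col Seed = cl (Seed, 0) \<union> FA"
  proof (rule set_eqI)
    fix v show "v \<in> role_class V col Seed \<longleftrightarrow> v \<in> cl (Seed, 0) \<union> FA"
      using FA'[of v] FB'[of v] phi0_iff[of v Seed]
      by (cases "v \<in> FA"; cases "v \<in> FB") (auto simp: role_class_def col_def cl_def)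
  qed
  have clsStart: "role_class V col Start = cl (Start, 0) \<union> FB"
  proof (rule set_eqI)
    fix v show "v \<in> role_class V col Start \<longleftrightarrow> v \<in> cl (Start, 0) \<union> FB"
      using FA'[of v] FB'[of v] phi0_iff[of v Start]
      by (cases "v \<in> FA"; cases "v \<in> FB") (auto simp: role_class_def col_def cl_def)
  qed
  have clsBlock: "role_class V col (Block i) = cl (Block i, 0)" for i
  proof (rule set_eqI)
    fix v show "v \<in> role_class V col (Block i) \<longleftrightarrow> v \<in> cl (Block i, 0)"
      using FA'[of v] FB'[of v] phi0_iff[of v "Block i"]
      by (cases "v \<in> FA"; cases "v \<in> FB") (auto simp: role_class_def col_def cl_def)
  qed
  have bound: "i < b" if "(r, i) \<in> parts d J" "r = Alt q j \<or> r = Link q j" for r i q j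
    using that by (auto simp: parts_def b_def)
  have clsLayer: "role_class V col r = (\<Union>i<b. cl (r, i))" if "r = Alt q j \<or> r = Link q j" for r q j
  proof -
    have "v \<in> role_class V col r \<longleftrightarrow> v \<in> V \<and> fst (\<phi> v) = r" for v
      using FA'[of v] FB'[of v] that by (auto simp: role_class_def col_def)
    moreover have "v \<in> (\<Union>i<b. cl (r, i)) \<longleftrightarrow> v \<in> V \<and> fst (\<phi> v) = r" for v
      using bound[of r "snd (\<phi> v)" q j] \<phi>[of v] that by (cases "\<phi> v") (auto simp: cl_def)
    ultimately show ?thesis by blast
  qed
  show ?thesis
  proof (rule hamilton_core[where T = T and k = k and \<theta> = "b * \<theta>'" and \<theta>' = \<theta>' and s = s and e = e and col = col])
    show "k \<ge> 1" using d by (simp add: k_def m_eq)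
    have "cl (Seed, 0) \<inter> FA = {}" "cl (Start, 0) \<inter> FB = {}" using FA' FB' by (auto simp: cl_def)
    then show "card (role_class V col Seed) = T" "card (role_class V col Start) = T"
      unfolding clsSeed clsStart
      using FA(2) FB(2) finF clV(2) cl_upper[OF in_parts(1)] cl_upper[OF in_parts(2)]
      by (simp_all add: card_Un_disjoint)
    show "card (role_class V col (Block i)) \<le> T" if "i < k" for i
      unfolding clsBlock by (rule cl_upper[OF in_parts(5)[OF that]])
    show "expands E V (role_class V col r) (b * \<theta>') \<and> expands (E\<inverse>) V (role_class V col r) (b * \<theta>') \<and>
        real (card (role_class V col r)) < 2 * (b * \<theta>' - s)"
      if "q < J" "j \<le> 2 * J" "r \<in> {Alt q j, Link q j}" for q j r
    proof -
      have r: "r = Alt q j \<or> r = Link q j" using that by auto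
      have "(r, i) \<in> parts d J" if "i < b" for i
        using in_parts_layer[OF \<open>q < J\<close> \<open>j \<le> 2 * J\<close> that] r by auto
      from expand_b[OF clsLayer[OF r] this] layer_bound show ?thesis by auto
    qed
    show "expands E V (role_class V col r) \<theta>' \<and> expands (E\<inverse>) V (role_class V col r) \<theta>'"
      if "r \<in> {Seed, Start} \<union> Block ` {..<k}" for r
    proof -
      have "cl (r, 0) \<subseteq> role_class V col r" "(r, 0) \<in> parts d J"
        using that clsSeed clsStart clsBlock in_parts by auto
      then show ?thesis by (intro expand1[OF _ role_class_subset])
    qed
    show "T * (J + 1) < 2 ^ J"
    proof -
      have "T * (J + 1) \<le> T * (k + c)" by (intro mult_le_mono2) (simp add: c_def)
      also have "\<dots> \<le> card V" unfolding n_eq by simp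
      finally show ?thesis using n(1) by linarith
    qed
    show "b * \<theta>' \<le> 4 * 2 ^ J"
    proof -
      have "real (card V) \<le> 2 ^ J" using n(1) by (metis less_imp_le of_nat_less_iff of_nat_numeral of_nat_power)
      then show ?thesis using bP by linarith
    qed
    show "card V = T * (k + (J + 1) * (2 * J + 3) + 1) + e" using n_eq by (simp add: c_def add.assoc)
  qed (use V J T1 s2 Te in \<open>auto simp: s_def\<close>)
qed


section \<open>Chernoff bounds and random colourings\<close>

lemma exp_le_quadratic:
  fixes s :: real
  assumes "\<bar>s\<bar> \<le> 1"
  shows "exp s \<le> 1 + s + s\<^sup>2"
proof (cases "s \<ge> 0")
  case True
  then show ?thesis using exp_bound[of s] assms by simp
next
  case False
  define t where "t = - s"
  have t: "0 < t" "t \<le> 1" using False assms by (auto simp: t_def)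
  have "exp s = inverse (exp t)" by (simp add: t_def exp_minus)
  also have "\<dots> \<le> inverse (1 + t)" using t by (intro le_imp_inverse_le) auto
  also have "\<dots> \<le> 1 - t + t\<^sup>2"
  proof -
    have "(1 - t + t\<^sup>2) * (1 + t) = 1 + t ^ 3" by (simp add: algebra_simps power2_eq_square power3_eq_cube)
    also have "\<dots> \<ge> 1" using t by simp
    finally show ?thesis using t by (simp add: field_simps)
  qed
  finally show ?thesis by (simp add: t_def)
qed

text \<open>Markov's inequality for the exponential of \<open>s\<close> times the count. Keeping the
  sign of \<open>s\<close> in the event covers both tails at once. Elements outside \<open>S\<close>
  contribute the factor 1, so the expectation factorises over all of \<open>A\<close>.\<close>

lemma chernoff_mgf:
  fixes s \<tau> q :: real and P :: "'b pmf" and B :: "'b set"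
  assumes A: "finite A" "S \<subseteq> A" and s: "\<bar>s\<bar> \<le> 1"
  defines "q \<equiv> measure_pmf.prob P B"
  shows "measure_pmf.prob (Pi_pmf A d (\<lambda>_. P)) {f. s * \<tau> \<le> s * card {a \<in> S. f a \<in> B}} \<le>
    exp (- s * \<tau> + q * card S * (s + s\<^sup>2))"
proof -
  let ?Q = "Pi_pmf A d (\<lambda>_. P)"
  define g where "g a y = (if a \<in> S \<and> y \<in> B then exp s else 1)" for a :: 'a and y :: 'b
  define u where "u f = (\<Prod>a\<in>A. g a (f a))" for f
  have u: "u f = exp (s * card {a \<in> S. f a \<in> B})" for f
  proof -
    have "u f = (\<Prod>a\<in>{a \<in> S. f a \<in> B}. exp s)"
      unfolding u_def g_def using A by (intro prod.mono_neutral_cong_right) auto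
    also have "\<dots> = exp (s * card {a \<in> S. f a \<in> B})" by (simp add: exp_of_nat_mult[symmetric] mult.commute)
    finally show ?thesis .
  qed
  have int: "integrable (measure_pmf P) (g a)" for a
    by (rule measure_pmf.integrable_const_bound[where B = "max (exp s) 1"]) (auto simp: g_def)
  have Eg: "measure_pmf.expectation P (g a) = (if a \<in> S then 1 + q * (exp s - 1) else 1)" for a
  proof (cases "a \<in> S")
    case True
    have "g a = (\<lambda>y. 1 + (exp s - 1) * indicator B y)" using True by (auto simp: g_def indicator_def)
    moreover have "integrable (measure_pmf P) (indicat_real B)"
      by (rule measure_pmf.integrable_const_bound[where B = 1]) auto
    ultimately show ?thesis using True by (simp add: q_def mult.commute)
  next
    case False
    then have "g a = (\<lambda>_. 1)" by (auto simp: g_def)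
    then show ?thesis using False by simp
  qed
  have q: "0 \<le> q" "q \<le> 1" by (auto simp: q_def)
  have "measure_pmf.prob ?Q {f. s * \<tau> \<le> s * card {a \<in> S. f a \<in> B}} =
      measure_pmf.prob ?Q {f \<in> space (measure_pmf ?Q). u f \<ge> exp (s * \<tau>)}"
    by (simp add: u)
  also have "\<dots> \<le> measure_pmf.expectation ?Q u / exp (s * \<tau>)"
  proof (rule integral_Markov_inequality_measure[where A = "{}"])
    show "integrable (measure_pmf ?Q) u"
      unfolding u_def by (rule integrable_prod_Pi_pmf[OF A(1) int])
  qed (auto simp: u)
  also have "measure_pmf.expectation ?Q u = (\<Prod>a\<in>A. measure_pmf.expectation P (g a))"
    unfolding u_def by (rule expectation_prod_Pi_pmf[OF A(1) int]) (auto simp: g_def)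
  also have "\<dots> = (\<Prod>a\<in>S. 1 + q * (exp s - 1))"
    unfolding Eg using A by (intro prod.mono_neutral_cong_right) auto
  also have "\<dots> = (1 + q * (exp s - 1)) ^ card S" by simp
  also have "\<dots> \<le> exp (q * (s + s\<^sup>2)) ^ card S"
  proof (rule power_mono)
    have "1 + q * (exp s - 1) \<le> 1 + q * (s + s\<^sup>2)"
      using exp_le_quadratic[OF s] q by (intro add_left_mono mult_left_mono) auto
    also have "\<dots> \<le> exp (q * (s + s\<^sup>2))" by (rule exp_ge_add_one_self)
    finally show "1 + q * (exp s - 1) \<le> exp (q * (s + s\<^sup>2))" .
    have "0 \<le> (1 - q) + q * exp s" using q by (intro add_nonneg_nonneg mult_nonneg_nonneg) auto
    then show "0 \<le> 1 + q * (exp s - 1)" by (simp add: algebra_simps)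
  qed
  also have "\<dots> = exp (q * card S * (s + s\<^sup>2))" by (simp add: exp_of_nat_mult[symmetric] mult_ac)
  finally show ?thesis by (simp add: divide_right_mono exp_add exp_diff exp_minus field_simps)
qed

text \<open>With parameter \<delta> the mean cancels exactly from the exponent, and the additive
  slack \<open>y\<close> alone decides the bound. It thus stays useful when the mean is small, as
  for small sets in \<open>prob_not_sparse_pairs\<close>.\<close>

lemma chernoff_upper:
  fixes \<delta> y q :: real and P :: "'b pmf" and B :: "'b set"
  assumes A: "finite A" "S \<subseteq> A" and \<delta>: "0 < \<delta>" "\<delta> \<le> 1"
  defines "q \<equiv> measure_pmf.prob P B"
  shows "measure_pmf.prob (Pi_pmf A d (\<lambda>_. P)) {f. (1 + \<delta>) * (q * card S) + y \<le> card {a \<in> S. f a \<in> B}} \<le>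
    exp (- (\<delta> * y))"
proof -
  define \<tau> where "\<tau> = (1 + \<delta>) * (q * card S) + y"
  have "{f. \<tau> \<le> card {a \<in> S. f a \<in> B}} = {f. \<delta> * \<tau> \<le> \<delta> * card {a \<in> S. f a \<in> B}}"
    using \<delta> by simp
  also have "measure_pmf.prob (Pi_pmf A d (\<lambda>_. P)) \<dots> \<le> exp (- \<delta> * \<tau> + q * card S * (\<delta> + \<delta>\<^sup>2))"
    unfolding q_def by (rule chernoff_mgf[OF A]) (use \<delta> in auto)
  also have "- \<delta> * \<tau> + q * card S * (\<delta> + \<delta>\<^sup>2) = - (\<delta> * y)"
    by (simp add: \<tau>_def algebra_simps power2_eq_square)
  finally show ?thesis by (simp add: \<tau>_def)
qed

lemma chernoff_lower:
  fixes \<delta> y q :: real and P :: "'b pmf" and B :: "'b set"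
  assumes A: "finite A" "S \<subseteq> A" and \<delta>: "0 < \<delta>" "\<delta> \<le> 1"
  defines "q \<equiv> measure_pmf.prob P B"
  shows "measure_pmf.prob (Pi_pmf A d (\<lambda>_. P)) {f. card {a \<in> S. f a \<in> B} \<le> (1 - \<delta>) * (q * card S) - y} \<le>
    exp (- (\<delta> * y))"
proof -
  define \<tau> where "\<tau> = (1 - \<delta>) * (q * card S) - y"
  have "{f. card {a \<in> S. f a \<in> B} \<le> \<tau>} = {f. - \<delta> * \<tau> \<le> - \<delta> * card {a \<in> S. f a \<in> B}}"
    using \<delta> by simp
  also have "measure_pmf.prob (Pi_pmf A d (\<lambda>_. P)) \<dots> \<le> exp (- (- \<delta>) * \<tau> + q * card S * (- \<delta> + (- \<delta>)\<^sup>2))"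
    unfolding q_def by (rule chernoff_mgf[OF A]) (use \<delta> in auto)
  also have "- (- \<delta>) * \<tau> + q * card S * (- \<delta> + (- \<delta>)\<^sup>2) = - (\<delta> * y)"
    by (simp add: \<tau>_def algebra_simps power2_eq_square)
  finally show ?thesis by (simp add: \<tau>_def)
qed

lemma prob_UN_le:
  fixes c :: real
  assumes "finite I" "\<And>i. i \<in> I \<Longrightarrow> measure_pmf.prob P (B i) \<le> c"
  shows "measure_pmf.prob P (\<Union>i\<in>I. B i) \<le> card I * c"
proof -
  have "measure_pmf.prob P (\<Union>i\<in>I. B i) \<le> (\<Sum>i\<in>I. measure_pmf.prob P (B i))"
    by (rule measure_pmf.finite_measure_subadditive_finite) (use assms in auto)
  also have "\<dots> \<le> (\<Sum>i\<in>I. c)" by (rule sum_mono) (use assms in auto)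
  finally show ?thesis by simp
qed

lemma prob_Un_le: "measure_pmf.prob P (A \<union> B) \<le> measure_pmf.prob P A + measure_pmf.prob P B"
  by (rule measure_Un_le) auto

text \<open>First moment method for independent uniform colours. Relative slack \<delta> and
  additive slack \<delta> times the mean add up to \<open>2 * \<delta>\<close>, with failure
  probability at most \<open>exp (- (\<delta>\<^sup>2 * \<mu>))\<close>. For each colour there are
  \<open>card F\<close> lower bounds and one upper bound.\<close>

lemma balanced_colouring_exists:
  fixes V :: "'a set" and C :: "'c set" and \<delta> \<mu> :: real
  assumes V: "finite V" and F: "finite F" "\<And>S. S \<in> F \<Longrightarrow> S \<subseteq> V"
    and C: "finite C" "C \<noteq> {}" and \<delta>: "0 < \<delta>" "\<delta> \<le> 1"
    and \<mu>: "\<And>S. S \<in> F \<Longrightarrow> \<mu> \<le> card S / card C" "\<mu> \<le> card V / card C"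
    and small: "(real (card F) + 1) * card C * exp (- (\<delta>\<^sup>2 * \<mu>)) < 1"
  shows "\<exists>\<phi>. (\<forall>v\<in>V. \<phi> v \<in> C) \<and>
    (\<forall>S\<in>F. \<forall>c\<in>C. (1 - 2 * \<delta>) * (card S / card C) \<le> card {v \<in> S. \<phi> v = c}) \<and>
    (\<forall>c\<in>C. card {v \<in> V. \<phi> v = c} \<le> (1 + 2 * \<delta>) * (card V / card C))"
proof -
  define Q where "Q = Pi_pmf V undefined (\<lambda>_. pmf_of_set C)"
  have q: "measure_pmf.prob (pmf_of_set C) {c} = 1 / card C" if "c \<in> C" for c
    using C that by (simp add: measure_pmf_single)
  define B1 where "B1 S c = {\<phi>. card {v \<in> S. \<phi> v \<in> {c}} \<le> (1 - \<delta>) * (measure_pmf.prob (pmf_of_set C) {c} * card S) -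
      \<delta> * (card S / card C)}" for S :: "'a set" and c
  define B2 where "B2 c = {\<phi>. (1 + \<delta>) * (measure_pmf.prob (pmf_of_set C) {c} * card V) + \<delta> * (card V / card C) \<le>
      card {v \<in> V. \<phi> v \<in> {c}}}" for c :: 'c
  define \<epsilon> where "\<epsilon> = exp (- (\<delta>\<^sup>2 * \<mu>))"
  have le: "exp (- (\<delta> * (\<delta> * x))) \<le> \<epsilon>" if "\<mu> \<le> x" for x
    using that \<delta> by (simp add: \<epsilon>_def power2_eq_square mult.assoc)
  have p1: "measure_pmf.prob Q (B1 S c) \<le> \<epsilon>" if "S \<in> F" for S c
    unfolding Q_def B1_def by (rule order_trans[OF chernoff_lower[OF V F(2)[OF that] \<delta>] le[OF \<mu>(1)[OF that]]])
  have p2: "measure_pmf.prob Q (B2 c) \<le> \<epsilon>" for c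
    unfolding Q_def B2_def by (rule order_trans[OF chernoff_upper[OF V subset_refl \<delta>] le[OF \<mu>(2)]])
  define Bad where "Bad = (\<Union>i\<in>F \<times> C. case i of (S, c) \<Rightarrow> B1 S c) \<union> (\<Union>c\<in>C. B2 c)"
  have "measure_pmf.prob Q Bad \<le> card (F \<times> C) * \<epsilon> + card C * \<epsilon>"
    unfolding Bad_def
    by (rule order_trans[OF prob_Un_le add_mono[OF prob_UN_le prob_UN_le]]) (use F C p1 p2 in auto)
  also have "\<dots> = (real (card F) + 1) * card C * \<epsilon>" by (simp add: card_cartesian_product algebra_simps)
  finally have lt: "measure_pmf.prob Q Bad < 1" using small by (simp add: \<epsilon>_def)
  \<comment> \<open>The colouring is taken from the support, since this is what puts its values into
    \<open>C\<close>.\<close>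
  have "\<not> set_pmf Q \<subseteq> Bad"
  proof
    assume "set_pmf Q \<subseteq> Bad"
    then have "measure_pmf.prob Q Bad = 1"
      by (subst measure_pmf.prob_eq_1) (auto simp: AE_measure_pmf_iff)
    then show False using lt by simp
  qed
  then obtain \<phi> where \<phi>: "\<phi> \<in> set_pmf Q" "\<phi> \<notin> Bad" by blast
  show ?thesis
  proof (intro exI[of _ \<phi>] conjI ballI)
    show "\<phi> v \<in> C" if "v \<in> V" for v
      using \<phi>(1) that C V by (auto simp: Q_def set_Pi_pmf PiE_dflt_def)
    show "(1 - 2 * \<delta>) * (card S / card C) \<le> card {v \<in> S. \<phi> v = c}" if "S \<in> F" "c \<in> C" for S c
    proof -
      have "\<phi> \<notin> B1 S c" using \<phi>(2) that by (auto simp: Bad_def)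
      moreover define x where "x = real (card S) / card C"
      moreover have "measure_pmf.prob (pmf_of_set C) {c} * card S = x" using q[OF that(2)] by (simp add: x_def)
      ultimately have "(1 - \<delta>) * x - \<delta> * x < card {v \<in> S. \<phi> v = c}" by (simp add: B1_def)
      then show ?thesis unfolding x_def[symmetric] by (simp add: algebra_simps)
    qed
    show "card {v \<in> V. \<phi> v = c} \<le> (1 + 2 * \<delta>) * (card V / card C)" if "c \<in> C" for c
    proof -
      have "\<phi> \<notin> B2 c" using \<phi>(2) that by (auto simp: Bad_def)
      moreover define x where "x = real (card V) / card C"
      moreover have "measure_pmf.prob (pmf_of_set C) {c} * card V = x" using q[OF that] by (simp add: x_def)
      ultimately have "card {v \<in> V. \<phi> v = c} < (1 + \<delta>) * x + \<delta> * x" by (simp add: B2_def)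
      then show ?thesis unfolding x_def[symmetric] by (simp add: algebra_simps)
    qed
  qed
qed

section \<open>Typical properties of the random digraph\<close>

definition random_arcs :: "nat \<Rightarrow> real \<Rightarrow> (nat \<times> nat \<Rightarrow> bool) pmf" where
  "random_arcs n p = Pi_pmf (arc_pairs n) False (\<lambda>_. bernoulli_pmf p)"

definition arcs_of :: "nat \<Rightarrow> (nat \<times> nat \<Rightarrow> bool) \<Rightarrow> (nat \<times> nat) set" where
  "arcs_of n f = {a \<in> arc_pairs n. f a}"

text \<open>An upper bound only, so it passes to every subset of the arcs and survives any deletion.
  The linear term makes the union bound over all pairs of sets affordable.\<close>

definition sparse_pairs :: "nat \<Rightarrow> real \<Rightarrow> real \<Rightarrow> real \<Rightarrow> (nat \<times> nat) set \<Rightarrow> bool" where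
  "sparse_pairs n p \<delta> \<Lambda> E \<longleftrightarrow> (\<forall>X Y. X \<subseteq> {1..n} \<longrightarrow> Y \<subseteq> {1..n} \<longrightarrow>
     real (card (E \<inter> X \<times> Y)) \<le> (1 + \<delta>) * p * card X * card Y + \<Lambda> * (real (card X) + card Y))"

lemma finite_arc_pairs: "finite (arc_pairs n)"
  by (rule finite_subset[of _ "{1..n} \<times> {1..n}"]) (auto simp: arc_pairs_def)

lemma sum_power_card_Pow:
  fixes r :: real
  assumes "finite A"
  shows "(\<Sum>X\<in>Pow A. r ^ card X) = (1 + r) ^ card A"
proof -
  have "(1 + r) ^ card A = (\<Prod>a\<in>A. r + 1)" by (simp add: add.commute)
  also have "\<dots> = (\<Sum>X\<in>Pow A. (\<Prod>a\<in>X. r) * (\<Prod>a\<in>A - X. 1))" by (rule prod_add[OF assms])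
  finally show ?thesis by simp
qed

text \<open>A pair (X, Y) fails with probability at most r^(|X| + |Y|), where the coefficient 3 /
  \<delta> makes r = n^(-3). The sum over pairs of nonempty sets therefore factorises into the
  square of \<open>(1 + r) ^ n - 1\<close>, which is about n^(-2).\<close>

lemma prob_not_sparse_pairs:
  fixes p \<delta> :: real
  assumes n: "n \<ge> 1" and p: "0 \<le> p" "p \<le> 1" and \<delta>: "0 < \<delta>" "\<delta> \<le> 1"
  shows "measure_pmf.prob (random_arcs n p) {f. \<not> sparse_pairs n p \<delta> (3 / \<delta> * ln n) (arcs_of n f)}
    \<le> (exp (1 / (real n)\<^sup>2) - 1)\<^sup>2"
proof -
  define \<Lambda> where "\<Lambda> = 3 / \<delta> * ln n"
  define r where "r = exp (- (\<delta> * \<Lambda>))"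
  define B where "B X Y = {f. (1 + \<delta>) * (measure_pmf.prob (bernoulli_pmf p) {True} * card (arc_pairs n \<inter> X \<times> Y)) +
      \<Lambda> * (real (card X) + card Y) \<le> card {a \<in> arc_pairs n \<inter> X \<times> Y. f a \<in> {True}}}" for X Y
  let ?V = "{1..n}" and ?Q = "random_arcs n p"
  \<comment> \<open>Empty sets span no arcs and are left out; their term is the 1 that is subtracted
    from \<open>(1 + r) ^ n\<close>.\<close>
  define N where "N = Pow ?V - {{}}"
  have \<Lambda>0: "\<Lambda> \<ge> 0" using \<delta> n by (simp add: \<Lambda>_def)
  have q: "measure_pmf.prob (bernoulli_pmf p) {True} = p" using p by (simp add: measure_pmf_single)
  have pB: "measure_pmf.prob ?Q (B X Y) \<le> r ^ card X * r ^ card Y" for X Y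
  proof -
    have "measure_pmf.prob ?Q (B X Y) \<le> exp (- (\<delta> * (\<Lambda> * (real (card X) + card Y))))"
      unfolding B_def random_arcs_def by (rule chernoff_upper[OF finite_arc_pairs _ \<delta>]) auto
    also have "\<dots> = r ^ card X * r ^ card Y"
    proof -
      have "- (\<delta> * (\<Lambda> * (real (card X) + card Y))) =
          real (card X) * - (\<delta> * \<Lambda>) + real (card Y) * - (\<delta> * \<Lambda>)" by (simp add: algebra_simps)
      then show ?thesis unfolding r_def by (simp only: exp_add exp_of_nat_mult)
    qed
    finally show ?thesis .
  qed
  have sub: "{f. \<not> sparse_pairs n p \<delta> \<Lambda> (arcs_of n f)} \<subseteq> (\<Union>i\<in>N \<times> N. case i of (X, Y) \<Rightarrow> B X Y)"
  proof
    fix f assume "f \<in> {f. \<not> sparse_pairs n p \<delta> \<Lambda> (arcs_of n f)}"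
    then obtain X Y where XY: "X \<subseteq> ?V" "Y \<subseteq> ?V"
      and gt: "(1 + \<delta>) * p * card X * card Y + \<Lambda> * (real (card X) + card Y) < card (arcs_of n f \<inter> X \<times> Y)"
      by (auto simp: sparse_pairs_def not_le)
    have fin: "finite X" "finite Y" using XY finite_subset by blast+
    have rhs: "0 \<le> (1 + \<delta>) * p * card X * card Y + \<Lambda> * (real (card X) + card Y)"
      using \<delta> p \<Lambda>0 by simp
    then have "arcs_of n f \<inter> X \<times> Y \<noteq> {}" using gt by auto
    then have ne: "X \<noteq> {}" "Y \<noteq> {}" by auto
    have "card (arc_pairs n \<inter> X \<times> Y) \<le> card (X \<times> Y)" using fin by (intro card_mono) auto
    then have "real (card (arc_pairs n \<inter> X \<times> Y)) \<le> real (card X) * card Y"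
      by (simp add: card_cartesian_product flip: of_nat_mult)
    then have "(1 + \<delta>) * (p * card (arc_pairs n \<inter> X \<times> Y)) \<le> (1 + \<delta>) * (p * (real (card X) * card Y))"
      using \<delta> p by (intro mult_left_mono) auto
    moreover have "arcs_of n f \<inter> X \<times> Y = {a \<in> arc_pairs n \<inter> X \<times> Y. f a \<in> {True}}"
      by (auto simp: arcs_of_def)
    ultimately have "f \<in> B X Y" using gt by (simp add: B_def q mult.assoc)
    then show "f \<in> (\<Union>i\<in>N \<times> N. case i of (X, Y) \<Rightarrow> B X Y)" using XY ne by (auto simp: N_def)
  qed
  have "measure_pmf.prob ?Q {f. \<not> sparse_pairs n p \<delta> \<Lambda> (arcs_of n f)} \<le>
      measure_pmf.prob ?Q (\<Union>i\<in>N \<times> N. case i of (X, Y) \<Rightarrow> B X Y)"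
    by (rule measure_pmf.finite_measure_mono[OF sub]) simp
  also have "\<dots> \<le> (\<Sum>i\<in>N \<times> N. measure_pmf.prob ?Q (case i of (X, Y) \<Rightarrow> B X Y))"
    by (rule measure_pmf.finite_measure_subadditive_finite) (auto simp: N_def)
  also have "\<dots> \<le> (\<Sum>i\<in>N \<times> N. case i of (X, Y) \<Rightarrow> r ^ card X * r ^ card Y)"
    by (rule sum_mono) (use pB in auto)
  also have "\<dots> = (\<Sum>X\<in>N. r ^ card X)\<^sup>2"
    by (simp add: sum_product power2_eq_square sum.cartesian_product)
  also have "(\<Sum>X\<in>N. r ^ card X) = (1 + r) ^ n - 1"
  proof -
    have "(\<Sum>X\<in>N. r ^ card X) = (\<Sum>X\<in>Pow ?V. r ^ card X) - r ^ card ({} :: nat set)"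
      unfolding N_def by (subst sum_diff1) auto
    then show ?thesis using sum_power_card_Pow[of ?V r] by simp
  qed
  also have "((1 + r) ^ n - 1)\<^sup>2 \<le> (exp (1 / (real n)\<^sup>2) - 1)\<^sup>2"
  proof (rule power_mono)
    have r0: "r \<ge> 0" by (simp add: r_def)
    have "\<delta> * \<Lambda> = real 3 * ln n" using \<delta> by (simp add: \<Lambda>_def)
    then have "exp (\<delta> * \<Lambda>) = exp (ln (real n)) ^ 3" by (simp only: exp_of_nat_mult)
    also have "\<dots> = real n ^ 3" using n by simp
    finally have "r = inverse (real n ^ 3)" unfolding r_def exp_minus by simp
    then have rn: "real n * r = 1 / (real n)\<^sup>2" using n by (simp add: field_simps power2_eq_square power3_eq_cube)
    have "(1 + r) ^ n \<le> exp r ^ n" using r0 by (intro power_mono exp_ge_add_one_self) auto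
    also have "\<dots> = exp (real n * r)" by (rule exp_of_nat_mult[symmetric])
    finally show "(1 + r) ^ n - 1 \<le> exp (1 / (real n)\<^sup>2) - 1" unfolding rn by simp
    show "0 \<le> (1 + r) ^ n - 1" using r0 by (simp add: one_le_power)
  qed
  finally show ?thesis by (simp add: \<Lambda>_def)
qed

text \<open>The minimum semidegrees serve both bounds on the resilience. The last two conditions
  concern the arcs from the first half of the vertices to the second, which are deleted for the
  upper bound.\<close>

definition degrees_ok :: "nat \<Rightarrow> real \<Rightarrow> real \<Rightarrow> (nat \<times> nat) set \<Rightarrow> bool" where
  "degrees_ok n p \<delta> E \<longleftrightarrow>
     (\<forall>v\<in>{1..n}. (1 - 2 * \<delta>) * (p * (real n - 1)) \<le> real (card (E `` {v})) \<and>
                 (1 - 2 * \<delta>) * (p * (real n - 1)) \<le> real (card (E\<inverse> `` {v}))) \<and>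
     (\<forall>v\<in>{1..n div 2}. real (card (E `` {v} \<inter> {n div 2<..n})) \<le> (1 + 2 * \<delta>) * (p * card {n div 2<..n})) \<and>
     (\<forall>v\<in>{n div 2<..n}. real (card (E\<inverse> `` {v} \<inter> {1..n div 2})) \<le> (1 + 2 * \<delta>) * (p * card {1..n div 2}))"

lemma card_out:
  assumes "v \<in> {1..n}" "W \<subseteq> {1..n}"
  shows "card (arcs_of n f `` {v} \<inter> W) = card {a \<in> {v} \<times> (W - {v}). f a \<in> {True}}"
proof -
  have "arcs_of n f `` {v} \<inter> W = {w \<in> W - {v}. f (v, w)}"
    using assms by (auto simp: arcs_of_def arc_pairs_def)
  moreover have "{a \<in> {v} \<times> (W - {v}). f a \<in> {True}} = Pair v ` {w \<in> W - {v}. f (v, w)}" by auto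
  ultimately have "{a \<in> {v} \<times> (W - {v}). f a \<in> {True}} = Pair v ` (arcs_of n f `` {v} \<inter> W)" by simp
  then show ?thesis by (simp add: card_image inj_on_def)
qed

lemma card_in:
  assumes "v \<in> {1..n}" "W \<subseteq> {1..n}"
  shows "card ((arcs_of n f)\<inverse> `` {v} \<inter> W) = card {a \<in> (W - {v}) \<times> {v}. f a \<in> {True}}"
proof -
  have "(arcs_of n f)\<inverse> `` {v} \<inter> W = {w \<in> W - {v}. f (w, v)}"
    using assms by (auto simp: arcs_of_def arc_pairs_def)
  moreover have "{a \<in> (W - {v}) \<times> {v}. f a \<in> {True}} = (\<lambda>w. (w, v)) ` {w \<in> W - {v}. f (w, v)}" by auto
  ultimately have "{a \<in> (W - {v}) \<times> {v}. f a \<in> {True}} = (\<lambda>w. (w, v)) ` ((arcs_of n f)\<inverse> `` {v} \<inter> W)" by simp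
  then show ?thesis by (simp add: card_image inj_on_def)
qed

text \<open>Every degree in question counts arcs among at least (n - 1) / 2 pairs, which fixes the
  exponent. There are 2 n events for the semidegrees and n for the two halves.\<close>

lemma prob_not_degrees_ok:
  fixes p \<delta> :: real
  assumes n: "n \<ge> 2" and p: "0 \<le> p" "p \<le> 1" and \<delta>: "0 < \<delta>" "\<delta> \<le> 1"
  shows "measure_pmf.prob (random_arcs n p) {f. \<not> degrees_ok n p \<delta> (arcs_of n f)}
    \<le> 3 * real n * exp (- (\<delta>\<^sup>2 * (p * (real n - 1) / 2)))"
proof -
  let ?V = "{1..n}" and ?L = "{1..n div 2}" and ?R = "{n div 2<..n}" and ?Q = "random_arcs n p"
  define \<epsilon> where "\<epsilon> = exp (- (\<delta>\<^sup>2 * (p * (real n - 1) / 2)))"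
  have q: "measure_pmf.prob (bernoulli_pmf p) {True} = p" using p by (simp add: measure_pmf_single)
  have le: "exp (- (\<delta> * (\<delta> * (p * x)))) \<le> \<epsilon>" if "(real n - 1) / 2 \<le> x" for x
  proof -
    have "\<delta>\<^sup>2 * (p * ((real n - 1) / 2)) \<le> \<delta>\<^sup>2 * (p * x)" using that p by (intro mult_left_mono) auto
    then show ?thesis by (simp add: \<epsilon>_def power2_eq_square mult.assoc)
  qed
  have lower: "measure_pmf.prob ?Q {f. card {a \<in> S. f a \<in> {True}} < (1 - 2 * \<delta>) * (p * card S)} \<le> \<epsilon>"
    if "S \<subseteq> arc_pairs n" "(real n - 1) / 2 \<le> card S" for S
  proof -
    have "measure_pmf.prob ?Q {f. card {a \<in> S. f a \<in> {True}} < (1 - 2 * \<delta>) * (p * card S)} \<le>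
      measure_pmf.prob ?Q {f. card {a \<in> S. f a \<in> {True}} \<le>
        (1 - \<delta>) * (measure_pmf.prob (bernoulli_pmf p) {True} * card S) - \<delta> * (p * card S)}"
      by (rule measure_pmf.finite_measure_mono) (auto simp: q algebra_simps)
    also have "\<dots> \<le> exp (- (\<delta> * (\<delta> * (p * card S))))"
      unfolding random_arcs_def by (rule chernoff_lower[OF finite_arc_pairs that(1) \<delta>])
    finally show ?thesis using le[OF that(2)] by linarith
  qed
  have upper: "measure_pmf.prob ?Q {f. (1 + 2 * \<delta>) * (p * card S) < card {a \<in> S. f a \<in> {True}}} \<le> \<epsilon>"
    if "S \<subseteq> arc_pairs n" "(real n - 1) / 2 \<le> card S" for S
  proof -
    have "measure_pmf.prob ?Q {f. (1 + 2 * \<delta>) * (p * card S) < card {a \<in> S. f a \<in> {True}}} \<le>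
      measure_pmf.prob ?Q {f. (1 + \<delta>) * (measure_pmf.prob (bernoulli_pmf p) {True} * card S) + \<delta> * (p * card S)
        \<le> card {a \<in> S. f a \<in> {True}}}"
      by (rule measure_pmf.finite_measure_mono) (auto simp: q algebra_simps)
    also have "\<dots> \<le> exp (- (\<delta> * (\<delta> * (p * card S))))"
      unfolding random_arcs_def by (rule chernoff_upper[OF finite_arc_pairs that(1) \<delta>])
    finally show ?thesis using le[OF that(2)] by linarith
  qed
  define O1 where "O1 v = {v} \<times> (?V - {v})" for v
  define I1 where "I1 v = (?V - {v}) \<times> {v}" for v
  define O2 where "O2 v = {v} \<times> (?R - {v})" for v
  define I2 where "I2 v = (?L - {v}) \<times> {v}" for v
  define lo where "lo S = {f. card {a \<in> S. f a \<in> {True}} < (1 - 2 * \<delta>) * (p * card S)}" for S :: "(nat \<times> nat) set"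
  define hi where "hi S = {f. (1 + 2 * \<delta>) * (p * card S) < card {a \<in> S. f a \<in> {True}}}" for S :: "(nat \<times> nat) set"
  have cR: "card ?R = n - n div 2" "card ?L = n div 2" by auto
  have half: "(real n - 1) / 2 \<le> real (n div 2)" "(real n - 1) / 2 \<le> real (n - n div 2)"
  proof -
    have "n \<le> 2 * (n div 2) + 1" by presburger
    then have "real n \<le> real (2 * (n div 2) + 1)" by (rule of_nat_mono)
    then show 1: "(real n - 1) / 2 \<le> real (n div 2)" by simp
    have "n div 2 \<le> n - n div 2" by presburger
    then have "real (n div 2) \<le> real (n - n div 2)" by (rule of_nat_mono)
    then show "(real n - 1) / 2 \<le> real (n - n div 2)" using 1 by linarith
  qed
  have sub: "{f. \<not> degrees_ok n p \<delta> (arcs_of n f)} \<subseteq>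
      (\<Union>v\<in>?V. lo (O1 v)) \<union> (\<Union>v\<in>?V. lo (I1 v)) \<union> ((\<Union>v\<in>?L. hi (O2 v)) \<union> (\<Union>v\<in>?R. hi (I2 v)))"
  proof
    fix f assume f: "f \<in> {f. \<not> degrees_ok n p \<delta> (arcs_of n f)}"
    have full: "arcs_of n f `` {v} \<inter> ?V = arcs_of n f `` {v}" "(arcs_of n f)\<inverse> `` {v} \<inter> ?V = (arcs_of n f)\<inverse> `` {v}" for v
      by (auto simp: arcs_of_def arc_pairs_def)
    have o1: "f \<in> lo (O1 v) \<longleftrightarrow> card (arcs_of n f `` {v}) < (1 - 2 * \<delta>) * (p * (real n - 1))" if "v \<in> ?V" for v
      using card_out[OF that subset_refl, of f, unfolded full] that n
      by (simp add: lo_def O1_def card_cartesian_product of_nat_diff)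
    have i1: "f \<in> lo (I1 v) \<longleftrightarrow> card ((arcs_of n f)\<inverse> `` {v}) < (1 - 2 * \<delta>) * (p * (real n - 1))" if "v \<in> ?V" for v
      using card_in[OF that subset_refl, of f, unfolded full] that n
      by (simp add: lo_def I1_def card_cartesian_product of_nat_diff)
    have o2: "f \<in> hi (O2 v) \<longleftrightarrow> (1 + 2 * \<delta>) * (p * card ?R) < card (arcs_of n f `` {v} \<inter> ?R)" if "v \<in> ?L" for v
    proof -
      have "v \<in> ?V" "?R \<subseteq> ?V" "?R - {v} = ?R" using that by auto
      then show ?thesis using card_out[of v n ?R f] by (simp add: hi_def O2_def card_cartesian_product)
    qed
    have i2: "f \<in> hi (I2 v) \<longleftrightarrow> (1 + 2 * \<delta>) * (p * card ?L) < card ((arcs_of n f)\<inverse> `` {v} \<inter> ?L)" if "v \<in> ?R" for v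
    proof -
      have "v \<in> ?V" "?L \<subseteq> ?V" "?L - {v} = ?L" using that by auto
      then show ?thesis using card_in[of v n ?L f] by (simp add: hi_def I2_def card_cartesian_product)
    qed
    show "f \<in> (\<Union>v\<in>?V. lo (O1 v)) \<union> (\<Union>v\<in>?V. lo (I1 v)) \<union> ((\<Union>v\<in>?L. hi (O2 v)) \<union> (\<Union>v\<in>?R. hi (I2 v)))"
    proof (rule ccontr)
      assume neg: "\<not> ?thesis"
      have "\<forall>v\<in>?V. f \<notin> lo (O1 v)" "\<forall>v\<in>?V. f \<notin> lo (I1 v)" "\<forall>v\<in>?L. f \<notin> hi (O2 v)" "\<forall>v\<in>?R. f \<notin> hi (I2 v)"
        using neg by blast+
      then have "degrees_ok n p \<delta> (arcs_of n f)"
        unfolding degrees_ok_def using o1 i1 o2 i2 by (metis not_less)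
      then show False using f by simp
    qed
  qed
  have "measure_pmf.prob ?Q {f. \<not> degrees_ok n p \<delta> (arcs_of n f)} \<le> measure_pmf.prob ?Q
      ((\<Union>v\<in>?V. lo (O1 v)) \<union> (\<Union>v\<in>?V. lo (I1 v)) \<union> ((\<Union>v\<in>?L. hi (O2 v)) \<union> (\<Union>v\<in>?R. hi (I2 v))))"
    by (rule measure_pmf.finite_measure_mono[OF sub]) simp
  also have "\<dots> \<le> (card ?V * \<epsilon> + card ?V * \<epsilon>) + (card ?L * \<epsilon> + card ?R * \<epsilon>)"
  proof (intro order_trans[OF prob_Un_le] add_mono prob_UN_le)
    show "measure_pmf.prob ?Q (lo (O1 v)) \<le> \<epsilon>" if "v \<in> ?V" for v
      unfolding lo_def by (rule lower) (use that n in \<open>auto simp: O1_def arc_pairs_def card_cartesian_product of_nat_diff\<close>)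
    show "measure_pmf.prob ?Q (lo (I1 v)) \<le> \<epsilon>" if "v \<in> ?V" for v
      unfolding lo_def by (rule lower) (use that n in \<open>auto simp: I1_def arc_pairs_def card_cartesian_product of_nat_diff\<close>)
    show "measure_pmf.prob ?Q (hi (O2 v)) \<le> \<epsilon>" if "v \<in> ?L" for v
    proof -
      have "?R - {v} = ?R" using that by auto
      then show ?thesis unfolding hi_def
        by (intro upper) (use that half cR in \<open>auto simp: O2_def arc_pairs_def card_cartesian_product\<close>)
    qed
    show "measure_pmf.prob ?Q (hi (I2 v)) \<le> \<epsilon>" if "v \<in> ?R" for v
    proof -
      have "?L - {v} = ?L" using that by auto
      then show ?thesis unfolding hi_def
        by (intro upper) (use that half cR in \<open>auto simp: I2_def arc_pairs_def card_cartesian_product\<close>)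
    qed
  qed auto
  also have "\<dots> = (2 * real n + (real (n div 2) + real (n - n div 2))) * \<epsilon>"
    by (simp add: cR algebra_simps)
  also have "real (n div 2) + real (n - n div 2) = real n" by (simp flip: of_nat_add)
  finally show ?thesis by (simp add: \<epsilon>_def)
qed


section \<open>Hamiltonicity and resilience\<close>

lemma cas_orbit:
  assumes "tail G = fst" "head G = snd" "a \<le> b"
  shows "pre_digraph.cas G ((f ^^ a) v) (map (\<lambda>i. ((f ^^ i) v, (f ^^ Suc i) v)) [a..<b]) ((f ^^ b) v)"
  using assms(3)
proof (induction "b - a" arbitrary: a)
  case 0
  then show ?case by (simp add: pre_digraph.cas.simps)
next
  case (Suc m)
  then have "a < b" by simp
  then have "[a..<b] = a # [Suc a..<b]" by (simp add: upt_conv_Cons)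
  moreover have "pre_digraph.cas G ((f ^^ Suc a) v) (map (\<lambda>i. ((f ^^ i) v, (f ^^ Suc i) v)) [Suc a..<b]) ((f ^^ b) v)"
    by (rule Suc.hyps(1)) (use Suc.hyps(2) \<open>a < b\<close> in auto)
  ultimately show ?case using assms(1,2) by (simp add: pre_digraph.cas.simps)
qed

text \<open>The cycle is the orbit of a vertex \<open>v\<close> up to its least period
  \<open>N\<close>. The orbit is closed under successors and, by injectivity, under predecessors in
  \<open>V\<close>, so it exhausts its class of \<open>cyc\<close>, which is all of
  \<open>V\<close>.\<close>

lemma hamiltonian_of_permutation:
  assumes G: "verts G = V" "tail G = fst" "head G = snd"
    and V: "finite V" "V \<noteq> {}" and f: "bij_betw f V V" "\<And>x. x \<in> V \<Longrightarrow> (x, f x) \<in> arcs G"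
    and one: "V \<times> V \<subseteq> cyc V f"
  shows "hamiltonian G"
proof -
  obtain v where v: "v \<in> V" using V by blast
  have fV: "f ` V \<subseteq> V" using f by (simp add: bij_betw_def)
  have inj: "inj_on f V" using f by (simp add: bij_betw_def)
  have inV: "(f ^^ i) v \<in> V" for i by (rule funpow_mem[OF fV v])
  obtain m where "(f ^^ Suc m) v = v"
    using funpow_returns[OF V(1) f(1) v] by (auto simp: funpow_swap1)
  then have ex: "\<exists>N. N \<ge> 1 \<and> (f ^^ N) v = v" by (intro exI[of _ "Suc m"]) simp
  define N where "N = (LEAST N. N \<ge> 1 \<and> (f ^^ N) v = v)"
  have N: "N \<ge> 1" "(f ^^ N) v = v" using LeastI_ex[OF ex] by (simp_all add: N_def)
  have least: "k \<ge> N" if "k \<ge> 1" "(f ^^ k) v = v" for k unfolding N_def by (rule Least_le) (use that in simp)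
  have canc: "(f ^^ k) v = v" if "(f ^^ (i + k)) v = (f ^^ i) v" for i k
    using that
  proof (induction i)
    case (Suc i)
    then have "f ((f ^^ (i + k)) v) = f ((f ^^ i) v)" by simp
    then have "(f ^^ (i + k)) v = (f ^^ i) v" by (rule inj_onD[OF inj _ inV inV])
    then show ?case by (rule Suc.IH)
  qed simp
  have dist: "i = j" if "i \<le> j" "j < N + i" "(f ^^ i) v = (f ^^ j) v" for i j
  proof (rule ccontr)
    assume "i \<noteq> j"
    then have "j - i \<ge> 1" "(f ^^ (j - i)) v = v" using that canc[of i "j - i"] by auto
    then show False using least[of "j - i"] that by simp
  qed
  define c where "c = map (\<lambda>i. ((f ^^ i) v, (f ^^ Suc i) v)) [0..<N]"
  have cas: "pre_digraph.cas G v c v"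
    using cas_orbit[OF G(2,3), of 0 N f v] N by (simp add: c_def)
  have sub: "set c \<subseteq> arcs G" using f(2)[OF inV] by (auto simp: c_def)
  have walk: "pre_digraph.awalk G v c v" using cas sub v G by (simp add: pre_digraph.awalk_def)
  have ne: "c \<noteq> []" using N by (simp add: c_def)
  have verts: "pre_digraph.awalk_verts G v c = tail G (hd c) # map (\<lambda>i. (f ^^ Suc i) v) [0..<N]"
    using pre_digraph.awalk_verts_conv'[OF cas] ne G by (simp add: c_def)
  have "inj_on (\<lambda>i. (f ^^ Suc i) v) {0..<N}"
  proof (rule inj_onI)
    fix i j assume ij: "i \<in> {0..<N}" "j \<in> {0..<N}" "(f ^^ Suc i) v = (f ^^ Suc j) v"
    show "i = j"
      using ij dist[of "Suc i" "Suc j"] dist[of "Suc j" "Suc i"] by (cases "i \<le> j") auto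
  qed
  then have "distinct (tl (pre_digraph.awalk_verts G v c))" by (simp add: verts distinct_map)
  then have cycle: "pre_digraph.cycle G c" using walk ne unfolding pre_digraph.cycle_def by blast
  define Orb where "Orb = range (\<lambda>i. (f ^^ i) v)"
  have OrbV: "Orb \<subseteq> V" using inV by (auto simp: Orb_def)
  have "w \<in> Orb" if "(v, w) \<in> cyc V f" for w
    using that unfolding cyc_def
  proof (induction rule: rtrancl_induct)
    case base
    then show ?case unfolding Orb_def by (rule range_eqI[of _ _ 0]) simp
  next
    case (step y z)
    obtain i where i: "y = (f ^^ i) v" using step by (auto simp: Orb_def)
    consider "z = f y" | "z \<in> V" "y = f z" using step by auto
    then show ?case
    proof cases
      case 1
      then show ?thesis unfolding Orb_def i by (intro range_eqI[of _ _ "Suc i"]) simp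
    next
      case 2
      have "\<exists>j. y = f ((f ^^ j) v)"
      proof (cases i)
        case 0
        \<comment> \<open>The predecessor of \<open>v\<close> itself is found by going once around
          the cycle.\<close>
        have "y = (f ^^ Suc (N - 1)) v" using N i 0 by simp
        then show ?thesis by (intro exI[of _ "N - 1"]) simp
      next
        case (Suc j)
        then show ?thesis using i by (intro exI[of _ j]) simp
      qed
      then obtain j where "f z = f ((f ^^ j) v)" using 2 by metis
      then have "z = (f ^^ j) v" by (rule inj_onD[OF inj _ 2(1) inV])
      then show ?thesis by (auto simp: Orb_def)
    qed
  qed
  then have VOrb: "V \<subseteq> Orb" using one v by blast
  \<comment> \<open>Exponents are normalised to 1, ..., \<open>N\<close>, since these index the
    vertices of the walk after its first entry.\<close>
  have mod: "\<exists>j. 1 \<le> j \<and> j \<le> N \<and> (f ^^ i) v = (f ^^ j) v" for i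
  proof (induction i)
    case 0
    then show ?case using N by (intro exI[of _ N]) simp
  next
    case (Suc i)
    then obtain j where j: "1 \<le> j" "j \<le> N" "(f ^^ i) v = (f ^^ j) v" by blast
    show ?case
    proof (cases "j = N")
      case True
      then have "(f ^^ Suc i) v = (f ^^ 1) v" using j N by simp
      then show ?thesis using N(1) by (intro exI[of _ 1]) simp
    next
      case False
      then show ?thesis using j by (intro exI[of _ "Suc j"]) simp
    qed
  qed
  have "V \<subseteq> set (pre_digraph.awalk_verts G v c)"
  proof
    fix w assume "w \<in> V"
    then obtain i where "w = (f ^^ i) v" using VOrb by (auto simp: Orb_def)
    then obtain j where j: "1 \<le> j" "j \<le> N" "w = (f ^^ j) v" using mod[of i] by auto
    then have "w = (f ^^ Suc (j - 1)) v" "j - 1 < N" by simp_all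
    then show "w \<in> set (pre_digraph.awalk_verts G v c)" unfolding verts by auto
  qed
  moreover have "set (pre_digraph.awalk_verts G v c) \<subseteq> V"
  proof -
    have "tail G (hd c) \<in> V" using N inV[of 0] G by (simp add: c_def hd_map)
    then show ?thesis unfolding verts using inV[of "Suc _"] by auto
  qed
  ultimately show ?thesis unfolding hamiltonian_def using cycle walk G by blast
qed

text \<open>The colouring is chosen for the given \<open>E\<close>, hence after the deletion, so
  mere existence is enough. It is balanced on the vertex set and on all out- and in-neighbourhoods,
  at most \<open>2 * n + 1\<close> sets, whence the factor \<open>2 * n + 2\<close> in the union
  bound.\<close>

lemma hamilton_deterministic:
  fixes E :: "(nat \<times> nat) set" and p \<delta> \<kappa> \<Lambda> :: real and n d J :: nat
  defines "\<delta> \<equiv> 1 / (8 * real d)" and "M \<equiv> card (parts d J)"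
  assumes E: "E \<subseteq> {1..n} \<times> {1..n}" "sparse_pairs n p \<delta> \<Lambda> E"
    and deg: "\<And>v. v \<in> {1..n} \<Longrightarrow> \<kappa> * p * n \<le> card (E `` {v})"
      "\<And>v. v \<in> {1..n} \<Longrightarrow> \<kappa> * p * n \<le> card (E\<inverse> `` {v})"
    and d: "d \<ge> 2" and J: "odd J" "n < 2 ^ J" and p: "0 < p" "p \<le> 1"
    and \<kappa>: "1 / 2 + 2 / real d \<le> \<kappa>" "\<kappa> \<le> 1"
    and \<Lambda>: "\<Lambda> \<ge> 0" "9 * \<Lambda> \<le> \<delta> * (p * (n / M))" and M: "real M \<le> \<delta> * (n / M)"
    and small: "(2 * real n + 2) * M * exp (- (\<delta>\<^sup>2 * (\<kappa> * p * n / M))) < 1"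
  shows "\<exists>f. bij_betw f {1..n} {1..n} \<and> (\<forall>x\<in>{1..n}. (x, f x) \<in> E) \<and> {1..n} \<times> {1..n} \<subseteq> cyc {1..n} f"
proof -
  let ?V = "{1..n}"
  define F where "F = (\<lambda>v. E `` {v}) ` ?V \<union> (\<lambda>v. E\<inverse> `` {v}) ` ?V"
  define \<mu> where "\<mu> = \<kappa> * p * n / M"
  have \<delta>: "0 < \<delta>" "\<delta> \<le> 1" using d by (auto simp: \<delta>_def)
  have "card (parts d J) > 0" by (simp add: card_parts special_parts_def)
  then have M0: "real M > 0" by (simp add: M_def)
  have cF: "card F \<le> 2 * n"
  proof -
    have "card F \<le> card ((\<lambda>v. E `` {v}) ` ?V) + card ((\<lambda>v. E\<inverse> `` {v}) ` ?V)"
      unfolding F_def by (rule card_Un_le)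
    also have "\<dots> \<le> card ?V + card ?V" by (intro add_mono card_image_le) auto
    finally show ?thesis by simp
  qed
  have "\<exists>\<phi>. (\<forall>v\<in>?V. \<phi> v \<in> parts d J) \<and>
    (\<forall>S\<in>insert ?V F. \<forall>c\<in>parts d J. (1 - 2 * \<delta>) * (card S / card (parts d J)) \<le> card {v \<in> S. \<phi> v = c}) \<and>
    (\<forall>c\<in>parts d J. card {v \<in> ?V. \<phi> v = c} \<le> (1 + 2 * \<delta>) * (card ?V / card (parts d J)))"
  proof (rule balanced_colouring_exists[where \<mu> = \<mu>])
    show "S \<subseteq> ?V" if "S \<in> insert ?V F" for S using that E(1) by (auto simp: F_def)
    have "\<kappa> * p \<le> 1 * 1" using \<kappa> p by (intro mult_mono) auto
    then have "\<kappa> * p * n \<le> 1 * real n" by (intro mult_right_mono) auto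
    then have Vmu: "\<mu> \<le> card ?V / card (parts d J)" unfolding \<mu>_def M_def[symmetric] using M0
      by (simp add: divide_right_mono)
    then show "\<mu> \<le> card ?V / card (parts d J)" .
    show "\<mu> \<le> card S / card (parts d J)" if "S \<in> insert ?V F" for S
    proof (cases "S = ?V")
      case True
      then show ?thesis using Vmu by simp
    next
      case False
      then have "\<kappa> * p * n \<le> card S" using that deg by (auto simp: F_def)
      then show ?thesis unfolding \<mu>_def M_def[symmetric] using M0 by (simp add: divide_right_mono)
    qed
    have "card (insert ?V F) \<le> 2 * n + 1" using cF card_insert_le_m1[of "2 * n + 1" F ?V] by simp
    then have "real (card (insert ?V F)) \<le> real (2 * n + 1)" by (rule of_nat_mono)
    then have "(real (card (insert ?V F)) + 1) * M * exp (- (\<delta>\<^sup>2 * \<mu>)) \<le>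
        (2 * real n + 2) * M * exp (- (\<delta>\<^sup>2 * \<mu>))"
      by (intro mult_right_mono) auto
    then show "(real (card (insert ?V F)) + 1) * card (parts d J) * exp (- (\<delta>\<^sup>2 * \<mu>)) < 1"
      using small unfolding M_def[symmetric] \<mu>_def by linarith
  qed (use finite_parts \<delta> in \<open>auto simp: F_def parts_def\<close>)
  then obtain \<phi> where \<phi>: "\<And>v. v \<in> ?V \<Longrightarrow> \<phi> v \<in> parts d J"
    "\<And>S c. S \<in> insert ?V F \<Longrightarrow> c \<in> parts d J \<Longrightarrow> (1 - 2 * \<delta>) * (card S / M) \<le> card {v \<in> S. \<phi> v = c}"
    "\<And>c. c \<in> parts d J \<Longrightarrow> card {v \<in> ?V. \<phi> v = c} \<le> (1 + 2 * \<delta>) * (card ?V / M)"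
    unfolding M_def by blast
  show ?thesis
  proof (rule hamilton_of_colouring[where d = d and J = J and p = p and \<kappa> = \<kappa> and \<Lambda> = \<Lambda> and \<phi> = \<phi>,
      folded \<delta>_def M_def])
    show "real (card (E \<inter> X \<times> Y)) \<le> (1 + \<delta>) * p * card X * card Y + \<Lambda> * (real (card X) + card Y)"
      if "X \<subseteq> ?V" "Y \<subseteq> ?V" for X Y using E(2) that by (auto simp: sparse_pairs_def)
    show "(1 - 2 * \<delta>) * (\<kappa> * p * (card ?V / M)) \<le> card (E `` {v} \<inter> {w \<in> ?V. \<phi> w = c}) \<and>
        (1 - 2 * \<delta>) * (\<kappa> * p * (card ?V / M)) \<le> card (E\<inverse> `` {v} \<inter> {w \<in> ?V. \<phi> w = c})"
      if "v \<in> ?V" "c \<in> parts d J" for v c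
    proof -
      have \<delta>2: "0 \<le> 1 - 2 * \<delta>" using d by (simp add: \<delta>_def field_simps)
      have "(1 - 2 * \<delta>) * (\<kappa> * p * (card ?V / M)) \<le> card (S \<inter> {w \<in> ?V. \<phi> w = c})"
        if S: "S \<in> F" "\<kappa> * p * n \<le> card S" for S
      proof -
        have "\<kappa> * p * (card ?V / M) \<le> card S / M" using S(2) M0 by (simp add: divide_right_mono)
        then have "(1 - 2 * \<delta>) * (\<kappa> * p * (card ?V / M)) \<le> (1 - 2 * \<delta>) * (card S / M)"
          using \<delta>2 by (rule mult_left_mono)
        also have "\<dots> \<le> card {v \<in> S. \<phi> v = c}" using \<phi>(2)[of S c] S \<open>c \<in> parts d J\<close> by simp
        also have "{v \<in> S. \<phi> v = c} = S \<inter> {w \<in> ?V. \<phi> w = c}" using S(1) E(1) by (auto simp: F_def)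
        finally show ?thesis .
      qed
      then show ?thesis using that deg by (simp add: F_def)
    qed
    show "(1 - 2 * \<delta>) * (card ?V / M) \<le> card {w \<in> ?V. \<phi> w = c} \<and>
        card {w \<in> ?V. \<phi> w = c} \<le> (1 + 2 * \<delta>) * (card ?V / M)" if "c \<in> parts d J" for c
      using \<phi>(2)[of ?V c] \<phi>(3)[of c] that by simp
  qed (use J d p \<kappa> \<Lambda> M \<phi>(1) in auto)
qed

section \<open>Asymptotics of the parameters\<close>

lemma card_parts_le:
  assumes "J \<ge> 1"
  shows "real (card (parts d J)) \<le> 200 * (real d + 1)\<^sup>2 * real J ^ 3"
proof -
  have J: "real J \<ge> 1" using assms by simp
  have J2: "1 \<le> real J ^ 2" "real J \<le> real J ^ 2" "real J ^ 2 \<le> real J ^ 3" "1 \<le> real J ^ 3"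
    using J power_increasing[of 1 2 "real J"] power_increasing[of 2 3 "real J"] by (simp_all add: one_le_power)
  then have J3: "real J \<le> real J ^ 3" by linarith
  have "real (special_parts d J) = 4 + 12 * real d * (2 * real J ^ 3 + 3 * real J ^ 2 + real J)"
    by (simp add: special_parts_def layer_parts_def algebra_simps power2_eq_square power3_eq_cube)
  also have "\<dots> \<le> 4 * real J ^ 3 + 12 * real d * (2 * real J ^ 3 + 3 * real J ^ 3 + real J ^ 3)"
    using J2 J3 by (intro add_mono mult_left_mono) auto
  also have "\<dots> \<le> 200 * (real d + 1) * real J ^ 3" using J2 by (simp add: algebra_simps)
  finally have "(real d + 1) * real (special_parts d J) \<le> (real d + 1) * (200 * (real d + 1) * real J ^ 3)"
    by (intro mult_left_mono) auto
  then show ?thesis by (simp add: card_parts power2_eq_square algebra_simps)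
qed

text \<open>For m the rounded-up logarithm of n, \<open>J = 2 * m + 1\<close> is odd and
  \<open>2 ^ J = 2 * 4 ^ m\<close> exceeds n, as 4 > e. The number of classes is of order J^3, hence
  eventually below log^4 n.\<close>

lemma eventually_parts_small:
  fixes d :: nat
  shows "eventually (\<lambda>n. (\<exists>J. odd J \<and> n < 2 ^ J \<and> real (card (parts d J)) \<le> ln (real n) ^ 4)) sequentially"
proof -
  define c where "c = 200 * (real d + 1)\<^sup>2"
  have c: "c > 0" unfolding c_def by (intro mult_pos_pos zero_less_power) auto
  have "eventually (\<lambda>n. c * (2 * ln (real n) + 3) ^ 3 \<le> ln (real n) ^ 4) sequentially"
    using c by real_asymp
  moreover have "eventually (\<lambda>n. n \<ge> 1) sequentially" by (rule eventually_ge_at_top)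
  ultimately show ?thesis
  proof eventually_elim
    case (elim n)
    define m where "m = nat \<lceil>ln (real n)\<rceil>"
    define J where "J = 2 * m + 1"
    have ln0: "ln (real n) \<ge> 0" using elim by simp
    have m: "ln (real n) \<le> m" "real m \<le> ln (real n) + 1" using ln0 unfolding m_def by linarith+
    have "real n = exp (ln (real n))" using elim by simp
    also have "\<dots> \<le> exp (real m)" using m by simp
    also have "\<dots> = exp 1 ^ m" by (simp add: exp_of_nat_mult[of m 1, simplified])
    also have "\<dots> \<le> 3 ^ m" using exp_le by (intro power_mono) auto
    also have "\<dots> \<le> (4::real) ^ m" by (intro power_mono) auto
    also have "\<dots> < 2 * 4 ^ m" by simp
    also have "\<dots> = 2 ^ J" by (simp add: J_def power_mult)
    finally have "real n < real (2 ^ J)" by simp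
    then have "n < 2 ^ J" by (simp only: of_nat_less_iff)
    moreover have "real (card (parts d J)) \<le> ln (real n) ^ 4"
    proof -
      have "real J ^ 3 \<le> (2 * ln (real n) + 3) ^ 3" using m by (intro power_mono) (auto simp: J_def)
      then have "c * real J ^ 3 \<le> c * (2 * ln (real n) + 3) ^ 3" using c by (intro mult_left_mono) auto
      moreover have "real (card (parts d J)) \<le> c * real J ^ 3"
        unfolding c_def by (rule card_parts_le) (simp add: J_def)
      ultimately show ?thesis using elim(1) by linarith
    qed
    ultimately show ?case by (intro exI[of _ J]) (simp add: J_def)
  qed
qed

text \<open>With M <= log^4 n classes and p n >= log^8 n these yield, in this order, M <= \<delta> n
  / M, an error \<Lambda> negligible against p n / M, and the union bound for the colouring.\<close>

lemma eventually_log_bounds: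
  fixes \<delta> :: real
  assumes "\<delta> > 0"
  shows "eventually (\<lambda>n. ln (real n) ^ 8 \<le> \<delta> * real n) sequentially"
    "eventually (\<lambda>n. 27 / \<delta> * ln (real n) * ln (real n) ^ 4 \<le> \<delta> * ln (real n) ^ 8) sequentially"
    "eventually (\<lambda>n. (2 * real n + 2) * ln (real n) ^ 4 * exp (- (\<delta>\<^sup>2 * (1 / 2 * ln (real n) ^ 4))) < 1) sequentially"
  using assms by real_asymp+

section \<open>From arc sets to the two bounds on the resilience\<close>

definition digraph_of :: "nat \<Rightarrow> (nat \<times> nat \<Rightarrow> bool) \<Rightarrow> (nat, nat \<times> nat) pre_digraph" where
  "digraph_of n f = \<lparr>verts = {1..n}, arcs = arcs_of n f, tail = fst, head = snd\<rparr>"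

lemma random_digraph_eq: "random_digraph n p = map_pmf (digraph_of n) (random_arcs n p)"
  by (simp add: random_digraph_def random_arcs_def digraph_of_def[abs_def] arcs_of_def)

lemma arcs_of_subset: "arcs_of n f \<subseteq> {1..n} \<times> {1..n}"
  by (auto simp: arcs_of_def arc_pairs_def)

lemma finite_arcs_of: "finite (arcs_of n f)"
  by (simp add: arcs_of_def finite_arc_pairs)

lemma fin_digraph_of: "fin_digraph (digraph_of n f)"
  using arcs_of_subset[of n f] finite_arcs_of[of n f]
  by unfold_locales (auto simp: digraph_of_def)

lemma card_out_image:
  assumes "finite A"
  shows "card (A `` {v}) = card {e \<in> A. fst e = v}"
proof -
  have "{e \<in> A. fst e = v} = Pair v ` (A `` {v})" by force
  then show ?thesis by (simp add: card_image inj_on_def)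
qed

lemma card_in_image:
  assumes "finite A"
  shows "card (A\<inverse> `` {v}) = card {e \<in> A. snd e = v}"
proof -
  have "{e \<in> A. snd e = v} = (\<lambda>w. (w, v)) ` (A\<inverse> `` {v})" by force
  then show ?thesis by (simp add: card_image inj_on_def)
qed

lemma degree_digraph_of:
  "out_degree (digraph_of n f) v = card (arcs_of n f `` {v})"
  "in_degree (digraph_of n f) v = card ((arcs_of n f)\<inverse> `` {v})"
  by (simp_all only: out_degree_def out_arcs_def in_degree_def in_arcs_def digraph_of_def
      card_out_image[OF finite_arcs_of] card_in_image[OF finite_arcs_of] pre_digraph.simps)

text \<open>If the resilience were at most \<open>1 / 2 - b\<close>, an optimal \<open>H\<close>
  would leave a fraction \<open>1 / 2 + b\<close> of every semidegree. The margin \<open>b\<close>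
  pays for 2 / d in \<kappa>, for the deviation 2 \<delta> of the degrees and for n - 1 in place of
  n.\<close>

lemma resilience_lower_bound:
  fixes n d J :: nat and b p \<delta> \<Lambda> :: real
  defines "\<delta> \<equiv> 1 / (8 * real d)" and "M \<equiv> card (parts d J)" and "\<kappa> \<equiv> 1 / 2 + 2 / real d"
  assumes b: "0 < b" "b \<le> 1 / 2" and d: "4 / b \<le> real d" and n: "4 / b \<le> real n"
    and good: "sparse_pairs n p \<delta> \<Lambda> (arcs_of n f)" "degrees_ok n p \<delta> (arcs_of n f)"
    and J: "odd J" "n < 2 ^ J" and p: "0 < p" "p \<le> 1"
    and \<Lambda>: "\<Lambda> \<ge> 0" "9 * \<Lambda> \<le> \<delta> * (p * (n / M))" and M: "real M \<le> \<delta> * (n / M)"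
    and small: "(2 * real n + 2) * M * exp (- (\<delta>\<^sup>2 * (\<kappa> * p * n / M))) < 1"
  shows "1 / 2 - b < local_resilience (digraph_of n f) hamiltonian"
proof (rule ccontr)
  assume neg: "\<not> ?thesis"
  let ?G = "digraph_of n f" and ?V = "{1..n}"
  define E where "E = arcs_of n f"
  define r where "r = local_resilience ?G hamiltonian"
  have r: "0 \<le> r" "r \<le> 1 / 2 - b" "breaks hamiltonian ?G r"
    using neg local_resilience_attained(1,2)[where P = hamiltonian, OF fin_digraph_of not_hamiltonian_no_arcs] by (auto simp: r_def)
  obtain H where H: "subgraph H ?G" "\<not> hamiltonian (delete_arcs ?G H)"
    "\<And>v. v \<in> ?V \<Longrightarrow> real (out_degree H v) \<le> r * real (out_degree ?G v) \<and>
      real (in_degree H v) \<le> r * real (in_degree ?G v)"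
    using r(3) unfolding breaks_def by (auto simp: digraph_of_def)
  define E' where "E' = E - arcs H"
  have HE: "arcs H \<subseteq> E" "tail H = fst" "head H = snd"
    using H(1) by (auto simp: subgraph_def compatible_def digraph_of_def E_def)
  have finE: "finite E" "finite E'" "finite (arcs H)"
    using finite_arcs_of finite_subset[OF HE(1)] by (auto simp: E_def E'_def)
  have E'V: "E' \<subseteq> ?V \<times> ?V" using arcs_of_subset by (auto simp: E'_def E_def)
  have "8 \<le> 4 / b" using b by (simp add: field_simps)
  then have d8: "real d \<ge> 8" using d by linarith
  have n8: "real n \<ge> 8" using n \<open>8 \<le> 4 / b\<close> by linarith
  define t where "t = 1 / real d"
  have t: "0 < t" "t \<le> b / 4" using d d8 b by (auto simp: t_def field_simps)
  have \<delta>t: "\<delta> = t / 8" "\<kappa> = 1 / 2 + 2 * t" by (simp_all add: \<delta>_def t_def \<kappa>_def)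
  have ineq: "\<kappa> * p * n \<le> (1 - r) * x" if x: "(1 - 2 * \<delta>) * (p * (real n - 1)) \<le> x" for x
  proof -
    have "(1 / 2 + b) * (1 - t / 4) \<ge> 1 / 2 + b - t / 4"
    proof -
      have "(1 / 2 + b) * (t / 4) \<le> 1 * (t / 4)" using b t by (intro mult_right_mono) auto
      then show ?thesis by (simp add: algebra_simps)
    qed
    then have "(1 / 2 + b - t / 4) * (real n - 1) \<le> (1 / 2 + b) * (1 - t / 4) * (real n - 1)"
      using n8 by (intro mult_right_mono) auto
    \<comment> \<open>The terms 2 t and t / 4 take at most 9 / 16 of the margin \<open>b\<close>;
      the rest, multiplied by n >= 4 / b, makes up for the lost vertex.\<close>
    moreover have "(1 / 2 + 2 * t) * real n \<le> (1 / 2 + b - t / 4) * (real n - 1)"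
    proof -
      have "1 \<le> b / 4 * real n" using n b by (simp add: field_simps)
      also have "\<dots> \<le> (b - 9 / 4 * t) * real n" using t b by (intro mult_right_mono) auto
      finally have "1 \<le> (b - 9 / 4 * t) * real n" .
      moreover have "(1 / 2 + b - t / 4) * (real n - 1) =
          (1 / 2 + 2 * t) * real n + ((b - 9 / 4 * t) * real n - (1 / 2 + b - t / 4))"
        by (simp add: field_simps)
      ultimately show ?thesis using t b by linarith
    qed
    moreover have "1 - 2 * \<delta> = 1 - t / 4" using \<delta>t by simp
    ultimately have "\<kappa> * real n \<le> (1 / 2 + b) * (1 - 2 * \<delta>) * (real n - 1)"
      unfolding \<delta>t(2) by (simp only:)
    then have "\<kappa> * real n * p \<le> (1 / 2 + b) * (1 - 2 * \<delta>) * (real n - 1) * p"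
      using p by (intro mult_right_mono) auto
    then have "\<kappa> * p * n \<le> (1 / 2 + b) * ((1 - 2 * \<delta>) * (p * (real n - 1)))" by (simp add: mult_ac)
    also have "\<dots> \<le> (1 / 2 + b) * x" using x b by (intro mult_left_mono) auto
    also have "\<dots> \<le> (1 - r) * x"
    proof -
      have "0 \<le> (1 - 2 * \<delta>) * (p * (real n - 1))" using n8 p t b \<delta>t by (intro mult_nonneg_nonneg) auto
      then show ?thesis using r x by (intro mult_right_mono) auto
    qed
    finally show ?thesis .
  qed
  have deg_out: "\<kappa> * p * n \<le> card (E' `` {v})" if v: "v \<in> ?V" for v
  proof -
    have "{e \<in> E'. fst e = v} = {e \<in> E. fst e = v} - {e \<in> arcs H. fst e = v}" by (auto simp: E'_def)
    then have "card (E' `` {v}) = card {e \<in> E. fst e = v} - card {e \<in> arcs H. fst e = v}"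
      unfolding card_out_image[OF finE(2)] using HE(1) finE by (simp only:) (rule card_Diff_subset; auto)
    then have "real (card (E' `` {v})) \<ge> real (card (E `` {v})) - real (out_degree H v)"
      using card_out_image[OF finE(1)] HE by (simp add: out_degree_def out_arcs_def)
    moreover have "real (out_degree H v) \<le> r * card (E `` {v})"
      using H(3)[OF v] by (simp add: degree_digraph_of E_def)
    moreover have "\<kappa> * p * n \<le> (1 - r) * card (E `` {v})"
      by (rule ineq) (use good(2) v in \<open>auto simp: degrees_ok_def E_def\<close>)
    ultimately show ?thesis by (simp add: algebra_simps)
  qed
  have deg_in: "\<kappa> * p * n \<le> card (E'\<inverse> `` {v})" if v: "v \<in> ?V" for v
  proof -
    have "{e \<in> E'. snd e = v} = {e \<in> E. snd e = v} - {e \<in> arcs H. snd e = v}" by (auto simp: E'_def)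
    then have "card (E'\<inverse> `` {v}) = card {e \<in> E. snd e = v} - card {e \<in> arcs H. snd e = v}"
      unfolding card_in_image[OF finE(2)] using HE(1) finE by (simp only:) (rule card_Diff_subset; auto)
    then have "real (card (E'\<inverse> `` {v})) \<ge> real (card (E\<inverse> `` {v})) - real (in_degree H v)"
      using card_in_image[OF finE(1)] HE by (simp add: in_degree_def in_arcs_def)
    moreover have "real (in_degree H v) \<le> r * card (E\<inverse> `` {v})"
      using H(3)[OF v] by (simp add: degree_digraph_of E_def)
    moreover have "\<kappa> * p * n \<le> (1 - r) * card (E\<inverse> `` {v})"
      by (rule ineq) (use good(2) v in \<open>auto simp: degrees_ok_def E_def\<close>)
    ultimately show ?thesis by (simp add: algebra_simps)
  qed
  have sparse: "sparse_pairs n p \<delta> \<Lambda> E'"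
    unfolding sparse_pairs_def
  proof (intro allI impI)
    fix X Y assume XY: "X \<subseteq> ?V" "Y \<subseteq> ?V"
    have "card (E' \<inter> X \<times> Y) \<le> card (E \<inter> X \<times> Y)" using finE by (intro card_mono) (auto simp: E'_def)
    then show "real (card (E' \<inter> X \<times> Y)) \<le> (1 + \<delta>) * p * card X * card Y + \<Lambda> * (real (card X) + card Y)"
      using good(1) XY unfolding sparse_pairs_def E_def by (meson of_nat_mono order_trans)
  qed
  have "\<exists>f. bij_betw f ?V ?V \<and> (\<forall>x\<in>?V. (x, f x) \<in> E') \<and> ?V \<times> ?V \<subseteq> cyc ?V f"
  proof (rule hamilton_deterministic[where d = d and J = J and \<kappa> = \<kappa> and p = p and \<Lambda> = \<Lambda>, folded \<delta>_def M_def])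
    show "\<kappa> \<le> 1" using t b \<delta>t by simp
    show "1 / 2 + 2 / real d \<le> \<kappa>" by (simp add: \<kappa>_def)
  qed (use E'V sparse deg_out deg_in d8 J p \<Lambda> M small in auto)
  then obtain g where g: "bij_betw g ?V ?V" "\<And>x. x \<in> ?V \<Longrightarrow> (x, g x) \<in> E'" "?V \<times> ?V \<subseteq> cyc ?V g"
    by blast
  have "hamiltonian (delete_arcs ?G H)"
    by (rule hamiltonian_of_permutation[of _ ?V g])
      (use g n8 in \<open>auto simp: delete_arcs_def digraph_of_def E'_def E_def\<close>)
  then show False using H(2) by simp
qed

text \<open>No arc of the walk leaves \<open>L\<close>, so a walk that starts in \<open>L\<close>
  stays there, and one that ends outside was never inside. Hence a closed walk lies entirely in
  \<open>L\<close> or entirely outside.\<close>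

lemma cas_one_way:
  assumes G: "tail G = fst" "head G = snd"
    and A: "\<And>x y. (x, y) \<in> A \<Longrightarrow> x \<in> L \<Longrightarrow> y \<in> L"
    and c: "pre_digraph.cas G u c v" "set c \<subseteq> A"
  shows "u \<in> L \<Longrightarrow> set (pre_digraph.awalk_verts G u c) \<subseteq> L"
    and "v \<notin> L \<Longrightarrow> set (pre_digraph.awalk_verts G u c) \<inter> L = {}"
proof -
  have "(u \<in> L \<longrightarrow> set (pre_digraph.awalk_verts G u c) \<subseteq> L) \<and>
      (v \<notin> L \<longrightarrow> u \<notin> L \<and> set (pre_digraph.awalk_verts G u c) \<inter> L = {})"
    using c
  proof (induction c arbitrary: u)
    case Nil
    then show ?case by (simp add: pre_digraph.cas.simps pre_digraph.awalk_verts.simps)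
  next
    case (Cons e c)
    have e: "fst e = u" "pre_digraph.cas G (snd e) c v" "(u, snd e) \<in> A" "set c \<subseteq> A"
      using Cons.prems G by (auto simp: pre_digraph.cas.simps)
    have "set (pre_digraph.awalk_verts G u (e # c)) = insert u (set (pre_digraph.awalk_verts G (snd e) c))"
      using G e(1) by (simp add: pre_digraph.awalk_verts.simps)
    then show ?case using Cons.IH[OF e(2,4)] A[OF e(3)] by auto
  qed
  then show "u \<in> L \<Longrightarrow> set (pre_digraph.awalk_verts G u c) \<subseteq> L"
    "v \<notin> L \<Longrightarrow> set (pre_digraph.awalk_verts G u c) \<inter> L = {}" by blast+
qed

text \<open>The excess \<open>b / 2\<close> over one half pays for the factors 1 + 2 \<delta> and 1
  - 2 \<delta> and for a half of up to (n + 1) / 2 vertices compared with n - 1 possible neighbours;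
  \<open>\<delta> \<le> b / 32\<close> and n >= 6 / b make it sufficient.\<close>

lemma resilience_upper_bound:
  fixes n :: nat and b p \<delta> :: real
  assumes b: "0 < b" "b \<le> 1 / 2" and n: "6 / b \<le> real n" and \<delta>: "0 < \<delta>" "\<delta> \<le> b / 32" and p: "0 \<le> p"
    and good: "degrees_ok n p \<delta> (arcs_of n f)"
  shows "local_resilience (digraph_of n f) hamiltonian \<le> 1 / 2 + b / 2"
proof (rule local_resilience_attained(3)[where P = hamiltonian, OF fin_digraph_of not_hamiltonian_no_arcs])
  let ?G = "digraph_of n f" and ?V = "{1..n}" and ?L = "{1..n div 2}" and ?R = "{n div 2<..n}"
  define E where "E = arcs_of n f"
  define H where "H = ?G\<lparr>arcs := E \<inter> ?L \<times> ?R\<rparr>"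
  have "12 \<le> 6 / b" using b by (simp add: field_simps)
  then have n12: "real n \<ge> 12" using n by linarith
  then have n2: "n \<ge> 2" by simp
  have EV: "E \<subseteq> ?V \<times> ?V" using arcs_of_subset by (simp add: E_def)
  have wf: "wf_digraph ?G" using fin_digraph_of fin_digraph.axioms(1) by blast
  have "wf_digraph H"
    by unfold_locales (use EV in \<open>auto simp: H_def digraph_of_def\<close>)
  then have sub: "subgraph H ?G"
    using wf by (auto simp: subgraph_def compatible_def H_def digraph_of_def E_def)
  have key: "(1 + 2 * \<delta>) * (p * real m) \<le> (1 / 2 + b / 2) * x"
    if m: "real m \<le> (real n + 1) / 2" and x: "(1 - 2 * \<delta>) * (p * (real n - 1)) \<le> x" for m :: nat and x
  proof -
    have "(1 + 2 * \<delta>) * (real n + 1) \<le> (1 + b) * (1 - 2 * \<delta>) * (real n - 1)"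
    proof -
      have d1: "\<delta> * b \<le> b / 32 * 1" using \<delta> b by (intro mult_mono) auto
      have "6 \<le> b * real n" using n b by (simp add: field_simps)
      moreover have "b / 2 \<le> b - 4 * \<delta> - 2 * (\<delta> * b)" using d1 \<delta> by linarith
      then have "b / 2 * real n \<le> (b - 4 * \<delta> - 2 * (\<delta> * b)) * real n" by (intro mult_right_mono) auto
      ultimately have "3 \<le> (b - 4 * \<delta> - 2 * (\<delta> * b)) * real n" by linarith
      moreover have "(1 + b) * (1 - 2 * \<delta>) * (real n - 1) - (1 + 2 * \<delta>) * (real n + 1) =
          (b - 4 * \<delta> - 2 * (\<delta> * b)) * real n - (2 + b - 2 * (\<delta> * b))" by (simp add: algebra_simps)
      moreover have "0 \<le> \<delta> * b" using \<delta> b by simp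
      ultimately show ?thesis using b by linarith
    qed
    then have "(1 + 2 * \<delta>) * (real n + 1) * (p / 2) \<le> (1 + b) * (1 - 2 * \<delta>) * (real n - 1) * (p / 2)"
      using p by (intro mult_right_mono) auto
    moreover have "(1 + 2 * \<delta>) * (p * real m) \<le> (1 + 2 * \<delta>) * (p * ((real n + 1) / 2))"
      using m p \<delta> by (intro mult_left_mono) auto
    ultimately have "(1 + 2 * \<delta>) * (p * real m) \<le> (1 / 2 + b / 2) * ((1 - 2 * \<delta>) * (p * (real n - 1)))"
      by (simp add: algebra_simps)
    also have "\<dots> \<le> (1 / 2 + b / 2) * x" using x b by (intro mult_left_mono) auto
    finally show ?thesis .
  qed
  have card_half: "real (card ?R) \<le> (real n + 1) / 2" "real (card ?L) \<le> (real n + 1) / 2"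
    using of_nat_mono[of "2 * (n div 2)" n, where 'a = real] of_nat_mono[of "2 * (n - n div 2)" "n + 1", where 'a = real]
    by simp_all
  have outH: "real (out_degree H v) \<le> (1 / 2 + b / 2) * real (out_degree ?G v)" if v: "v \<in> ?V" for v
  proof (cases "v \<in> ?L")
    case True
    have "{e \<in> E \<inter> ?L \<times> ?R. fst e = v} = Pair v ` (E `` {v} \<inter> ?R)" using True by force
    then have "out_degree H v = card (E `` {v} \<inter> ?R)"
      by (simp add: out_degree_def out_arcs_def H_def digraph_of_def card_image inj_on_def)
    moreover have "real (card (E `` {v} \<inter> ?R)) \<le> (1 + 2 * \<delta>) * (p * card ?R)"
      using good True by (simp add: degrees_ok_def E_def)
    moreover have "(1 + 2 * \<delta>) * (p * card ?R) \<le> (1 / 2 + b / 2) * real (out_degree ?G v)"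
      by (rule key[OF card_half(1)]) (use good v in \<open>simp add: degrees_ok_def degree_digraph_of\<close>)
    ultimately show ?thesis by linarith
  next
    case False
    then have "{e \<in> E \<inter> ?L \<times> ?R. fst e = v} = {}" by auto
    then have "out_degree H v = 0" by (simp add: out_degree_def out_arcs_def H_def digraph_of_def)
    then show ?thesis using b by simp
  qed
  have inH: "real (in_degree H v) \<le> (1 / 2 + b / 2) * real (in_degree ?G v)" if v: "v \<in> ?V" for v
  proof (cases "v \<in> ?R")
    case True
    have "{e \<in> E \<inter> ?L \<times> ?R. snd e = v} = (\<lambda>w. (w, v)) ` (E\<inverse> `` {v} \<inter> ?L)" using True by force
    then have "in_degree H v = card (E\<inverse> `` {v} \<inter> ?L)"
      by (simp add: in_degree_def in_arcs_def H_def digraph_of_def card_image inj_on_def)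
    moreover have "real (card (E\<inverse> `` {v} \<inter> ?L)) \<le> (1 + 2 * \<delta>) * (p * card ?L)"
      using good True by (simp add: degrees_ok_def E_def)
    moreover have "(1 + 2 * \<delta>) * (p * card ?L) \<le> (1 / 2 + b / 2) * real (in_degree ?G v)"
      by (rule key[OF card_half(2)]) (use good v in \<open>simp add: degrees_ok_def degree_digraph_of\<close>)
    ultimately show ?thesis by linarith
  next
    case False
    then have "{e \<in> E \<inter> ?L \<times> ?R. snd e = v} = {}" by auto
    then have "in_degree H v = 0" by (simp add: in_degree_def in_arcs_def H_def digraph_of_def)
    then show ?thesis using b by simp
  qed
  have "\<not> hamiltonian (delete_arcs ?G H)"
  proof
    let ?D = "delete_arcs ?G H"
    assume "hamiltonian ?D"
    then obtain u c where c: "pre_digraph.awalk ?D u c u" "set (pre_digraph.awalk_verts ?D u c) = ?V"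
      by (auto simp: hamiltonian_def delete_arcs_def digraph_of_def)
    have D: "tail ?D = fst" "head ?D = snd" by (simp_all add: delete_arcs_def digraph_of_def)
    have cas: "pre_digraph.cas ?D u c u" and sc: "set c \<subseteq> E - ?L \<times> ?R"
      using c(1) by (auto simp: pre_digraph.awalk_def delete_arcs_def H_def digraph_of_def E_def)
    have one_way: "y \<in> ?L" if "(x, y) \<in> E - ?L \<times> ?R" "x \<in> ?L" for x y using that EV by auto
    have "1 \<in> ?L" "n \<in> ?V" "n \<notin> ?L" "1 \<in> ?V" using n2 by auto
    moreover have "u \<in> ?L \<Longrightarrow> ?V \<subseteq> ?L" "u \<notin> ?L \<Longrightarrow> ?V \<inter> ?L = {}"
      using cas_one_way[where L = ?L and A = "E - ?L \<times> ?R", OF D _ cas sc] one_way c(2) by auto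
    ultimately show False by blast
  qed
  then show "breaks hamiltonian ?G (1 / 2 + b / 2)"
    unfolding breaks_def using sub outH inH by (intro exI[of _ H]) (auto simp: digraph_of_def)
  show "0 \<le> 1 / 2 + b / 2" using b by simp
qed

theorem theorem1p3:
  fixes \<beta> :: real and p :: "nat \<Rightarrow> real"
  assumes "\<beta> > 0"
    and "\<And>n. 0 \<le> p n \<and> p n \<le> 1"
    and "p \<in> \<omega>(\<lambda>n. ln (real n) ^ 8 / real n)"
  shows "(\<lambda>n. measure_pmf.prob (random_digraph n (p n))
            {G. local_resilience G hamiltonian \<in> {1/2 - \<beta> <..< 1/2 + \<beta>}})
         \<longlonglongrightarrow> 1"
proof -
  \<comment> \<open>Both estimates then stay inside the open interval: the lower one is strict, and
    b / 2 < \<beta>.\<close>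
  define b where "b = min \<beta> (1 / 2)"
  have b: "0 < b" "b \<le> 1 / 2" "b \<le> \<beta>" using assms(1) by (auto simp: b_def)
  define d where "d = nat \<lceil>4 / b\<rceil>"
  have d: "4 / b \<le> real d" unfolding d_def using b by linarith
  have "8 \<le> 4 / b" using b by (simp add: field_simps)
  then have d8: "real d \<ge> 8" using d by linarith
  define \<delta> where "\<delta> = 1 / (8 * real d)"
  have \<delta>: "0 < \<delta>" "\<delta> \<le> 1" using d8 by (auto simp: \<delta>_def)
  have \<delta>b: "\<delta> \<le> b / 32"
    using d d8 b by (simp add: \<delta>_def field_simps)
  \<comment> \<open>The two failure probabilities with \<open>p n\<close> replaced by its eventual
    lower bound, in which the second one is decreasing.\<close>
  define err where "err n = (exp (1 / (real n)\<^sup>2) - 1)\<^sup>2 +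
    3 * real n * exp (- (\<delta>\<^sup>2 * (ln (real n) ^ 8 / real n * (real n - 1) / 2)))" for n :: nat
  have "(\<lambda>n. (exp (1 / (real n)\<^sup>2) - 1)\<^sup>2 +
    3 * real n * exp (- (\<delta>\<^sup>2 * (ln (real n) ^ 8 / real n * (real n - 1) / 2)))) \<longlonglongrightarrow> 0"
    using \<delta> by real_asymp
  then have err: "(\<lambda>n. 1 - err n) \<longlonglongrightarrow> 1"
    unfolding err_def[symmetric] by (auto intro!: tendsto_eq_intros)
  \<comment> \<open>The growth hypothesis is applied with the constant 1.\<close>
  have "eventually (\<lambda>n. 1 * norm (ln (real n) ^ 8 / real n) \<le> norm (p n)) sequentially"
    using landau_omega.smallD[OF assms(3) zero_less_one] by simp
  moreover have "eventually (\<lambda>n. n \<ge> 3) sequentially" by (rule eventually_ge_at_top)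
  moreover have "eventually (\<lambda>n. real n \<ge> 6 / b) sequentially" by real_asymp
  moreover note eventually_parts_small[of d]
  moreover note eventually_log_bounds[OF \<delta>(1)]
  ultimately have "eventually (\<lambda>n. 1 - err n \<le> measure_pmf.prob (random_digraph n (p n))
            {G. local_resilience G hamiltonian \<in> {1/2 - \<beta> <..< 1/2 + \<beta>}}) sequentially"
  proof eventually_elim
    case (elim n)
    define L where "L = ln (real n)"
    define \<Lambda> where "\<Lambda> = 3 / \<delta> * L"
    have L: "L > 0" unfolding L_def using elim(2) by simp
    have p: "L ^ 8 / real n \<le> p n" "0 \<le> p n" "p n \<le> 1"
      using elim(1) assms(2)[of n] by (auto simp: L_def)
    have pn: "L ^ 8 \<le> p n * real n" using p(1) elim(2) by (simp add: field_simps)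
    have p0: "0 < p n"
    proof -
      have "0 < L ^ 8 / real n" using L elim(2) by simp
      then show ?thesis using p(1) by linarith
    qed
    obtain J where J: "odd J" "n < 2 ^ J" "real (card (parts d J)) \<le> L ^ 4"
      using elim(4) by (auto simp: L_def)
    define M where "M = card (parts d J)"
    have "card (parts d J) > 0" using d8 by (simp add: card_parts special_parts_def)
    then have M: "0 < real M" "real M \<le> L ^ 4" using J(3) by (auto simp: M_def)
    have MM: "real M * real M \<le> L ^ 8"
    proof -
      have "real M * real M \<le> L ^ 4 * L ^ 4" using M by (intro mult_mono) auto
      then show ?thesis by (simp flip: power_add)
    qed
    have c1: "real M \<le> \<delta> * (n / M)"
      using MM elim(5) M(1) by (simp add: L_def field_simps)
    have c2: "9 * \<Lambda> \<le> \<delta> * (p n * (n / M))"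
    proof -
      have "27 / \<delta> * L * real M \<le> 27 / \<delta> * L * L ^ 4" using M L \<delta> by (intro mult_left_mono) auto
      also have "\<dots> \<le> \<delta> * L ^ 8" using elim(6) by (simp add: L_def)
      also have "\<dots> \<le> \<delta> * (p n * real n)" using pn \<delta> by (intro mult_left_mono) auto
      finally have "27 / \<delta> * L * real M \<le> \<delta> * (p n * real n)" .
      moreover have "9 * \<Lambda> = 27 / \<delta> * L" by (simp add: \<Lambda>_def)
      ultimately have "9 * \<Lambda> * real M \<le> \<delta> * (p n * real n)" by simp
      then have "9 * \<Lambda> \<le> \<delta> * (p n * real n) / real M" using M(1) by (simp add: pos_le_divide_eq)
      then show ?thesis by simp
    qed
    define \<kappa> where "\<kappa> = 1 / 2 + 2 / real d"
    have c3: "(2 * real n + 2) * M * exp (- (\<delta>\<^sup>2 * (\<kappa> * p n * n / M))) < 1"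
    proof -
      have "L ^ 4 \<le> p n * real n / M"
      proof -
        have "L ^ 4 * real M \<le> L ^ 4 * L ^ 4" using M L by (intro mult_left_mono) auto
        also have "\<dots> = L ^ 8" by (simp flip: power_add)
        finally show ?thesis using pn M(1) by (simp add: pos_le_divide_eq)
      qed
      then have "1 / 2 * L ^ 4 \<le> \<kappa> * (p n * real n / M)"
        using p M L by (intro mult_mono) (auto simp: \<kappa>_def)
      then have "\<delta>\<^sup>2 * (1 / 2 * L ^ 4) \<le> \<delta>\<^sup>2 * (\<kappa> * (p n * real n / M))" by (intro mult_left_mono) auto
      then have "exp (- (\<delta>\<^sup>2 * (\<kappa> * p n * n / M))) \<le> exp (- (\<delta>\<^sup>2 * (1 / 2 * L ^ 4)))"
        by (simp add: mult.assoc)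
      then have "(2 * real n + 2) * M * exp (- (\<delta>\<^sup>2 * (\<kappa> * p n * n / M))) \<le>
          (2 * real n + 2) * L ^ 4 * exp (- (\<delta>\<^sup>2 * (1 / 2 * L ^ 4)))"
        using M L by (intro mult_mono) auto
      also have "\<dots> < 1" using elim(7) by (simp only: L_def)
      finally show ?thesis .
    qed
    have n4: "4 / b \<le> real n"
    proof -
      have "4 / b \<le> 6 / b" using b by (simp add: divide_right_mono)
      then show ?thesis using elim(3) by linarith
    qed
    have \<Lambda>0: "\<Lambda> \<ge> 0" using L \<delta> by (simp add: \<Lambda>_def)
    define Bad where "Bad = {f. \<not> sparse_pairs n (p n) \<delta> \<Lambda> (arcs_of n f)} \<union>
      {f. \<not> degrees_ok n (p n) \<delta> (arcs_of n f)}"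
    let ?Q = "random_arcs n (p n)"
    have good: "local_resilience (digraph_of n f) hamiltonian \<in> {1/2 - \<beta> <..< 1/2 + \<beta>}" if "f \<notin> Bad" for f
    proof -
      have sp: "sparse_pairs n (p n) \<delta> \<Lambda> (arcs_of n f)" and dg: "degrees_ok n (p n) \<delta> (arcs_of n f)"
        using that by (auto simp: Bad_def)
      have "1 / 2 - b < local_resilience (digraph_of n f) hamiltonian"
        by (rule resilience_lower_bound[OF b(1,2) d n4 sp[unfolded \<delta>_def] dg[unfolded \<delta>_def] J(1,2) p0 p(3) \<Lambda>0])
          (use c1 c2 c3 in \<open>simp_all add: \<delta>_def M_def \<kappa>_def\<close>)
      moreover have "local_resilience (digraph_of n f) hamiltonian \<le> 1 / 2 + b / 2"
        by (rule resilience_upper_bound[OF b(1,2) elim(3) \<delta>(1) \<delta>b p(2) dg])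
      ultimately show ?thesis using b by simp
    qed
    have "measure_pmf.prob ?Q Bad \<le> (exp (1 / (real n)\<^sup>2) - 1)\<^sup>2 +
        3 * real n * exp (- (\<delta>\<^sup>2 * (p n * (real n - 1) / 2)))"
      unfolding Bad_def \<Lambda>_def L_def
      by (rule order_trans[OF prob_Un_le add_mono[OF prob_not_sparse_pairs prob_not_degrees_ok]])
        (use elim(2) p \<delta> in auto)
    also have "\<dots> \<le> err n"
    proof -
      have "L ^ 8 / real n * (real n - 1) / 2 \<le> p n * (real n - 1) / 2"
        using p(1) elim(2) by (intro divide_right_mono mult_right_mono) auto
      then have "\<delta>\<^sup>2 * (L ^ 8 / real n * (real n - 1) / 2) \<le> \<delta>\<^sup>2 * (p n * (real n - 1) / 2)"
        by (intro mult_left_mono) auto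
      then show ?thesis unfolding err_def L_def[symmetric]
        by (intro add_left_mono mult_left_mono) auto
    qed
    finally have "1 - err n \<le> 1 - measure_pmf.prob ?Q Bad" by simp
    also have "\<dots> = measure_pmf.prob ?Q (- Bad)"
      using measure_pmf.prob_compl[of Bad ?Q] by (simp add: Compl_eq_Diff_UNIV)
    also have "\<dots> \<le> measure_pmf.prob ?Q (digraph_of n -` {G. local_resilience G hamiltonian \<in> {1/2 - \<beta> <..< 1/2 + \<beta>}})"
      by (rule measure_pmf.finite_measure_mono) (use good in auto)
    finally show ?case by (simp add: random_digraph_eq measure_map_pmf)
  qed
  then show ?thesis
    by (rule tendsto_sandwich[OF _ _ err tendsto_const]) simp
qed


end
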